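(* If $D$ is a purely balanced geodesic in $G$, then $\sharp(D)=\Xi_D$; that is, the set of $\lambda\in D$ such that $T_\lambda D=\sharp_\lambda$ is the simple real geodesic in $D$ whose endpoints are the two royal points of $D$.
   Context: $\mathbb{D}$ is the open unit disc and $\mathbb{T}$ the unit circle in $\mathbb{C}$. $G=\{(z+w,zw): |z|<1,|w|<1\}\subset\mathbb{C}^2$ is the symmetrized bidisc. A geodesic (that is, complex geodesic) in $G$ is a set $D=h(\mathbb{D})$ where $h:\mathbb{D}\to G$ is holomorphic and has a holomorphic left inverse $\Phi:G\to\mathbb{D}$, $\Phi\circ h=\mathrm{id}_{\mathbb{D}}$; such $h$ is known to be rational and to extend holomorphically to a neighbourhood of $\mathbb{D}^-$. If $\lambda=h(z)\in D$, the complex tangent space is $T_\lambda D=\mathbb{C}\,h'(z)\subset\mathbb{C}^2$. The royal variety is $\mathcal{R}=\{(2z,z^2):z\in\mathbb{D}\}$, and $\partial\mathcal{R}=\{(2z,z^2):z\in\mathbb{T}\}$. The royal points of a geodesic $D$ are the elements of $D^-\cap\mathcal{R}^-$ (closures in $\mathbb{C}^2$). $D$ is purely balanced if it has exactly two royal points, and both lie in $\partial\mathcal{R}$. Sharp direction: let $\mathrm{Orb}(\lambda)$ be the orbit of $\lambda\in G$ under the group $\mathrm{Aut}\,G$ of biholomorphic self-maps of $G$. It is known that $\mathrm{Orb}(\lambda)=\mathcal{R}$ if $\lambda\in\mathcal{R}$, and $\mathrm{Orb}(\lambda)$ is a smooth properly embedded real 3-dimensional submanifold of $G$ if $\lambda\notin\mathcal{R}$.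 In both cases the real tangent space to $\mathrm{Orb}(\lambda)$ at $\lambda$ contains a unique one-dimensional complex subspace of $\mathbb{C}^2$, denoted $\sharp_\lambda$. For a geodesic $D$, $\sharp(D)=\{\lambda\in D: T_\lambda D=\sharp_\lambda\}$ (equivalently, the set of $\lambda\in D$ at which $D$ is orthogonal to the unique flat geodesic through $\lambda$). A real hyperbolic geodesic $C$ in $\mathbb{D}$ is a full Poincaré geodesic (the intersection with $\mathbb{D}$ of a line or circle orthogonal to $\mathbb{T}$). A simple real geodesic in $G$ is a set $h(C)$ where $h:\mathbb{D}\to G$ is a holomorphic map having a holomorphic left inverse $\Phi:G\to\mathbb{D}$, $\Phi\circ h=\mathrm{id}_{\mathbb{D}}$ (so that $h$ parametrizes the complex geodesic $h(\mathbb{D})$), and $C$ is a real hyperbolic geodesic in $\mathbb{D}$; its endpoints are the images under (the extension of) $h$ of the two endpoints of $C$ in $\mathbb{T}$. For a purely balanced geodesic $D$, $\Xi_D$ denotes the unique simple real geodesic contained in $D$ whose endpoints are the royal points of $D$; explicitly, writing $D=h(\mathbb{D})$, $\Xi_D=h(C)$ where $C$ is the real hyperbolic geodesic in $\mathbb{D}$ whose endpoints are the two points of $\mathbb{T}$ mapped by $h$ to the royal points of $D$. *)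

theory Defs
  imports "HOL-Complex_Analysis.Complex_Analysis"
begin

definition sym_bidisc :: "(complex \<times> complex) set" where
  "sym_bidisc = {(z + w, z * w) | z w. norm z < 1 \<and> norm w < 1}"


section \<open>Holomorphic maps into and out of two-dimensional complex space\<close>

definition cscale :: "complex \<Rightarrow> complex \<times> complex \<Rightarrow> complex \<times> complex" where
  "cscale c v = (c * fst v, c * snd v)"

definition holo_curve_on :: "(complex \<Rightarrow> complex \<times> complex) \<Rightarrow> complex set \<Rightarrow> bool" where
  "holo_curve_on h S \<longleftrightarrow> (\<lambda>z. fst (h z)) holomorphic_on S \<and> (\<lambda>z. snd (h z)) holomorphic_on S"

definition curve_deriv :: "(complex \<Rightarrow> complex \<times> complex) \<Rightarrow> complex \<Rightarrow> complex \<times> complex" where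
  "curve_deriv h z = (deriv (\<lambda>\<zeta>. fst (h \<zeta>)) z, deriv (\<lambda>\<zeta>. snd (h \<zeta>)) z)"

text \<open>Complex differentiability in two variables: the real Frechet derivative exists and is
  complex linear, that is, of the form \<open>v \<mapsto> a v\<^sub>1 + b v\<^sub>2\<close> with complex \<open>a\<close>, \<open>b\<close>.\<close>

definition holo2_on :: "(complex \<times> complex \<Rightarrow> complex) \<Rightarrow> (complex \<times> complex) set \<Rightarrow> bool" where
  "holo2_on f S \<longleftrightarrow>
     (\<forall>p\<in>S. \<exists>a b. (f has_derivative (\<lambda>v. a * fst v + b * snd v)) (at p within S))"

definition holo_map_on ::
    "(complex \<times> complex \<Rightarrow> complex \<times> complex) \<Rightarrow> (complex \<times> complex) set \<Rightarrow> bool" where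
  "holo_map_on f S \<longleftrightarrow> holo2_on (\<lambda>p. fst (f p)) S \<and> holo2_on (\<lambda>p. snd (f p)) S"


section \<open>Complex geodesics and royal points\<close>

definition geodesic_param :: "(complex \<Rightarrow> complex \<times> complex) \<Rightarrow> bool" where
  "geodesic_param h \<longleftrightarrow>
     holo_curve_on h (ball 0 1) \<and> h ` ball 0 1 \<subseteq> sym_bidisc \<and>
     (\<exists>\<Phi>. holo2_on \<Phi> sym_bidisc \<and> \<Phi> ` sym_bidisc \<subseteq> ball 0 1 \<and>
          (\<forall>z\<in>ball 0 1. \<Phi> (h z) = z))"

definition complex_geodesic :: "(complex \<times> complex) set \<Rightarrow> bool" where
  "complex_geodesic D \<longleftrightarrow> (\<exists>h. geodesic_param h \<and> D = h ` ball 0 1)"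

text \<open>Two parametrizations of \<open>D\<close> differ by an automorphism of the disc, so the following set is
  the single complex line spanned by \<open>h'(z)\<close>, for any one choice of \<open>h\<close>.\<close>

definition geodesic_tangent ::
    "(complex \<times> complex) set \<Rightarrow> complex \<times> complex \<Rightarrow> (complex \<times> complex) set" where
  "geodesic_tangent D p =
     {cscale c (curve_deriv h z) | c h z.
        geodesic_param h \<and> D = h ` ball 0 1 \<and> z \<in> ball 0 1 \<and> h z = p}"

definition royal_variety :: "(complex \<times> complex) set" where
  "royal_variety = (\<lambda>z. (2 * z, z\<^sup>2)) ` ball 0 1"

definition royal_boundary :: "(complex \<times> complex) set" where
  "royal_boundary = (\<lambda>z. (2 * z, z\<^sup>2)) ` sphere 0 1"

definition royal_points :: "(complex \<times> complex) set \<Rightarrow> (complex \<times> complex) set" where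
  "royal_points D = closure D \<inter> closure royal_variety"

definition purely_balanced :: "(complex \<times> complex) set \<Rightarrow> bool" where
  "purely_balanced D \<longleftrightarrow> card (royal_points D) = 2 \<and> royal_points D \<subseteq> royal_boundary"


section \<open>The sharp direction\<close>

definition Aut_sym_bidisc :: "(complex \<times> complex \<Rightarrow> complex \<times> complex) set" where
  "Aut_sym_bidisc = {f. bij_betw f sym_bidisc sym_bidisc \<and> holo_map_on f sym_bidisc \<and>
                        holo_map_on (inv_into sym_bidisc f) sym_bidisc}"

definition Orb :: "complex \<times> complex \<Rightarrow> (complex \<times> complex) set" where
  "Orb p = {f p | f. f \<in> Aut_sym_bidisc}"

text \<open>Velocities at \<open>p\<close> of \<open>C\<^sup>1\<close> curves in \<open>M\<close> through \<open>p\<close>; for an embedded submanifold \<open>M\<close>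
  this is the usual tangent space.\<close>

definition real_tangent_space ::
    "(complex \<times> complex) set \<Rightarrow> complex \<times> complex \<Rightarrow> (complex \<times> complex) set" where
  "real_tangent_space M p =
     {v. \<exists>(\<gamma> :: real \<Rightarrow> complex \<times> complex) \<epsilon>. \<epsilon> > 0 \<and> \<gamma> C1_differentiable_on {-\<epsilon><..<\<epsilon>} \<and>
           \<gamma> ` {-\<epsilon><..<\<epsilon>} \<subseteq> M \<and> \<gamma> 0 = p \<and> (\<gamma> has_vector_derivative v) (at 0)}"

definition complex_line :: "(complex \<times> complex) set \<Rightarrow> bool" where
  "complex_line L \<longleftrightarrow> (\<exists>v. v \<noteq> 0 \<and> L = range (\<lambda>c. cscale c v))"

definition sharp_direction :: "complex \<times> complex \<Rightarrow> (complex \<times> complex) set" where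
  "sharp_direction p = (THE L. complex_line L \<and> L \<subseteq> real_tangent_space (Orb p) p)"

definition sharp_set :: "(complex \<times> complex) set \<Rightarrow> (complex \<times> complex) set" where
  "sharp_set D = {p \<in> D. geodesic_tangent D p = sharp_direction p}"


section \<open>Simple real geodesics\<close>

text \<open>Two circles are orthogonal if their radii at the common points are; a line is orthogonal to
  the unit circle iff it passes through the centre \<open>0\<close>.\<close>

definition circle_orthogonal_to_unit :: "complex set \<Rightarrow> bool" where
  "circle_orthogonal_to_unit K \<longleftrightarrow>
     (\<exists>a r. r > 0 \<and> K = sphere a r \<and> K \<inter> sphere 0 1 \<noteq> {} \<and>
            (\<forall>z \<in> K \<inter> sphere 0 1. orthogonal (z - a) z))"

definition line_orthogonal_to_unit :: "complex set \<Rightarrow> bool" where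
  "line_orthogonal_to_unit K \<longleftrightarrow> (\<exists>u. u \<noteq> 0 \<and> K = span {u})"

definition real_hyperbolic_geodesic :: "complex set \<Rightarrow> bool" where
  "real_hyperbolic_geodesic C \<longleftrightarrow>
     (\<exists>K. (line_orthogonal_to_unit K \<or> circle_orthogonal_to_unit K) \<and> C = K \<inter> ball 0 1)"

definition hyperbolic_endpoints :: "complex set \<Rightarrow> complex set" where
  "hyperbolic_endpoints C = closure C \<inter> sphere 0 1"

text \<open>\<open>g\<close> is a holomorphic extension of \<open>h\<close> to a neighbourhood of the closed unit disc. Every
  parametrization of a geodesic has one, and its values on the closed disc are unique.\<close>

definition holo_extension ::
    "(complex \<Rightarrow> complex \<times> complex) \<Rightarrow> (complex \<Rightarrow> complex \<times> complex) \<Rightarrow> bool" where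
  "holo_extension h g \<longleftrightarrow>
     (\<exists>S. open S \<and> cball 0 1 \<subseteq> S \<and> holo_curve_on g S) \<and> (\<forall>z\<in>ball 0 1. g z = h z)"

definition simple_real_geodesic_with_endpoints ::
    "(complex \<times> complex) set \<Rightarrow> (complex \<times> complex) set \<Rightarrow> bool" where
  "simple_real_geodesic_with_endpoints E P \<longleftrightarrow>
     (\<exists>h g C. geodesic_param h \<and> holo_extension h g \<and> real_hyperbolic_geodesic C \<and>
              E = h ` C \<and> P = g ` hyperbolic_endpoints C)"

definition Xi :: "(complex \<times> complex) set \<Rightarrow> (complex \<times> complex) set" where
  "Xi D = (THE E. E \<subseteq> D \<and> simple_real_geodesic_with_endpoints E (royal_points D))"

end

theory Submission
  imports Defs
begin

text \<open>
  Write points of the symmetrized bidisc as \<open>sympair z w = (z + w, zw)\<close>. The proof reduces everything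
  to the pair \<open>{z, w}\<close> of roots, on which the automorphisms act through automorphisms of the disc.

  \<^emph>\<open>The geodesic.\<close> The royal points of a purely balanced geodesic \<open>D\<close> lie on the boundary, so \<open>D\<close>
  does not meet the royal variety and a parametrization lifts to a pair \<open>(f\<^sub>1, f\<^sub>2)\<close> of holomorphic
  maps of the disc. Its left inverse, composed with \<open>sympair\<close>, is a symmetric left inverse of
  \<open>(f\<^sub>1, f\<^sub>2)\<close> on the bidisc. On the bidisc a left inverse of a geodesic with one non-automorphic
  component depends only on the other coordinate, and such a function is not symmetric; hence both
  \<open>f\<^sub>1\<close> and \<open>f\<^sub>2\<close> are automorphisms of the disc (\<open>geodesic_off_royal_variety\<close>), and the royal points are
  the images of the two points of the circle where \<open>f\<^sub>1 = f\<^sub>2\<close>.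

  \<^emph>\<open>The sharp direction.\<close> An automorphism carries tangent lines of the royal variety to such
  lines, because discs in the boundary of the domain lie on these lines; hence it is
  \<open>sympair z w \<mapsto> sympair (m z) (m w)\<close> for an automorphism \<open>m\<close> of the disc
  (\<open>automorphism_of_sym_bidisc\<close>). So the orbit of \<open>sympair z w\<close> lies in a level set of the
  pseudo-hyperbolic distance of the roots, a real hypersurface, and the complex line in its tangent
  space is found from the infinitesimal automorphisms of the disc (\<open>sharp_direction_sympair\<close>).

  \<^emph>\<open>The comparison.\<close> The tangent \<open>(f\<^sub>1', f\<^sub>2')\<close> points in the sharp direction exactly if the numerator
  of \<open>1 - f\<^sub>1\<^sup>*f\<^sub>2\<close> is real (\<open>sharp_iff_pair_form_real\<close>). This numerator has the form
  \<open>\<kappa> - \<kappa>\<^sup>*\<bar>z\<bar>\<^sup>2 + 2\<i> Im(\<delta>z)\<close>, so the condition \<open>Im \<kappa> (1 + \<bar>z\<bar>\<^sup>2) + 2 Im(\<delta>z) = 0\<close> describes a line or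
  circle orthogonal to the unit circle. On the unit circle the numerator is imaginary, so there the
  same condition says that it vanishes, which means \<open>f\<^sub>1 = f\<^sub>2\<close>: the endpoints are the royal nodes.

  That only one simple real geodesic in \<open>D\<close> has the royal points as endpoints follows from the
  identity theorem, by which it is parametrized by a parametrization of \<open>D\<close>, and from the fact
  that a real hyperbolic geodesic of the disc is determined by its endpoints.
\<close>

section \<open>Automorphisms of the disc\<close>

lemma of_real_cmod_square: "(complex_of_real (cmod z))\<^sup>2 = z * cnj z"
  by (metis complex_norm_square of_real_power)

text \<open>For \<open>\<bar>b\<bar> < \<bar>a\<bar>\<close> these are the automorphisms of the disc. The pair \<open>(a, b)\<close> is left unnormalized,
  so that automorphisms near the identity can be written without square roots.\<close>

definition mob :: "complex \<Rightarrow> complex \<Rightarrow> complex \<Rightarrow> complex" where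
  "mob a b z = (a * z + b) / (cnj b * z + cnj a)"

lemma mob_denom_nonzero:
  assumes "cmod b < cmod a" "cmod z \<le> 1"
  shows "cnj b * z + cnj a \<noteq> 0"
proof
  assume "cnj b * z + cnj a = 0"
  then have "cnj a = - (cnj b * z)"
    by (simp add: add_eq_0_iff)
  then have "cmod a = cmod b * cmod z"
    by (metis complex_mod_cnj norm_minus_cancel norm_mult)
  also have "\<dots> \<le> cmod b"
    using assms by (simp add: mult_left_le)
  finally show False
    using assms by simp
qed

lemma mob_det_pos:
  assumes "cmod b < cmod a"
  shows "a * cnj a - b * cnj b = of_real ((cmod a)\<^sup>2 - (cmod b)\<^sup>2)" "(cmod a)\<^sup>2 - (cmod b)\<^sup>2 > 0"
        "a * cnj a - b * cnj b \<noteq> 0"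
proof -
  show 1: "a * cnj a - b * cnj b = of_real ((cmod a)\<^sup>2 - (cmod b)\<^sup>2)"
    by (simp add: of_real_cmod_square)
  show 2: "(cmod a)\<^sup>2 - (cmod b)\<^sup>2 > 0"
    using assms power_strict_mono[of "cmod b" "cmod a" 2] by simp
  show "a * cnj a - b * cnj b \<noteq> 0"
    unfolding 1 using 2 by (metis less_irrefl of_real_eq_0_iff)
qed

text \<open>Up to a factor in \<open>z\<close> and a factor in \<open>w\<close> the hermitian form \<open>1 - z\<^sup>*w\<close> is preserved. For \<open>z = w\<close>
  this shows that the disc and the circle are mapped to themselves, and together with \<open>mob_diff\<close>
  it gives the invariance of the pseudo-hyperbolic distance.\<close>

lemma mob_kernel:
  assumes "cmod b < cmod a" "cmod z \<le> 1" "cmod w \<le> 1"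
  shows "1 - cnj (mob a b z) * mob a b w =
    (a * cnj a - b * cnj b) * (1 - cnj z * w) / (cnj (cnj b * z + cnj a) * (cnj b * w + cnj a))"
proof -
  have "cnj b * w + cnj a \<noteq> 0" "cnj (cnj b * z + cnj a) \<noteq> 0"
    using mob_denom_nonzero[OF assms(1)] assms(2,3) by (auto simp del: complex_cnj_add)
  then have "cnj b * w + cnj a \<noteq> 0" "b * cnj z + a \<noteq> 0"
    by auto
  then show ?thesis
    unfolding mob_def by (simp add: divide_simps) (simp add: algebra_simps)
qed

lemma mob_norm:
  assumes "cmod b < cmod a" "cmod z \<le> 1"
  shows "1 - (cmod (mob a b z))\<^sup>2 =
    ((cmod a)\<^sup>2 - (cmod b)\<^sup>2) * (1 - (cmod z)\<^sup>2) / (cmod (cnj b * z + cnj a))\<^sup>2"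
proof -
  have "complex_of_real (1 - (cmod (mob a b z))\<^sup>2) = 1 - cnj (mob a b z) * mob a b z"
    by (simp add: of_real_cmod_square)
  also have "\<dots> = complex_of_real (((cmod a)\<^sup>2 - (cmod b)\<^sup>2) * (1 - (cmod z)\<^sup>2)
      / (cmod (cnj b * z + cnj a))\<^sup>2)"
    unfolding mob_kernel[OF assms assms(2)]
    by (simp add: of_real_cmod_square mult.commute)
  finally show ?thesis
    using of_real_eq_iff by blast
qed

lemma mob_less_1:
  assumes "cmod b < cmod a" "cmod z < 1"
  shows "cmod (mob a b z) < 1"
proof -
  have "1 - (cmod (mob a b z))\<^sup>2 > 0"
    unfolding mob_norm[OF assms(1) less_imp_le[OF assms(2)]]
    using mob_det_pos(2)[OF assms(1)] assms(2) mob_denom_nonzero[OF assms(1) less_imp_le[OF assms(2)]]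
    by (intro divide_pos_pos mult_pos_pos) (auto simp: power_less_one_iff)
  then show ?thesis
    by (simp add: power_less_one_iff)
qed

lemma mob_sphere:
  assumes "cmod b < cmod a" "cmod z = 1"
  shows "cmod (mob a b z) = 1"
proof -
  have "1 - (cmod (mob a b z))\<^sup>2 = 0"
    by (subst mob_norm) (use assms in auto)
  then show ?thesis
    by (simp add: power2_eq_1_iff) (smt (verit) norm_ge_zero)
qed

lemma mob_diff:
  assumes "cmod b < cmod a" "cmod z \<le> 1" "cmod w \<le> 1"
  shows "mob a b z - mob a b w =
    (a * cnj a - b * cnj b) * (z - w) / ((cnj b * z + cnj a) * (cnj b * w + cnj a))"
  using mob_denom_nonzero[OF assms(1)] assms(2,3)
  unfolding mob_def by (simp add: divide_simps) (simp add: algebra_simps)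

lemma mob_inj:
  assumes "cmod b < cmod a" "cmod z \<le> 1" "cmod w \<le> 1" "mob a b z = mob a b w"
  shows "z = w"
  using mob_diff[OF assms(1-3)] assms(4) mob_det_pos(3)[OF assms(1)]
    mob_denom_nonzero[OF assms(1)] assms(2,3) by auto

lemma mob_inverse:
  assumes "cmod b < cmod a" "cmod z \<le> 1"
  shows "mob (cnj a) (- b) (mob a b z) = z"
proof -
  have nz: "cnj b * z + cnj a \<noteq> 0"
    by (rule mob_denom_nonzero[OF assms])
  have "mob (cnj a) (- b) (mob a b z) =
      (cnj a * (a * z + b) - b * (cnj b * z + cnj a)) / (a * (cnj b * z + cnj a) - cnj b * (a * z + b))"
    using nz unfolding mob_def by (simp add: divide_simps)
  also have "\<dots> = (a * cnj a - b * cnj b) * z / (a * cnj a - b * cnj b)"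
    by (simp add: algebra_simps)
  finally show ?thesis
    using mob_det_pos(3)[OF assms(1)] by simp
qed

lemma mob_DERIV:
  assumes "cmod b < cmod a" "cmod z \<le> 1"
  shows "(mob a b has_field_derivative (a * cnj a - b * cnj b) / (cnj b * z + cnj a)\<^sup>2) (at z)"
proof -
  have nz: "cnj b * z + cnj a \<noteq> 0"
    by (rule mob_denom_nonzero[OF assms])
  show ?thesis
    unfolding mob_def[abs_def]
    by (rule derivative_eq_intros refl nz)+ (use nz in \<open>simp add: field_simps power2_eq_square\<close>)
qed

lemma mob_holomorphic_ball:
  assumes "cmod b < cmod a"
  shows "mob a b holomorphic_on ball 0 1"
  using mob_DERIV[OF assms] field_differentiable_at_within
  by (force simp: holomorphic_on_def field_differentiable_def)

text \<open>The automorphism \<open>mob 1 b\<close> carries \<open>0\<close> to \<open>b\<close>; it serves to move base points to the origin.\<close>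

lemma mob_one:
  assumes "cmod b < 1"
  shows "mob 1 b 0 = b" "mob 1 (- b) b = 0" "cmod z \<le> 1 \<Longrightarrow> mob 1 b (mob 1 (- b) z) = z"
  using mob_inverse[of "- b" 1 z] assms by (auto simp: mob_def)

lemma mob_of_rotation:
  assumes "cmod \<alpha> = 1" "cmod c < 1"
  obtains a b where "cmod b < cmod a" "\<And>z. mob 1 c (\<alpha> * z) = mob a b z"
proof -
  define \<mu> where "\<mu> = csqrt \<alpha>"
  have mu2: "\<mu> * \<mu> = \<alpha>"
    by (metis \<mu>_def power2_csqrt power2_eq_square)
  then have "cmod \<mu> * cmod \<mu> = 1"
    using assms(1) by (metis norm_mult)
  then have mu1: "cmod \<mu> = 1"
    by (metis abs_norm_cancel real_sqrt_abs2 real_sqrt_one)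
  then have mm: "\<mu> * cnj \<mu> = 1"
    using of_real_cmod_square[of \<mu>] by simp
  have mm': "cnj \<mu> * (\<mu> * x) = x" "\<mu> * (cnj \<mu> * x) = x" for x
    using mm by (metis mult.assoc mult.commute mult.left_neutral)+
  have [simp]: "\<mu> \<noteq> 0" using mm by auto
  show ?thesis
  proof
    show "cmod (c * cnj \<mu>) < cmod \<mu>"
      using mu1 assms(2) by (simp add: norm_mult)
    fix z
    have "mob \<mu> (c * cnj \<mu>) z = (\<mu> * (\<mu> * z + c * cnj \<mu>)) / (\<mu> * (cnj c * \<mu> * z + cnj \<mu>))"
      by (simp add: mob_def)
    also have "\<dots> = (\<alpha> * z + c) / (cnj c * (\<alpha> * z) + 1)"
      using mu2 by (simp add: algebra_simps mm' mm flip: mu2)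
    also have "\<dots> = mob 1 c (\<alpha> * z)"
      by (simp add: mob_def)
    finally show "mob 1 c (\<alpha> * z) = mob \<mu> (c * cnj \<mu>) z"
      by simp
  qed
qed

text \<open>Moving \<open>f 0\<close> to the origin by \<open>mob 1 (- f 0)\<close> turns the inequality and its case of equality into
  Schwarz's lemma. Equality is the criterion by which maps are recognized as automorphisms below.\<close>

lemma schwarz_pick_at_0:
  assumes "f holomorphic_on ball 0 1" "\<And>z. cmod z < 1 \<Longrightarrow> cmod (f z) < 1"
  shows "cmod (deriv f 0) \<le> 1 - (cmod (f 0))\<^sup>2"
    and "cmod (deriv f 0) = 1 - (cmod (f 0))\<^sup>2 \<Longrightarrow>
      \<exists>a b. cmod b < cmod a \<and> (\<forall>z. cmod z < 1 \<longrightarrow> f z = mob a b z)"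
proof -
  define c where "c = f 0"
  have c: "cmod c < 1" "cmod (-c) < cmod 1"
    using assms(2)[of 0] by (auto simp: c_def)
  define k where "k = mob 1 (- c) \<circ> f"
  have im: "f ` ball 0 1 \<subseteq> ball 0 1"
    using assms(2) by auto
  have k1: "k holomorphic_on ball 0 1"
    unfolding k_def
    by (rule holomorphic_on_compose_gen[OF assms(1) mob_holomorphic_ball im]) (use c in auto)
  have k2: "k 0 = 0"
    using mob_one(2)[OF c(1)] by (simp add: k_def c_def)
  have k3: "cmod z < 1 \<Longrightarrow> cmod (k z) < 1" for z
    unfolding k_def using mob_less_1[OF c(2)] assms(2) by auto
  have pos: "1 - (cmod c)\<^sup>2 > 0"
    using c by (simp add: power_less_one_iff)
  have cc: "1 - cnj c * c = of_real (1 - (cmod c)\<^sup>2)"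
    by (simp add: of_real_cmod_square)
  have "(f has_field_derivative deriv f 0) (at 0)"
    using assms(1) holomorphic_derivI[of f "ball 0 1" 0] by simp
  moreover have "(mob 1 (-c) has_field_derivative 1 / (1 - cnj c * c)) (at (f 0))"
  proof -
    have "1 - cnj c * c \<noteq> 0"
      unfolding cc using pos by (metis less_irrefl of_real_eq_0_iff)
    then have "(1 * cnj 1 - - c * cnj (- c)) / (cnj (- c) * c + cnj 1)\<^sup>2 = 1 / (1 - cnj c * c)"
      by (simp add: power2_eq_square mult.commute)
    then show ?thesis
      using mob_DERIV[OF c(2), of "f 0"] c(1) by (simp add: c_def)
  qed
  ultimately have "(k has_field_derivative 1 / (1 - cnj c * c) * deriv f 0) (at 0)"
    unfolding k_def by (intro DERIV_chain)
  then have dk: "deriv k 0 = deriv f 0 / of_real (1 - (cmod c)\<^sup>2)"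
    unfolding cc by (simp add: DERIV_imp_deriv)
  then have ndk: "cmod (deriv k 0) = cmod (deriv f 0) / (1 - (cmod c)\<^sup>2)"
    using pos by (simp add: norm_divide del: of_real_diff)
  show "cmod (deriv f 0) \<le> 1 - (cmod (f 0))\<^sup>2"
    using Schwarz_Lemma(2)[OF k1 k2 k3, of 0] ndk pos by (simp add: c_def field_simps)
  assume "cmod (deriv f 0) = 1 - (cmod (f 0))\<^sup>2"
  then have "cmod (deriv k 0) = 1"
    using ndk pos by (simp add: c_def)
  then obtain \<alpha> where al: "\<And>z. cmod z < 1 \<Longrightarrow> k z = \<alpha> * z" "cmod \<alpha> = 1"
    using Schwarz_Lemma(3)[OF k1 k2 k3, of 0] by auto
  obtain a b where ab: "cmod b < cmod a" "\<And>z. mob 1 c (\<alpha> * z) = mob a b z"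
    using mob_of_rotation[OF al(2) c(1)] by blast
  have "f z = mob a b z" if "cmod z < 1" for z
  proof -
    have "mob 1 c (k z) = f z"
      unfolding k_def using mob_one(3)[OF c(1), of "f z"] assms(2)[OF that] by auto
    then show ?thesis
      using al(1)[OF that] ab(2) by simp
  qed
  then show "\<exists>a b. cmod b < cmod a \<and> (\<forall>z. cmod z < 1 \<longrightarrow> f z = mob a b z)"
    using ab(1) by blast
qed

text \<open>The Schwarz-Pick bounds for \<open>m\<close> at \<open>0\<close> and for \<open>n\<close> at \<open>m 0\<close> have product \<open>1\<close>, and so have the
  derivatives; hence equality holds in both.\<close>

lemma left_invertible_disc_map_is_mob:
  assumes m: "m holomorphic_on ball 0 1" "\<And>z. cmod z < 1 \<Longrightarrow> cmod (m z) < 1"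
    and n: "n holomorphic_on ball 0 1" "\<And>z. cmod z < 1 \<Longrightarrow> cmod (n z) < 1"
    and nm: "\<And>z. cmod z < 1 \<Longrightarrow> n (m z) = z"
  obtains a b where "cmod b < cmod a" "\<And>z. cmod z < 1 \<Longrightarrow> m z = mob a b z"
proof -
  have dm: "(m has_field_derivative deriv m 0) (at 0)"
    using m(1) holomorphic_derivI[of m "ball 0 1" 0] by simp
  \<comment> \<open>translate \<open>m 0\<close> to the origin, so that the inverse can be estimated there as well\<close>
  define c where "c = m 0"
  have c: "cmod c < 1" "cmod c < cmod 1"
    using m(2)[of 0] by (auto simp: c_def)
  have pos: "1 - (cmod c)\<^sup>2 > 0"
    using c by (simp add: power_less_one_iff)
  have im: "mob 1 c ` ball 0 1 \<subseteq> ball 0 1"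
    using mob_less_1[OF c(2)] by auto
  define l where "l = n \<circ> mob 1 c"
  have l1: "l holomorphic_on ball 0 1"
    unfolding l_def by (rule holomorphic_on_compose_gen[OF mob_holomorphic_ball[OF c(2)] n(1) im])
  have l2: "cmod (l z) < 1" if "cmod z < 1" for z
    unfolding l_def using n(2) mob_less_1[OF c(2) that] by auto
  have dn: "(n has_field_derivative deriv n c) (at c)"
    using n(1) c holomorphic_derivI[of n "ball 0 1" c] by simp
  have "((n \<circ> m) has_field_derivative deriv n c * deriv m 0) (at 0)"
    using dn dm unfolding c_def by (intro DERIV_chain)
  moreover have "((n \<circ> m) has_field_derivative 1) (at 0)"
    by (rule has_field_derivative_transform_within_open[OF DERIV_ident, of "ball 0 1"])
       (auto simp: nm)
  ultimately have one: "deriv n c * deriv m 0 = 1"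
    by (rule DERIV_unique)
  have dmob: "(mob 1 c has_field_derivative of_real (1 - (cmod c)\<^sup>2)) (at 0)"
    using mob_DERIV[OF c(2), of 0] by (simp add: of_real_cmod_square)
  have "(l has_field_derivative deriv n c * of_real (1 - (cmod c)\<^sup>2)) (at 0)"
    unfolding l_def using dn mob_one(1)[OF c(1)] dmob by (intro DERIV_chain) auto
  then have dl: "deriv l 0 = deriv n c * of_real (1 - (cmod c)\<^sup>2)"
    by (rule DERIV_imp_deriv)
  have "cmod (deriv l 0) \<le> 1 - (cmod (l 0))\<^sup>2"
    by (rule schwarz_pick_at_0(1)[OF l1 l2])
  also have "\<dots> \<le> 1" by simp
  finally have A: "cmod (deriv n c) * (1 - (cmod c)\<^sup>2) \<le> 1"
    unfolding dl using pos by (simp add: norm_mult del: of_real_diff)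
  have B: "cmod (deriv m 0) \<le> 1 - (cmod c)\<^sup>2"
    unfolding c_def by (rule schwarz_pick_at_0(1)[OF m])
  have C: "cmod (deriv n c) * cmod (deriv m 0) = 1"
    using one by (metis norm_mult norm_one)
  then have "cmod (deriv n c) > 0"
    by (metis norm_eq_zero mult_zero_left zero_neq_one zero_less_norm_iff)
  then have "1 - (cmod c)\<^sup>2 \<le> cmod (deriv m 0)"
    using A C by (metis mult_le_cancel_left_pos)
  then have "cmod (deriv m 0) = 1 - (cmod (m 0))\<^sup>2"
    using B by (simp add: c_def)
  then show ?thesis
    using schwarz_pick_at_0(2)[OF m] that by blast
qed

section \<open>The symmetrization map\<close>

definition sympair :: "complex \<Rightarrow> complex \<Rightarrow> complex \<times> complex" where
  "sympair z w = (z + w, z * w)"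

lemma sympair_commute: "sympair z w = sympair w z"
  by (simp add: sympair_def algebra_simps)

lemma sympair_eq_iff: "sympair z w = sympair x y \<longleftrightarrow> (z = x \<and> w = y) \<or> (z = y \<and> w = x)"
proof
  assume "sympair z w = sympair x y"
  then have s: "z + w = x + y" and p: "z * w = x * y"
    by (auto simp: sympair_def)
  have "(z - x) * (z - y) = z * z - z * (x + y) + x * y"
    by (simp add: algebra_simps)
  also have "\<dots> = 0"
    unfolding s[symmetric] p[symmetric] by (simp add: algebra_simps)
  finally have "z = x \<or> z = y"
    by simp
  then show "(z = x \<and> w = y) \<or> (z = y \<and> w = x)"
    using s by auto
qed (auto simp: sympair_def algebra_simps)

lemma sympair_surj: obtains z w where "q = sympair z w"
proof -
  define d where "d = csqrt ((fst q)\<^sup>2 - 4 * snd q)"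
  have d: "d * d = (fst q)\<^sup>2 - 4 * snd q"
    unfolding d_def by (metis power2_csqrt power2_eq_square)
  have "((fst q + d) / 2) * ((fst q - d) / 2) = ((fst q)\<^sup>2 - d * d) / 4"
    by (simp add: power2_eq_square algebra_simps)
  also have "\<dots> = snd q"
    unfolding d by simp
  finally have "q = sympair ((fst q + d) / 2) ((fst q - d) / 2)"
    by (simp add: sympair_def prod_eq_iff field_simps)
  then show ?thesis
    by (rule that)
qed

lemma sym_bidisc_iff [simp]: "sympair z w \<in> sym_bidisc \<longleftrightarrow> cmod z < 1 \<and> cmod w < 1"
proof
  assume "sympair z w \<in> sym_bidisc"
  then obtain x y where "sympair z w = sympair x y" "cmod x < 1" "cmod y < 1"
    by (auto simp: sym_bidisc_def sympair_def)
  then show "cmod z < 1 \<and> cmod w < 1"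
    unfolding sympair_eq_iff by auto
qed (auto simp: sym_bidisc_def sympair_def)

lemma sym_bidisc_cases:
  assumes "q \<in> sym_bidisc"
  obtains z w where "q = sympair z w" "cmod z < 1" "cmod w < 1"
  using assms by (auto simp: sym_bidisc_def sympair_def)

lemma sympair_same: "sympair x x = (2 * x, x\<^sup>2)"
  by (simp add: sympair_def power2_eq_square)

lemma royal_variety_iff: "sympair z w \<in> royal_variety \<longleftrightarrow> z = w \<and> cmod z < 1"
  by (auto simp: royal_variety_def sympair_eq_iff image_iff simp flip: sympair_same)

lemma royal_boundary_iff: "sympair z w \<in> royal_boundary \<longleftrightarrow> z = w \<and> cmod z = 1"
  by (auto simp: royal_boundary_def sympair_eq_iff image_iff simp flip: sympair_same)

lemma closure_image_ball:
  fixes g :: "complex \<Rightarrow> 'a::t2_space"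
  assumes "continuous_on (cball 0 1) g"
  shows "closure (g ` ball 0 1) = g ` cball 0 1"
proof
  have "closed (g ` cball 0 1)"
    using assms compact_continuous_image compact_imp_closed compact_cball by blast
  then show "closure (g ` ball 0 1) \<subseteq> g ` cball 0 1"
    by (rule closure_minimal[rotated]) auto
  have cb: "closure (ball (0::complex) 1) = cball 0 1"
    by simp
  show "g ` cball 0 1 \<subseteq> closure (g ` ball 0 1)"
    using image_closure_subset[OF _ closed_closure closure_subset, of "ball 0 1" g] assms
    unfolding cb by simp
qed

lemma closure_royal_variety_iff:
  "sympair z w \<in> closure royal_variety \<longleftrightarrow> z = w \<and> cmod z \<le> 1"
proof -
  have "continuous_on (cball 0 1) (\<lambda>x::complex. (2 * x, x\<^sup>2))"
    by (intro continuous_intros)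
  then have "closure royal_variety = (\<lambda>x. (2 * x, x\<^sup>2)) ` cball 0 1"
    unfolding royal_variety_def by (rule closure_image_ball)
  then show ?thesis
    by (auto simp: sympair_eq_iff image_iff simp flip: sympair_same)
qed

text \<open>A function that is holomorphic in two variables is holomorphic along every holomorphic
  disc; nothing else about holomorphy in two variables is used.\<close>

lemma holo2_compose_DERIV:
  assumes "(f has_derivative (\<lambda>v. a * fst v + b * snd v)) (at (x z, y z) within S)"
    and "open T" "z \<in> T" "\<And>\<zeta>. \<zeta> \<in> T \<Longrightarrow> (x \<zeta>, y \<zeta>) \<in> S"
    and "(x has_field_derivative x') (at z)" "(y has_field_derivative y') (at z)"
  shows "((\<lambda>\<zeta>. f (x \<zeta>, y \<zeta>)) has_field_derivative a * x' + b * y') (at z)"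
proof -
  have "((\<lambda>\<zeta>. (x \<zeta>, y \<zeta>)) has_derivative (\<lambda>h. (x' * h, y' * h))) (at z)"
    using assms(5,6) unfolding has_field_derivative_def by (rule has_derivative_Pair)
  then have "((\<lambda>\<zeta>. (x \<zeta>, y \<zeta>)) has_derivative (\<lambda>h. (x' * h, y' * h))) (at z within T)"
    by (rule has_derivative_at_withinI)
  moreover have "(\<lambda>\<zeta>. (x \<zeta>, y \<zeta>)) ` T \<subseteq> S"
    using assms(4) by auto
  then have "(f has_derivative (\<lambda>v. a * fst v + b * snd v))
      (at (x z, y z) within (\<lambda>\<zeta>. (x \<zeta>, y \<zeta>)) ` T)"
    by (rule has_derivative_subset[OF assms(1)])
  ultimately have "((\<lambda>\<zeta>. f (x \<zeta>, y \<zeta>)) has_derivative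
      (\<lambda>h. a * fst (x' * h, y' * h) + b * snd (x' * h, y' * h))) (at z within T)"
    by (rule has_derivative_in_compose)
  moreover have "(\<lambda>h. a * fst (x' * h, y' * h) + b * snd (x' * h, y' * h)) = (*) (a * x' + b * y')"
    by (auto simp: algebra_simps)
  ultimately have "((\<lambda>\<zeta>. f (x \<zeta>, y \<zeta>)) has_field_derivative a * x' + b * y') (at z within T)"
    unfolding has_field_derivative_def by (simp only:)
  then show ?thesis
    unfolding at_within_open[OF assms(3,2)] .
qed

lemma holo2_compose_holomorphic:
  assumes "holo2_on f S" "open T" "x holomorphic_on T" "y holomorphic_on T"
    "\<And>\<zeta>. \<zeta> \<in> T \<Longrightarrow> (x \<zeta>, y \<zeta>) \<in> S"
  shows "(\<lambda>\<zeta>. f (x \<zeta>, y \<zeta>)) holomorphic_on T"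
proof -
  have "(\<lambda>\<zeta>. f (x \<zeta>, y \<zeta>)) field_differentiable (at z)" if "z \<in> T" for z
  proof -
    obtain a b where "(f has_derivative (\<lambda>v. a * fst v + b * snd v)) (at (x z, y z) within S)"
      using assms(1,5) \<open>z \<in> T\<close> unfolding holo2_on_def by blast
    then have "((\<lambda>\<zeta>. f (x \<zeta>, y \<zeta>)) has_field_derivative a * deriv x z + b * deriv y z) (at z)"
      by (rule holo2_compose_DERIV[where T = T])
         (use assms(2-5) \<open>z \<in> T\<close> holomorphic_derivI in blast)+
    then show ?thesis
      unfolding field_differentiable_def by blast
  qed
  then show ?thesis
    using assms(2) by (simp add: holomorphic_on_open field_differentiable_def)
qed

lemma holo2_compose_sympair:
  assumes "holo2_on f sym_bidisc" "x holomorphic_on ball 0 1" "y holomorphic_on ball 0 1"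
    "\<And>z. cmod z < 1 \<Longrightarrow> cmod (x z) < 1 \<and> cmod (y z) < 1"
  shows "(\<lambda>z. f (sympair (x z) (y z))) holomorphic_on ball 0 1"
  unfolding sympair_def
  by (rule holo2_compose_holomorphic[OF assms(1)])
     (use assms(2-4) in \<open>auto intro!: holomorphic_intros simp flip: sympair_def\<close>)

section \<open>Geodesics that avoid the royal variety\<close>

text \<open>Off the royal variety the discriminant \<open>s\<^sup>2 - 4p\<close> does not vanish; on the contractible disc it
  then has a holomorphic square root, which separates the two roots.\<close>

lemma lift_to_bidisc:
  assumes "holo_curve_on h (ball 0 1)" "h ` ball 0 1 \<subseteq> sym_bidisc" "h ` ball 0 1 \<inter> royal_variety = {}"
  obtains f\<^sub>1 f\<^sub>2 where "f\<^sub>1 holomorphic_on ball 0 1" "f\<^sub>2 holomorphic_on ball 0 1"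
    "\<And>z. cmod z < 1 \<Longrightarrow> h z = sympair (f\<^sub>1 z) (f\<^sub>2 z) \<and> cmod (f\<^sub>1 z) < 1 \<and> cmod (f\<^sub>2 z) < 1
       \<and> f\<^sub>1 z \<noteq> f\<^sub>2 z"
proof -
  define s p where "s z = fst (h z)" and "p z = snd (h z)" for z
  have hol: "s holomorphic_on ball 0 1" "p holomorphic_on ball 0 1"
    using assms(1) by (simp_all add: holo_curve_on_def s_def[abs_def] p_def[abs_def])
  have "(s z)\<^sup>2 - 4 * p z \<noteq> 0" if z: "z \<in> ball 0 1" for z
  proof -
    obtain x y where xy: "h z = sympair x y" "cmod x < 1" "cmod y < 1"
      using assms(2) z sym_bidisc_cases by blast
    have "(s z)\<^sup>2 - 4 * p z = (x - y)\<^sup>2"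
      by (simp add: s_def p_def xy sympair_def power2_eq_square algebra_simps)
    moreover have "x \<noteq> y"
      using assms(3) z xy royal_variety_iff by (metis disjoint_iff image_eqI)
    ultimately show ?thesis by simp
  qed
  moreover have "(\<lambda>z. (s z)\<^sup>2 - 4 * p z) holomorphic_on ball 0 1"
    by (intro holomorphic_intros hol)
  moreover have "contractible (ball (0::complex) 1)"
    by (simp add: convex_imp_contractible)
  ultimately obtain d where d: "d holomorphic_on ball 0 1"
      "\<And>z. z \<in> ball 0 1 \<Longrightarrow> (s z)\<^sup>2 - 4 * p z = (d z)\<^sup>2"
    using contractible_imp_holomorphic_sqrt[of "\<lambda>z. (s z)\<^sup>2 - 4 * p z" "ball 0 1"] by auto
  define f\<^sub>1 f\<^sub>2 where "f\<^sub>1 z = (s z + d z) / 2" and "f\<^sub>2 z = (s z - d z) / 2" for z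
  have *: "h z = sympair (f\<^sub>1 z) (f\<^sub>2 z)" if "cmod z < 1" for z
  proof -
    have "f\<^sub>1 z * f\<^sub>2 z = ((s z)\<^sup>2 - (d z)\<^sup>2) / 4"
      by (simp add: f\<^sub>1_def f\<^sub>2_def power2_eq_square algebra_simps)
    also have "\<dots> = p z"
      using d(2)[of z] that by (simp flip: d(2))
    finally show ?thesis
      by (simp add: sympair_def prod_eq_iff s_def p_def f\<^sub>1_def f\<^sub>2_def field_simps)
  qed
  show ?thesis
  proof (rule that)
    show "f\<^sub>1 holomorphic_on ball 0 1" "f\<^sub>2 holomorphic_on ball 0 1"
      unfolding f\<^sub>1_def[abs_def] f\<^sub>2_def[abs_def] by (intro holomorphic_intros hol d; simp)+
    fix z :: complex assume z: "cmod z < 1"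
    have "h z \<in> h ` ball 0 1"
      using z by simp
    then have "h z \<in> sym_bidisc" "h z \<notin> royal_variety"
      using assms(2,3) by blast+
    then have "sympair (f\<^sub>1 z) (f\<^sub>2 z) \<in> sym_bidisc" "sympair (f\<^sub>1 z) (f\<^sub>2 z) \<notin> royal_variety"
      unfolding *[OF z] by auto
    then show "h z = sympair (f\<^sub>1 z) (f\<^sub>2 z) \<and> cmod (f\<^sub>1 z) < 1 \<and> cmod (f\<^sub>2 z) < 1 \<and> f\<^sub>1 z \<noteq> f\<^sub>2 z"
      using *[OF z] royal_variety_iff by auto
  qed
qed

lemma norm_unimodular_multiple: obtains c :: complex where "cmod c = 1" "c * x = of_real (cmod x)"
proof (cases "x = 0")
  case False
  show ?thesis
  proof (rule that)
    show "cmod (cnj (sgn x)) = 1"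
      using False by (simp add: norm_sgn)
    have "cnj (sgn x) * x = cnj x * x / of_real (cmod x)"
      by (simp add: sgn_eq)
    also have "\<dots> = of_real (cmod x)"
      using False of_real_cmod_square[of x] by (simp add: power2_eq_square field_simps)
    finally show "cnj (sgn x) * x = of_real (cmod x)" .
  qed
qed (use that[of 1] in auto)

text \<open>Let \<open>M\<^sub>1\<close>, \<open>M\<^sub>2\<close> be the partial derivatives of \<open>(z, w) \<mapsto> \<Phi>(z + w, zw)\<close> at \<open>(f\<^sub>1(0), f\<^sub>2(0))\<close>, let \<open>\<tau>\<^sub>i\<close> be
  the automorphism with \<open>\<tau>\<^sub>i(0) = f\<^sub>i(0)\<close>, and \<open>d\<^sub>i = 1 - \<bar>f\<^sub>i(0)\<bar>\<^sup>2\<close>. Differentiating \<open>\<Phi> \<circ> h = id\<close> at \<open>0\<close> gives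
  \<open>M\<^sub>1 f\<^sub>1' + M\<^sub>2 f\<^sub>2' = 1\<close>, while Schwarz's lemma on the discs \<open>\<zeta> \<mapsto> (\<tau>\<^sub>1(c\<^sub>1\<zeta>), \<tau>\<^sub>2(c\<^sub>2\<zeta>))\<close> gives
  \<open>\<bar>M\<^sub>1\<bar> d\<^sub>1 + \<bar>M\<^sub>2\<bar> d\<^sub>2 \<le> 1\<close>. If \<open>f\<^sub>2\<close> were not extremal at \<open>0\<close>, this would force \<open>M\<^sub>2 = 0\<close> and
  \<open>\<bar>M\<^sub>1\<bar> d\<^sub>1 = 1\<close>; the case of equality in Schwarz's lemma then makes the value of \<open>\<Phi>\<close> at
  \<open>(\<tau>\<^sub>1(\<zeta>), \<tau>\<^sub>2(c\<zeta>))\<close> independent of \<open>c\<close> for \<open>\<bar>c\<bar> \<le> 1\<close>. Two points of this form, exchanged by the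
  symmetry \<open>(z, w) \<mapsto> (w, z)\<close>, yield a contradiction.\<close>

lemma lifted_geodesic_extremal:
  assumes \<Phi>: "holo2_on \<Phi> sym_bidisc" "\<Phi> ` sym_bidisc \<subseteq> ball 0 1"
    and f: "f\<^sub>1 holomorphic_on ball 0 1" "f\<^sub>2 holomorphic_on ball 0 1"
    and fin: "\<And>z. cmod z < 1 \<Longrightarrow> cmod (f\<^sub>1 z) < 1 \<and> cmod (f\<^sub>2 z) < 1"
    and ne: "f\<^sub>1 0 \<noteq> f\<^sub>2 0"
    and inv: "\<And>z. cmod z < 1 \<Longrightarrow> \<Phi> (sympair (f\<^sub>1 z) (f\<^sub>2 z)) = z"
  shows "cmod (deriv f\<^sub>2 0) = 1 - (cmod (f\<^sub>2 0))\<^sup>2"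
proof (rule ccontr)
  assume not_eq: "cmod (deriv f\<^sub>2 0) \<noteq> 1 - (cmod (f\<^sub>2 0))\<^sup>2"
  define a\<^sub>1 a\<^sub>2 where "a\<^sub>1 = f\<^sub>1 0" and "a\<^sub>2 = f\<^sub>2 0"
  define d\<^sub>1 d\<^sub>2 where "d\<^sub>1 = 1 - (cmod a\<^sub>1)\<^sup>2" and "d\<^sub>2 = 1 - (cmod a\<^sub>2)\<^sup>2"
  have a: "cmod a\<^sub>1 < 1" "cmod a\<^sub>2 < 1" "cmod a\<^sub>1 < cmod 1" "cmod a\<^sub>2 < cmod 1"
    using fin[of 0] by (auto simp: a\<^sub>1_def a\<^sub>2_def)
  have dpos: "d\<^sub>1 > 0" "d\<^sub>2 > 0"
    using a by (auto simp: d\<^sub>1_def d\<^sub>2_def power_less_one_iff)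
  have b1: "cmod (deriv f\<^sub>1 0) \<le> d\<^sub>1" unfolding d\<^sub>1_def a\<^sub>1_def
    by (rule schwarz_pick_at_0(1)) (use f fin in auto)
  have "cmod (deriv f\<^sub>2 0) \<le> d\<^sub>2" unfolding d\<^sub>2_def a\<^sub>2_def
    by (rule schwarz_pick_at_0(1)) (use f fin in auto)
  then have b2: "cmod (deriv f\<^sub>2 0) < d\<^sub>2"
    using not_eq by (simp add: d\<^sub>2_def a\<^sub>2_def)
  obtain A B where AB: "(\<Phi> has_derivative (\<lambda>v. A * fst v + B * snd v)) (at (sympair a\<^sub>1 a\<^sub>2) within sym_bidisc)"
    using \<Phi>(1) a unfolding holo2_on_def by (meson sym_bidisc_iff)
  define M\<^sub>1 M\<^sub>2 where "M\<^sub>1 = A + B * a\<^sub>2" and "M\<^sub>2 = A + B * a\<^sub>1"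
  have along: "((\<lambda>z. \<Phi> (sympair (x z) (y z))) has_field_derivative M\<^sub>1 * x' + M\<^sub>2 * y') (at 0)"
    if "x 0 = a\<^sub>1" "y 0 = a\<^sub>2" "(x has_field_derivative x') (at 0)" "(y has_field_derivative y') (at 0)"
      "\<And>z. cmod z < 1 \<Longrightarrow> cmod (x z) < 1 \<and> cmod (y z) < 1" for x y x' y'
  proof -
    have "((\<lambda>z. \<Phi> (x z + y z, x z * y z)) has_field_derivative
        A * (x' + y') + B * (x' * y 0 + y' * x 0)) (at 0)"
      by (rule holo2_compose_DERIV[where S = sym_bidisc and T = "ball 0 1"])
         (use that AB in \<open>auto intro!: derivative_eq_intros simp flip: sympair_def simp: that\<close>)
    then show ?thesis
      using that(1,2) by (simp add: sympair_def M\<^sub>1_def M\<^sub>2_def algebra_simps)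
  qed
  have dersum: "M\<^sub>1 * deriv f\<^sub>1 0 + M\<^sub>2 * deriv f\<^sub>2 0 = 1"
  proof -
    have "((\<lambda>z. \<Phi> (sympair (f\<^sub>1 z) (f\<^sub>2 z))) has_field_derivative
        M\<^sub>1 * deriv f\<^sub>1 0 + M\<^sub>2 * deriv f\<^sub>2 0) (at 0)"
      using f fin by (intro along) (auto simp: a\<^sub>1_def a\<^sub>2_def intro!: holomorphic_derivI)
    moreover have "((\<lambda>z. \<Phi> (sympair (f\<^sub>1 z) (f\<^sub>2 z))) has_field_derivative 1) (at 0)"
      by (rule has_field_derivative_transform_within_open[OF DERIV_ident, of "ball 0 1"])
         (auto simp: inv)
    ultimately show ?thesis
      by (rule DERIV_unique)
  qed
  define k where "k c\<^sub>1 c\<^sub>2 z = \<Phi> (sympair (mob 1 a\<^sub>1 (c\<^sub>1 * z)) (mob 1 a\<^sub>2 (c\<^sub>2 * z)))" for c\<^sub>1 c\<^sub>2 z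
  have in1: "cmod (c * z) < 1" if "cmod c \<le> 1" "cmod z < 1" for c z :: complex
    using that by (metis norm_mult mult_le_one norm_ge_zero mult_less_cancel_right2 mult_left_le_one_le le_less_trans)
  have in2: "cmod (mob 1 a\<^sub>1 (c * z)) < 1" "cmod (mob 1 a\<^sub>2 (c * z)) < 1"
    if "cmod c \<le> 1" "cmod z < 1" for c z :: complex
    using mob_less_1[OF a(3) in1[OF that]] mob_less_1[OF a(4) in1[OF that]] by auto
  have k_hol: "k c\<^sub>1 c\<^sub>2 holomorphic_on ball 0 1" if "cmod c\<^sub>1 \<le> 1" "cmod c\<^sub>2 \<le> 1" for c\<^sub>1 c\<^sub>2
  proof -
    have "mob 1 b \<circ> (*) c holomorphic_on ball 0 1" if "cmod c \<le> 1" "cmod b < 1" for b c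
    proof (rule holomorphic_on_compose_gen)
      show "(*) c holomorphic_on ball 0 1"
        by (intro holomorphic_intros)
      show "mob 1 b holomorphic_on ball 0 1"
        using that(2) by (simp add: mob_holomorphic_ball)
      show "(*) c ` ball 0 1 \<subseteq> ball 0 1"
        using in1[OF that(1)] by auto
    qed
    from this[OF that(1) a(1)] this[OF that(2) a(2)]
    have "(\<lambda>z. mob 1 a\<^sub>1 (c\<^sub>1 * z)) holomorphic_on ball 0 1" "(\<lambda>z. mob 1 a\<^sub>2 (c\<^sub>2 * z)) holomorphic_on ball 0 1"
      by (simp_all add: o_def)
    then show ?thesis
      unfolding k_def[abs_def] by (rule holo2_compose_sympair[OF \<Phi>(1)]) (simp add: in2 that)
  qed
  have k_in: "cmod (k c\<^sub>1 c\<^sub>2 z) < 1" if "cmod c\<^sub>1 \<le> 1" "cmod c\<^sub>2 \<le> 1" "cmod z < 1" for c\<^sub>1 c\<^sub>2 z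
    unfolding k_def using \<Phi>(2) in2 that by (force simp: image_subset_iff)
  have k_0: "k c\<^sub>1 c\<^sub>2 0 = 0" for c\<^sub>1 c\<^sub>2
    unfolding k_def using inv[of 0] a mob_one(1) by (simp add: a\<^sub>1_def a\<^sub>2_def)
  have k_der: "deriv (k c\<^sub>1 c\<^sub>2) 0 = M\<^sub>1 * (c\<^sub>1 * d\<^sub>1) + M\<^sub>2 * (c\<^sub>2 * d\<^sub>2)"
    if "cmod c\<^sub>1 \<le> 1" "cmod c\<^sub>2 \<le> 1" for c\<^sub>1 c\<^sub>2
  proof -
    have mobder: "((\<lambda>z. mob 1 b (c * z)) has_field_derivative c * of_real (1 - (cmod b)\<^sup>2)) (at 0)"
      if "cmod b < 1" for b c
    proof -
      have "(mob 1 b has_field_derivative of_real (1 - (cmod b)\<^sup>2)) (at (c * 0))"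
        using mob_DERIV[of b 1 0] that by (simp add: of_real_cmod_square)
      then have "(mob 1 b \<circ> (*) c has_field_derivative of_real (1 - (cmod b)\<^sup>2) * c) (at 0)"
        by (intro DERIV_chain) (auto intro!: derivative_eq_intros)
      then show ?thesis
        by (simp add: o_def mult.commute)
    qed
    have "(k c\<^sub>1 c\<^sub>2 has_field_derivative M\<^sub>1 * (c\<^sub>1 * d\<^sub>1) + M\<^sub>2 * (c\<^sub>2 * d\<^sub>2)) (at 0)"
      unfolding k_def[abs_def] d\<^sub>1_def d\<^sub>2_def
      by (rule along) (use a mob_one(1) that in2 mobder in auto)
    then show ?thesis
      by (rule DERIV_imp_deriv)
  qed
  \<comment> \<open>turning both terms onto the positive axis by unimodular \<open>c\<^sub>1\<close>, \<open>c\<^sub>2\<close>\<close>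
  have bound: "cmod M\<^sub>1 * d\<^sub>1 + cmod M\<^sub>2 * d\<^sub>2 \<le> 1"
  proof -
    obtain c\<^sub>1 where c1: "cmod c\<^sub>1 = 1" "c\<^sub>1 * M\<^sub>1 = of_real (cmod M\<^sub>1)"
      using norm_unimodular_multiple by blast
    obtain c\<^sub>2 where c2: "cmod c\<^sub>2 = 1" "c\<^sub>2 * M\<^sub>2 = of_real (cmod M\<^sub>2)"
      using norm_unimodular_multiple by blast
    have "deriv (k c\<^sub>1 c\<^sub>2) 0 = (c\<^sub>1 * M\<^sub>1) * d\<^sub>1 + (c\<^sub>2 * M\<^sub>2) * d\<^sub>2"
      using k_der[of c\<^sub>1 c\<^sub>2] c1(1) c2(1) by (simp add: mult_ac)
    also have "\<dots> = of_real (cmod M\<^sub>1 * d\<^sub>1 + cmod M\<^sub>2 * d\<^sub>2)"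
      unfolding c1 c2 by simp
    finally have "cmod (deriv (k c\<^sub>1 c\<^sub>2) 0) = \<bar>cmod M\<^sub>1 * d\<^sub>1 + cmod M\<^sub>2 * d\<^sub>2\<bar>"
      by (simp only: norm_of_real)
    moreover have "cmod (deriv (k c\<^sub>1 c\<^sub>2) 0) \<le> 1"
      by (rule Schwarz_Lemma(2)[OF k_hol k_0 k_in, of _ _ 0]) (use c1 c2 in auto)
    ultimately show ?thesis by linarith
  qed
  have "1 \<le> cmod M\<^sub>1 * cmod (deriv f\<^sub>1 0) + cmod M\<^sub>2 * cmod (deriv f\<^sub>2 0)"
    using norm_triangle_ineq[of "M\<^sub>1 * deriv f\<^sub>1 0" "M\<^sub>2 * deriv f\<^sub>2 0"] unfolding dersum by (simp add: norm_mult)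
  moreover have "cmod M\<^sub>1 * cmod (deriv f\<^sub>1 0) \<le> cmod M\<^sub>1 * d\<^sub>1"
    using b1 by (intro mult_left_mono) auto
  ultimately have "cmod M\<^sub>2 * d\<^sub>2 \<le> cmod M\<^sub>2 * cmod (deriv f\<^sub>2 0)" "1 \<le> cmod M\<^sub>1 * d\<^sub>1 + cmod M\<^sub>2 * cmod (deriv f\<^sub>2 0)"
    using bound by linarith+
  then have M2: "M\<^sub>2 = 0" and "1 \<le> cmod M\<^sub>1 * d\<^sub>1"
    using b2 by (auto simp: mult_le_cancel_left)
  then have M1: "cmod M\<^sub>1 * d\<^sub>1 = 1"
    using bound by simp
  have k_eq: "k 1 c z = M\<^sub>1 * d\<^sub>1 * z" if "cmod c \<le> 1" "cmod z < 1" for c z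
  proof -
    have der: "deriv (k 1 c) 0 = M\<^sub>1 * d\<^sub>1"
      using k_der[of 1 c] that M2 by simp
    then have "cmod (deriv (k 1 c) 0) = 1"
      using M1 dpos by (simp add: norm_mult)
    then obtain \<alpha> where al: "\<And>z. cmod z < 1 \<Longrightarrow> k 1 c z = \<alpha> * z"
      using Schwarz_Lemma(3)[OF k_hol k_0 k_in, of 1 c 0] \<open>cmod c \<le> 1\<close>
      by (simp only: norm_zero zero_less_one norm_one order_refl) blast
    have "(k 1 c has_field_derivative \<alpha>) (at 0)"
      by (rule has_field_derivative_transform_within_open[of "\<lambda>z. \<alpha> * z" _ _ "ball 0 1"])
         (auto intro!: derivative_eq_intros simp: al)
    then show ?thesis
      using al that der DERIV_imp_deriv by metis
  qed
  \<comment> \<open>the point \<open>(a\<^sub>2, w)\<close> is \<open>(\<tau>\<^sub>1(\<zeta>), \<tau>\<^sub>2(c\<zeta>))\<close> with \<open>c = 1\<close>, and \<open>(w, a\<^sub>2)\<close> is \<open>(\<tau>\<^sub>1(\<xi>), \<tau>\<^sub>2(c\<xi>))\<close> with \<open>c = 0\<close>\<close>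
  define \<zeta> where "\<zeta> = mob 1 (- a\<^sub>1) a\<^sub>2"
  define w where "w = mob 1 a\<^sub>2 \<zeta>"
  define \<xi> where "\<xi> = mob 1 (- a\<^sub>1) w"
  have z1: "cmod \<zeta> < 1"
    unfolding \<zeta>_def using a by (intro mob_less_1) auto
  have w1: "cmod w < 1"
    unfolding w_def using a z1 by (intro mob_less_1) auto
  have x1: "cmod \<xi> < 1"
    unfolding \<xi>_def using a w1 by (intro mob_less_1) auto
  have tz: "mob 1 a\<^sub>1 \<zeta> = a\<^sub>2" "mob 1 a\<^sub>1 \<xi> = w"
    unfolding \<zeta>_def \<xi>_def using mob_one(3)[OF a(1)] a(2) w1 by simp_all
  have "\<zeta> \<noteq> 0"
    using tz(1) mob_one(1)[OF a(1)] ne by (auto simp: a\<^sub>1_def a\<^sub>2_def)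
  have "k 1 1 \<zeta> = k 1 0 \<xi>"
    unfolding k_def using tz mob_one(1)[OF a(2)] by (simp add: w_def[symmetric] sympair_commute)
  then have "M\<^sub>1 * d\<^sub>1 * \<zeta> = M\<^sub>1 * d\<^sub>1 * \<xi>"
    using k_eq z1 x1 by simp
  then have "\<zeta> = \<xi>"
    using M1 by auto
  then have "mob 1 a\<^sub>2 \<zeta> = mob 1 a\<^sub>2 0"
    using tz w_def mob_one(1)[OF a(2)] by simp
  then show False
    using mob_inj[OF a(4) less_imp_le[OF z1], of 0] \<open>\<zeta> \<noteq> 0\<close> by simp
qed

lemma geodesic_off_royal_variety:
  assumes "geodesic_param h" "h ` ball 0 1 \<inter> royal_variety = {}"
  obtains a\<^sub>1 b\<^sub>1 a\<^sub>2 b\<^sub>2 where "cmod b\<^sub>1 < cmod a\<^sub>1" "cmod b\<^sub>2 < cmod a\<^sub>2"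
    "\<And>z. cmod z < 1 \<Longrightarrow> h z = sympair (mob a\<^sub>1 b\<^sub>1 z) (mob a\<^sub>2 b\<^sub>2 z) \<and> mob a\<^sub>1 b\<^sub>1 z \<noteq> mob a\<^sub>2 b\<^sub>2 z"
proof -
  have h: "holo_curve_on h (ball 0 1)" "h ` ball 0 1 \<subseteq> sym_bidisc"
    using assms(1) by (auto simp: geodesic_param_def)
  obtain \<Phi> where \<Phi>: "holo2_on \<Phi> sym_bidisc" "\<Phi> ` sym_bidisc \<subseteq> ball 0 1" "\<And>z. cmod z < 1 \<Longrightarrow> \<Phi> (h z) = z"
    using assms(1) by (auto simp: geodesic_param_def)
  obtain f\<^sub>1 f\<^sub>2 where f: "f\<^sub>1 holomorphic_on ball 0 1" "f\<^sub>2 holomorphic_on ball 0 1" and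
    hf: "\<And>z. cmod z < 1 \<Longrightarrow> h z = sympair (f\<^sub>1 z) (f\<^sub>2 z) \<and> cmod (f\<^sub>1 z) < 1 \<and> cmod (f\<^sub>2 z) < 1
       \<and> f\<^sub>1 z \<noteq> f\<^sub>2 z"
    using lift_to_bidisc[OF h assms(2)] by blast
  have "cmod (deriv f\<^sub>2 0) = 1 - (cmod (f\<^sub>2 0))\<^sup>2"
    by (rule lifted_geodesic_extremal[OF \<Phi>(1,2) f]) (use hf \<Phi>(3) in force)+
  then obtain a\<^sub>2 b\<^sub>2 where 2: "cmod b\<^sub>2 < cmod a\<^sub>2" "\<And>z. cmod z < 1 \<Longrightarrow> f\<^sub>2 z = mob a\<^sub>2 b\<^sub>2 z"
    using schwarz_pick_at_0(2)[OF f(2)] hf by blast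
  have "cmod (deriv f\<^sub>1 0) = 1 - (cmod (f\<^sub>1 0))\<^sup>2"
    
  proof (rule lifted_geodesic_extremal[OF \<Phi>(1,2) f(2,1)])
    show "\<Phi> (sympair (f\<^sub>2 z) (f\<^sub>1 z)) = z" if "cmod z < 1" for z
      unfolding sympair_commute[of "f\<^sub>2 z"] using hf[OF that] \<Phi>(3)[OF that] by simp
    show "f\<^sub>2 0 \<noteq> f\<^sub>1 0"
      using hf by (metis norm_zero zero_less_one)
  qed (use hf in auto)
  then obtain a\<^sub>1 b\<^sub>1 where 1: "cmod b\<^sub>1 < cmod a\<^sub>1" "\<And>z. cmod z < 1 \<Longrightarrow> f\<^sub>1 z = mob a\<^sub>1 b\<^sub>1 z"
    using schwarz_pick_at_0(2)[OF f(1)] hf by blast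
  show ?thesis
    by (rule that[OF 1(1) 2(1)]) (use hf 1(2) 2(2) in auto)
qed

section \<open>Automorphisms of the symmetrized bidisc\<close>

text \<open>The tangent line of the royal variety at \<open>(2\<theta>, \<theta>\<^sup>2)\<close>; it consists of the points \<open>sympair \<theta> w\<close>.\<close>

definition on_tangent_line :: "complex \<Rightarrow> complex \<times> complex \<Rightarrow> bool" where
  "on_tangent_line \<theta> q \<longleftrightarrow> snd q - \<theta> * fst q + \<theta>\<^sup>2 = 0"

lemma on_tangent_line_sympair: "on_tangent_line \<theta> (sympair z w) \<longleftrightarrow> \<theta> = z \<or> \<theta> = w"
proof -
  have "snd (sympair z w) - \<theta> * fst (sympair z w) + \<theta>\<^sup>2 = (\<theta> - z) * (\<theta> - w)"
    by (simp add: sympair_def power2_eq_square algebra_simps)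
  then show ?thesis
    by (simp add: on_tangent_line_def)
qed

lemma on_two_tangent_lines:
  assumes "\<theta> \<noteq> \<eta>" "on_tangent_line \<theta> q" "on_tangent_line \<eta> q"
  shows "q = sympair \<theta> \<eta>"
proof -
  obtain z w where "q = sympair z w"
    by (rule sympair_surj)
  then show ?thesis
    using assms by (auto simp: on_tangent_line_sympair sympair_eq_iff)
qed

text \<open>For \<open>q \<noteq> q'\<close> this polynomial vanishes exactly if the line through \<open>q\<close> and \<open>q'\<close> is tangent to
  \<open>s\<^sup>2 = 4p\<close>. Working with chords instead of tangent vectors avoids all derivatives of
  automorphisms.\<close>

definition chord_form :: "complex \<times> complex \<Rightarrow> complex \<times> complex \<Rightarrow> complex" where
  "chord_form q q' = snd q * (fst q' - fst q)\<^sup>2 - fst q * (fst q' - fst q) * (snd q' - snd q)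
     + (snd q' - snd q)\<^sup>2"

lemma chord_form_eq_0:
  assumes "on_tangent_line \<theta> q" "on_tangent_line \<theta> q'"
  shows "chord_form q q' = 0"
proof -
  have q: "snd q = \<theta> * fst q - \<theta>\<^sup>2" "snd q' = \<theta> * fst q' - \<theta>\<^sup>2"
    using assms by (auto simp: on_tangent_line_def algebra_simps add_eq_0_iff)
  show ?thesis
    unfolding chord_form_def q by (simp add: power2_eq_square algebra_simps)
qed

lemma chord_form_imp_tangent_line:
  assumes "chord_form q q' = 0" "q \<noteq> q'"
  obtains \<theta> where "on_tangent_line \<theta> q" "on_tangent_line \<theta> q'"
proof -
  define x y where "x = fst q' - fst q" and "y = snd q' - snd q"
  have eq: "snd q * x\<^sup>2 - fst q * x * y + y\<^sup>2 = 0"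
    using assms(1) by (simp add: chord_form_def x_def y_def)
  have "x \<noteq> 0"
    using eq assms(2) by (auto simp: x_def y_def prod_eq_iff)
  define \<theta> where "\<theta> = y / x"
  have y: "y = \<theta> * x"
    using \<open>x \<noteq> 0\<close> by (simp add: \<theta>_def)
  have "(snd q - \<theta> * fst q + \<theta>\<^sup>2) * x\<^sup>2 = 0"
    using eq unfolding y by (simp add: power2_eq_square algebra_simps)
  then have 1: "snd q - \<theta> * fst q + \<theta>\<^sup>2 = 0"
    using \<open>x \<noteq> 0\<close> by simp
  have "snd q' - \<theta> * fst q' + \<theta>\<^sup>2 = (snd q - \<theta> * fst q + \<theta>\<^sup>2) + (y - \<theta> * x)"
    by (simp add: x_def y_def algebra_simps)
  then have "snd q' - \<theta> * fst q' + \<theta>\<^sup>2 = 0"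
    using 1 y by simp
  with 1 show ?thesis
    using that[of \<theta>] by (simp add: on_tangent_line_def)
qed

text \<open>The function \<open>(2\<omega>p - s)/(2 - \<omega>s)\<close> with \<open>\<bar>\<omega>\<bar> = 1\<close> is bounded by \<open>1\<close> on the closed symmetrized bidisc.
  After the rotation that makes \<open>\<omega> = 1\<close> this is the following inequality.\<close>

lemma magic_function_bound:
  assumes "cmod u \<le> 1" "cmod v \<le> 1"
  shows "cmod (2 * (u * v) - (u + v)) \<le> cmod (2 - (u + v))"
proof -
  have "(cmod (2 - (u + v)))\<^sup>2 - (cmod (2 * (u * v) - (u + v)))\<^sup>2 =
     2 * ((1 - (cmod u)\<^sup>2) * (cmod (1 - v))\<^sup>2 + (1 - (cmod v)\<^sup>2) * (cmod (1 - u))\<^sup>2)"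
    (is "?L = ?R")
  proof -
    have "complex_of_real ?L = (2 - (u + v)) * (2 - (cnj u + cnj v))
        - (2 * (u * v) - (u + v)) * (2 * (cnj u * cnj v) - (cnj u + cnj v))"
      by (simp add: of_real_cmod_square)
    also have "\<dots> = 2 * ((1 - u * cnj u) * ((1 - v) * (1 - cnj v)) + (1 - v * cnj v) * ((1 - u) * (1 - cnj u)))"
      by algebra
    also have "\<dots> = complex_of_real ?R"
      by (simp add: of_real_cmod_square)
    finally show ?thesis
      using of_real_eq_iff by blast
  qed
  also have "\<dots> \<ge> 0"
    using assms by (intro mult_nonneg_nonneg add_nonneg_nonneg) (auto simp: power_le_one)
  finally have "(cmod (2 * (u * v) - (u + v)))\<^sup>2 \<le> (cmod (2 - (u + v)))\<^sup>2"
    by linarith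
  then show ?thesis
    by (rule power2_le_imp_le) (rule norm_ge_zero)
qed

lemma sum_of_norm_2:
  assumes "cmod u \<le> 1" "cmod v \<le> 1" "cmod (u + v) = 2"
  shows "u = v"
proof -
  have "(cmod (u + v))\<^sup>2 + (cmod (u - v))\<^sup>2 = 2 * (cmod u)\<^sup>2 + 2 * (cmod v)\<^sup>2"
    unfolding cmod_power2 by (simp add: power2_eq_square algebra_simps)
  moreover have "(cmod u)\<^sup>2 \<le> 1" "(cmod v)\<^sup>2 \<le> 1"
    using assms by (auto simp: power_le_one)
  moreover have "(cmod (u + v))\<^sup>2 = 4"
    by (simp add: assms(3))
  ultimately have "(cmod (u - v))\<^sup>2 \<le> 0"
    by linarith
  then show ?thesis by simp
qed

text \<open>If the disc starts at \<open>sympair \<zeta> v\<close> with \<open>\<bar>\<zeta>\<bar> = 1\<close>, then along it \<open>(2\<zeta>\<^sup>*p - s)/(2 - \<zeta>\<^sup>*s)\<close> attains its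
  maximal modulus \<open>1\<close>, hence is constant, with value \<open>- \<zeta>\<close>; this is the equation of the tangent line at
  \<open>\<zeta>\<close>. The denominator vanishes only where \<open>\<bar>s\<bar> = 2\<close>, and if that happens somewhere, then \<open>s\<close> is
  constant.\<close>

lemma boundary_disc_on_tangent_line:
  assumes hol: "\<psi>\<^sub>1 holomorphic_on ball 0 1" "\<psi>\<^sub>2 holomorphic_on ball 0 1"
    and bd: "\<And>w. cmod w < 1 \<Longrightarrow> \<exists>u v. (\<psi>\<^sub>1 w, \<psi>\<^sub>2 w) = sympair u v \<and> cmod u = 1 \<and> cmod v \<le> 1"
  obtains \<zeta> where "\<And>w. cmod w < 1 \<Longrightarrow> on_tangent_line \<zeta> (\<psi>\<^sub>1 w, \<psi>\<^sub>2 w)"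
proof (cases "\<exists>w. cmod w < 1 \<and> cmod (\<psi>\<^sub>1 w) = 2")
  case True
  have le2: "cmod (\<psi>\<^sub>1 w) \<le> 2" if w: "cmod w < 1" for w
  proof -
    obtain u v where "(\<psi>\<^sub>1 w, \<psi>\<^sub>2 w) = sympair u v" "cmod u = 1" "cmod v \<le> 1"
      using bd[OF w] by blast
    then show ?thesis
      using norm_triangle_ineq[of u v] by (simp add: sympair_def)
  qed
  from True obtain w\<^sub>0 where w0: "cmod w\<^sub>0 < 1" "cmod (\<psi>\<^sub>1 w\<^sub>0) = 2" by blast
  have "\<psi>\<^sub>1 constant_on ball 0 1"
    by (rule maximum_modulus_principle[OF hol(1) _ _ open_ball order_refl, of w\<^sub>0]) (use w0 le2 in auto)
  then have const: "\<psi>\<^sub>1 w = \<psi>\<^sub>1 w\<^sub>0" if "cmod w < 1" for w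
    using w0 that unfolding constant_on_def by (metis mem_ball_0)
  have "on_tangent_line (\<psi>\<^sub>1 w\<^sub>0 / 2) (\<psi>\<^sub>1 w, \<psi>\<^sub>2 w)" if w: "cmod w < 1" for w
  proof -
    obtain u v where uv: "(\<psi>\<^sub>1 w, \<psi>\<^sub>2 w) = sympair u v" "cmod u = 1" "cmod v \<le> 1"
      using bd[OF w] by blast
    moreover have s: "\<psi>\<^sub>1 w\<^sub>0 = u + v"
      using uv const[OF w] by (simp add: sympair_def)
    ultimately have "u = v"
      using sum_of_norm_2 w0 by simp
    then show ?thesis
      using uv(1) s by (simp add: on_tangent_line_sympair)
  qed
  then show ?thesis by (rule that)
next
  case False
  obtain u\<^sub>0 v\<^sub>0 where uv0: "(\<psi>\<^sub>1 0, \<psi>\<^sub>2 0) = sympair u\<^sub>0 v\<^sub>0" "cmod u\<^sub>0 = 1" "cmod v\<^sub>0 \<le> 1"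
    using bd[of 0] by auto
  define \<omega> where "\<omega> = cnj u\<^sub>0"
  have om: "cmod \<omega> = 1" "\<omega> * u\<^sub>0 = 1" "u\<^sub>0 * \<omega> = 1"
    using uv0 of_real_cmod_square[of u\<^sub>0] by (auto simp: \<omega>_def mult.commute)
  define N M where "N w = 2 * \<omega> * \<psi>\<^sub>2 w - \<psi>\<^sub>1 w" and "M w = 2 - \<omega> * \<psi>\<^sub>1 w" for w
  have M: "M w \<noteq> 0" if "cmod w < 1" for w
  proof
    assume "M w = 0"
    then have "\<omega> * \<psi>\<^sub>1 w = 2" by (simp add: M_def)
    then have "cmod (\<psi>\<^sub>1 w) = 2"
      using om(1) by (metis mult_1 norm_mult norm_numeral)
    then show False using False that by blast
  qed
  have bound: "cmod (N w / M w) \<le> 1" if w: "cmod w < 1" for w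
  proof -
    obtain u v where uv: "(\<psi>\<^sub>1 w, \<psi>\<^sub>2 w) = sympair u v" "cmod u = 1" "cmod v \<le> 1"
      using bd[OF w] by blast
    have "\<omega> * N w = 2 * ((\<omega> * u) * (\<omega> * v)) - (\<omega> * u + \<omega> * v)" "M w = 2 - (\<omega> * u + \<omega> * v)"
      using uv(1) by (auto simp: N_def M_def sympair_def algebra_simps)
    moreover have "cmod (\<omega> * u) \<le> 1" "cmod (\<omega> * v) \<le> 1"
      using uv om(1) by (auto simp: norm_mult)
    ultimately have "cmod (\<omega> * N w) \<le> cmod (M w)"
      using magic_function_bound by metis
    then show ?thesis
      using M[OF w] om(1) by (simp add: norm_mult norm_divide divide_le_eq)
  qed
  have at0: "N 0 / M 0 = - u\<^sub>0"
  proof -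
    have "N 0 = 2 * (\<omega> * u\<^sub>0) * v\<^sub>0 - (u\<^sub>0 + v\<^sub>0)" "M 0 = 2 - \<omega> * u\<^sub>0 - \<omega> * v\<^sub>0"
      using uv0(1) by (auto simp: N_def M_def sympair_def algebra_simps)
    then have "N 0 = v\<^sub>0 - u\<^sub>0" "M 0 = 1 - \<omega> * v\<^sub>0"
      unfolding om by auto
    moreover have "- u\<^sub>0 * (1 - \<omega> * v\<^sub>0) = (u\<^sub>0 * \<omega>) * v\<^sub>0 - u\<^sub>0"
      by (simp add: algebra_simps)
    ultimately show ?thesis
      using M[of 0] om(3) by (simp add: divide_eq_eq)
  qed
  have "(\<lambda>w. N w / M w) constant_on ball 0 1"
    by (rule maximum_modulus_principle[OF _ open_ball _ open_ball order_refl, of _ _ _ 0])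
       (use bound at0 M uv0(2) in \<open>auto intro!: holomorphic_intros hol simp: N_def[abs_def] M_def[abs_def]\<close>)
  then have "N w / M w = N 0 / M 0" if "cmod w < 1" for w
    using that unfolding constant_on_def by (metis mem_ball_0 norm_zero zero_less_one)
  then have "N w = - u\<^sub>0 * M w" if "cmod w < 1" for w
    using that M at0 by (simp add: divide_eq_eq)
  then have eq: "2 * \<omega> * \<psi>\<^sub>2 w - \<psi>\<^sub>1 w = - u\<^sub>0 * (2 - \<omega> * \<psi>\<^sub>1 w)" if "cmod w < 1" for w
    using that by (simp add: N_def M_def)
  have "on_tangent_line u\<^sub>0 (\<psi>\<^sub>1 w, \<psi>\<^sub>2 w)" if "cmod w < 1" for w
  proof -
    have "2 * (\<psi>\<^sub>2 w - u\<^sub>0 * \<psi>\<^sub>1 w + u\<^sub>0\<^sup>2)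
       = u\<^sub>0 * (2 * \<omega> * \<psi>\<^sub>2 w - \<psi>\<^sub>1 w) - u\<^sub>0 * (- u\<^sub>0 * (2 - \<omega> * \<psi>\<^sub>1 w))
         + 2 * \<psi>\<^sub>2 w * (1 - \<omega> * u\<^sub>0) - u\<^sub>0 * \<psi>\<^sub>1 w * (1 - \<omega> * u\<^sub>0)"
      by (simp add: power2_eq_square algebra_simps)
    also have "\<dots> = 0"
      unfolding om eq[OF that] by simp
    finally have "\<psi>\<^sub>2 w - u\<^sub>0 * \<psi>\<^sub>1 w + u\<^sub>0\<^sup>2 = 0"
      by (metis mult_eq_0_iff zero_neq_numeral)
    then show ?thesis
      by (simp add: on_tangent_line_def)
  qed
  then show ?thesis by (rule that)
qed

lemma bounded_sequence_convergent_subsequence: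
  fixes F :: "nat \<Rightarrow> complex \<Rightarrow> complex"
  assumes "\<And>n. F n holomorphic_on ball 0 1" "\<And>n w. cmod w < 1 \<Longrightarrow> cmod (F n w) \<le> B"
  shows "\<exists>\<psi> \<rho>. \<psi> holomorphic_on ball 0 1 \<and> strict_mono (\<rho> :: nat \<Rightarrow> nat) \<and>
    (\<forall>w\<in>ball 0 1. (\<lambda>n. F (\<rho> n) w) \<longlonglongrightarrow> \<psi> w)"
proof (rule Montel[of "ball 0 1" "range F" F])
  fix K :: "complex set" assume "K \<subseteq> ball 0 1"
  then show "\<exists>C. \<forall>h\<in>range F. \<forall>z\<in>K. cmod (h z) \<le> C"
    using assms(2) by (intro exI[of _ B]) auto
next
  fix \<psi> \<rho> assume "\<psi> holomorphic_on ball 0 1" "strict_mono (\<rho> :: nat \<Rightarrow> nat)"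
    "\<And>w. w \<in> ball 0 1 \<Longrightarrow> (\<lambda>n. F (\<rho> n) w) \<longlonglongrightarrow> \<psi> w"
  then show ?thesis by blast
qed (use assms(1) in auto)

text \<open>If \<open>f\<close> is an automorphism and \<open>z\<close> tends to the circle, then by properness the discs
  \<open>w \<mapsto> f(sympair z w)\<close> accumulate at discs in the boundary, and these lie on tangent lines. Hence the
  chord form of two points of such a disc, holomorphic in \<open>z\<close>, has boundary values \<open>0\<close> and
  vanishes.\<close>

lemma automorphism_chord_form:
  assumes f: "holo_map_on f sym_bidisc" "f ` sym_bidisc \<subseteq> sym_bidisc"
    and k: "holo_map_on k sym_bidisc" "\<And>q. q \<in> sym_bidisc \<Longrightarrow> k q \<in> sym_bidisc"
    and kf: "\<And>q. q \<in> sym_bidisc \<Longrightarrow> k (f q) = q"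
    and z0: "cmod z\<^sub>0 < 1" and w: "cmod w\<^sub>1 < 1" "cmod w\<^sub>2 < 1"
  shows "chord_form (f (sympair z\<^sub>0 w\<^sub>1)) (f (sympair z\<^sub>0 w\<^sub>2)) = 0"
proof -
  define g where "g z w = f (sympair z w)" for z w
  have g_in: "g z w \<in> sym_bidisc" if "cmod z < 1" "cmod w < 1" for z w
    using f(2) that by (auto simp: g_def image_subset_iff)
  have hol: "(\<lambda>z. fst (g z w)) holomorphic_on ball 0 1" "(\<lambda>z. snd (g z w)) holomorphic_on ball 0 1"
      "(\<lambda>z. fst (g w z)) holomorphic_on ball 0 1" "(\<lambda>z. snd (g w z)) holomorphic_on ball 0 1"
    if "cmod w < 1" for w
    unfolding g_def using f(1) that unfolding holo_map_on_def
    by (auto intro!: holo2_compose_sympair[where f = "\<lambda>q. fst (f q)"]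
        holo2_compose_sympair[where f = "\<lambda>q. snd (f q)"] holomorphic_intros)
  have fst_le: "cmod (fst q) \<le> 2" and snd_le: "cmod (snd q) \<le> 2" if q: "q \<in> sym_bidisc" for q
  proof -
    obtain u v where uv: "q = sympair u v" "cmod u < 1" "cmod v < 1"
      using q by (rule sym_bidisc_cases)
    show "cmod (fst q) \<le> 2"
      using uv norm_triangle_ineq[of u v] by (simp add: sympair_def)
    have "cmod u * cmod v \<le> 1"
      using uv by (intro mult_le_one) auto
    then show "cmod (snd q) \<le> 2"
      using uv by (simp add: sympair_def norm_mult)
  qed
  define e where "e z = chord_form (g z w\<^sub>1) (g z w\<^sub>2)" for z
  have e_hol: "e holomorphic_on ball 0 1"
    unfolding e_def[abs_def] chord_form_def by (intro holomorphic_intros hol w)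
  have small: "\<exists>r<1. \<forall>z. r < cmod z \<and> cmod z < 1 \<longrightarrow> cmod (e z) < \<epsilon>" if "\<epsilon> > 0" for \<epsilon>
  proof (rule ccontr)
    assume contra: "\<not> ?thesis"
    have "\<exists>z. 1 - inverse (real (Suc n)) < cmod z \<and> cmod z < 1 \<and> \<epsilon> \<le> cmod (e z)" for n
    proof -
      have "1 - inverse (real (Suc n)) < 1" by simp
      then show ?thesis using contra by (meson not_less)
    qed
    then obtain Z where Z: "\<And>n. 1 - inverse (real (Suc n)) < cmod (Z n)" "\<And>n. cmod (Z n) < 1"
        "\<And>n. \<epsilon> \<le> cmod (e (Z n))"
      by metis
    have normZ: "(\<lambda>n. cmod (Z n)) \<longlonglongrightarrow> 1"
    proof (rule real_tendsto_sandwich)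
      show "(\<lambda>n. 1 - inverse (real (Suc n))) \<longlonglongrightarrow> 1"
        using tendsto_diff[OF tendsto_const[of 1] LIMSEQ_inverse_real_of_nat] by simp
      show "\<forall>\<^sub>F n in sequentially. 1 - inverse (real (Suc n)) \<le> cmod (Z n)"
        by (intro always_eventually allI less_imp_le Z(1))
      show "\<forall>\<^sub>F n in sequentially. cmod (Z n) \<le> 1"
        by (intro always_eventually allI less_imp_le Z(2))
    qed simp
    have "\<forall>n. Z n \<in> cball 0 1"
      using Z(2) by (simp add: less_imp_le)
    then obtain l \<sigma> where l: "strict_mono (\<sigma> :: nat \<Rightarrow> nat)" "(Z \<circ> \<sigma>) \<longlonglongrightarrow> l"
      using compact_cball[of "0::complex" 1] unfolding compact_def by meson
    have "(\<lambda>n. cmod ((Z \<circ> \<sigma>) n)) \<longlonglongrightarrow> 1"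
      using LIMSEQ_subseq_LIMSEQ[OF normZ l(1)] by (simp add: o_def)
    then have l1: "cmod l = 1"
      using tendsto_norm[OF l(2)] LIMSEQ_unique by blast
    have "\<exists>\<psi>\<^sub>1 \<rho>\<^sub>1. \<psi>\<^sub>1 holomorphic_on ball 0 1 \<and> strict_mono (\<rho>\<^sub>1 :: nat \<Rightarrow> nat) \<and>
        (\<forall>w\<in>ball 0 1. (\<lambda>n. fst (g (Z (\<sigma> (\<rho>\<^sub>1 n))) w)) \<longlonglongrightarrow> \<psi>\<^sub>1 w)"
      by (rule bounded_sequence_convergent_subsequence[where B = 2]) (use Z(2) hol in \<open>auto intro!: fst_le g_in\<close>)
    then obtain \<psi>\<^sub>1 \<rho>\<^sub>1 where \<psi>1: "\<psi>\<^sub>1 holomorphic_on ball 0 1" "strict_mono (\<rho>\<^sub>1 :: nat \<Rightarrow> nat)"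
        "\<And>w. w \<in> ball 0 1 \<Longrightarrow> (\<lambda>n. fst (g (Z (\<sigma> (\<rho>\<^sub>1 n))) w)) \<longlonglongrightarrow> \<psi>\<^sub>1 w"
      by blast
    have "\<exists>\<psi>\<^sub>2 \<rho>\<^sub>2. \<psi>\<^sub>2 holomorphic_on ball 0 1 \<and> strict_mono (\<rho>\<^sub>2 :: nat \<Rightarrow> nat) \<and>
        (\<forall>w\<in>ball 0 1. (\<lambda>n. snd (g (Z (\<sigma> (\<rho>\<^sub>1 (\<rho>\<^sub>2 n)))) w)) \<longlonglongrightarrow> \<psi>\<^sub>2 w)"
      by (rule bounded_sequence_convergent_subsequence[where B = 2]) (use Z(2) hol in \<open>auto intro!: snd_le g_in\<close>)
    then obtain \<psi>\<^sub>2 \<rho>\<^sub>2 where \<psi>2: "\<psi>\<^sub>2 holomorphic_on ball 0 1" "strict_mono (\<rho>\<^sub>2 :: nat \<Rightarrow> nat)"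
        "\<And>w. w \<in> ball 0 1 \<Longrightarrow> (\<lambda>n. snd (g (Z (\<sigma> (\<rho>\<^sub>1 (\<rho>\<^sub>2 n)))) w)) \<longlonglongrightarrow> \<psi>\<^sub>2 w"
      by blast
    define y where "y n = Z (\<sigma> (\<rho>\<^sub>1 (\<rho>\<^sub>2 n)))" for n
    have y1: "cmod (y n) < 1" and ye: "\<epsilon> \<le> cmod (e (y n))" for n
      using Z by (auto simp: y_def)
    have y_lim: "y \<longlonglongrightarrow> l"
      using LIMSEQ_subseq_LIMSEQ[OF LIMSEQ_subseq_LIMSEQ[OF l(2) \<psi>1(2)] \<psi>2(2)]
      by (simp add: o_def y_def[abs_def])
    have g_lim1: "(\<lambda>n. fst (g (y n) w)) \<longlonglongrightarrow> \<psi>\<^sub>1 w" and g_lim2: "(\<lambda>n. snd (g (y n) w)) \<longlonglongrightarrow> \<psi>\<^sub>2 w"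
      if "cmod w < 1" for w
      using LIMSEQ_subseq_LIMSEQ[OF \<psi>1(3) \<psi>2(2)] \<psi>2(3) that by (auto simp: o_def y_def)
    have bd: "\<exists>u v. (\<psi>\<^sub>1 w, \<psi>\<^sub>2 w) = sympair u v \<and> cmod u = 1 \<and> cmod v \<le> 1" if w: "cmod w < 1" for w
    proof -
      have lim: "(\<lambda>n. g (y n) w) \<longlonglongrightarrow> (\<psi>\<^sub>1 w, \<psi>\<^sub>2 w)"
        using tendsto_Pair[OF g_lim1[OF w] g_lim2[OF w]] by simp
      define K where "K = (\<lambda>x. sympair (fst x) (snd x)) ` (cball 0 1 \<times> cball 0 1)"
      have "closed K"
        unfolding K_def sympair_def
        by (intro compact_imp_closed compact_continuous_image compact_Times compact_cball continuous_intros)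
      moreover have "g (y n) w \<in> K" for n
      proof -
        obtain u v where "g (y n) w = sympair u v" "cmod u < 1" "cmod v < 1"
          using g_in[OF y1 w] sym_bidisc_cases by blast
        then show ?thesis
          unfolding K_def by (intro image_eqI[of _ _ "(u, v)"]) auto
      qed
      ultimately have "(\<psi>\<^sub>1 w, \<psi>\<^sub>2 w) \<in> K"
        by (rule closed_sequentially[OF _ _ lim])
      then obtain u v where uv: "(\<psi>\<^sub>1 w, \<psi>\<^sub>2 w) = sympair u v" "cmod u \<le> 1" "cmod v \<le> 1"
        by (auto simp: K_def)
      have "\<not> (cmod u < 1 \<and> cmod v < 1)"
      proof
        assume "cmod u < 1 \<and> cmod v < 1"
        then have q: "(\<psi>\<^sub>1 w, \<psi>\<^sub>2 w) \<in> sym_bidisc"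
          using uv(1) by simp
        have "continuous_on sym_bidisc (\<lambda>q. fst (k q))" "continuous_on sym_bidisc (\<lambda>q. snd (k q))"
          using k(1) has_derivative_continuous
          unfolding holo_map_on_def holo2_on_def continuous_on_eq_continuous_within by blast+
        then have "continuous_on sym_bidisc k"
          using continuous_on_Pair by fastforce
        then have "(\<lambda>n. k (g (y n) w)) \<longlonglongrightarrow> k (\<psi>\<^sub>1 w, \<psi>\<^sub>2 w)"
          by (rule continuous_on_tendsto_compose[OF _ lim q]) (use g_in y1 w in auto)
        moreover have "k (g (y n) w) = sympair (y n) w" for n
          unfolding g_def using y1 w by (intro kf) simp
        moreover have "(\<lambda>n. sympair (y n) w) \<longlonglongrightarrow> sympair l w"
          unfolding sympair_def by (intro tendsto_intros y_lim)
        ultimately have "k (\<psi>\<^sub>1 w, \<psi>\<^sub>2 w) = sympair l w"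
          by (simp add: LIMSEQ_unique)
        then show False
          using k(2)[OF q] l1 by simp
      qed
      then show ?thesis
        using uv sympair_commute by (metis order_le_less)
    qed
    obtain \<zeta> where "\<And>w. cmod w < 1 \<Longrightarrow> on_tangent_line \<zeta> (\<psi>\<^sub>1 w, \<psi>\<^sub>2 w)"
      using boundary_disc_on_tangent_line[OF \<psi>1(1) \<psi>2(1) bd] by blast
    then have "chord_form (\<psi>\<^sub>1 w\<^sub>1, \<psi>\<^sub>2 w\<^sub>1) (\<psi>\<^sub>1 w\<^sub>2, \<psi>\<^sub>2 w\<^sub>2) = 0"
      using w chord_form_eq_0 by blast
    moreover have "(\<lambda>n. e (y n)) \<longlonglongrightarrow> chord_form (\<psi>\<^sub>1 w\<^sub>1, \<psi>\<^sub>2 w\<^sub>1) (\<psi>\<^sub>1 w\<^sub>2, \<psi>\<^sub>2 w\<^sub>2)"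
      unfolding e_def chord_form_def fst_conv snd_conv by (intro tendsto_intros g_lim1 g_lim2 w)
    ultimately have "(\<lambda>n. cmod (e (y n))) \<longlonglongrightarrow> 0"
      using tendsto_norm_zero by simp
    then have "\<epsilon> \<le> 0"
      by (rule LIMSEQ_le_const) (use ye in auto)
    then show False using \<open>\<epsilon> > 0\<close> by simp
  qed
  have "cmod (e z\<^sub>0) \<le> \<epsilon>" if "\<epsilon> > 0" for \<epsilon>
  proof -
    obtain r where r: "r < 1" "\<And>z. r < cmod z \<Longrightarrow> cmod z < 1 \<Longrightarrow> cmod (e z) < \<epsilon>"
      using small[OF \<open>\<epsilon> > 0\<close>] by blast
    define \<rho> where "\<rho> = (1 + max r (cmod z\<^sub>0)) / 2"
    have rho: "r < \<rho>" "cmod z\<^sub>0 < \<rho>" "\<rho> < 1"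
      using r(1) z0 by (auto simp: \<rho>_def)
    show ?thesis
    proof (rule maximum_modulus_frontier[of e "cball 0 \<rho>"])
      show "e holomorphic_on interior (cball 0 \<rho>)"
        using e_hol rho by (auto intro: holomorphic_on_subset)
      show "continuous_on (closure (cball 0 \<rho>)) e"
        using e_hol rho by (auto intro!: holomorphic_on_imp_continuous_on elim: holomorphic_on_subset)
    qed (use rho r(2) less_imp_le in auto)
  qed
  then have "e z\<^sub>0 = 0"
    by (metis dense_le_bounded field_le_epsilon add_0 norm_le_zero_iff)
  then show ?thesis
    by (simp add: e_def g_def)
qed

text \<open>Two-element sets that meet pairwise have a common element unless they are the three sides of
  a triangle; here the sets are the roots of the points \<open>P w\<close>, and a fourth point excludes the
  triangle.\<close>

lemma common_tangent_line:
  fixes P :: "complex \<Rightarrow> complex \<times> complex"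
  assumes inj: "inj_on P (ball 0 1)"
    and pair: "\<And>v w. v \<in> ball 0 1 \<Longrightarrow> w \<in> ball 0 1 \<Longrightarrow> v \<noteq> w \<Longrightarrow>
      \<exists>\<theta>. on_tangent_line \<theta> (P v) \<and> on_tangent_line \<theta> (P w)"
  obtains \<theta> where "\<And>w. cmod w < 1 \<Longrightarrow> on_tangent_line \<theta> (P w)"
proof -
  define w\<^sub>1 w\<^sub>2 :: complex where "w\<^sub>1 = 0" and "w\<^sub>2 = 1/2"
  have w12: "w\<^sub>1 \<in> ball 0 1" "w\<^sub>2 \<in> ball 0 1" "w\<^sub>1 \<noteq> w\<^sub>2"
    by (auto simp: w\<^sub>1_def w\<^sub>2_def)
  obtain \<theta> where \<theta>: "on_tangent_line \<theta> (P w\<^sub>1)" "on_tangent_line \<theta> (P w\<^sub>2)"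
    using pair w12 by blast
  have "on_tangent_line \<theta> (P w)" if w: "w \<in> ball 0 1" for w
  proof (rule ccontr)
    assume not: "\<not> on_tangent_line \<theta> (P w)"
    then have ww: "w \<noteq> w\<^sub>1" "w \<noteq> w\<^sub>2"
      using \<theta> by auto
    obtain \<alpha> where \<alpha>: "on_tangent_line \<alpha> (P w\<^sub>1)" "on_tangent_line \<alpha> (P w)"
      using pair w12 w ww by blast
    obtain \<beta> where \<beta>: "on_tangent_line \<beta> (P w\<^sub>2)" "on_tangent_line \<beta> (P w)"
      using pair w12 w ww by blast
    have ne: "\<theta> \<noteq> \<alpha>" "\<theta> \<noteq> \<beta>"
      using not \<alpha> \<beta> by auto
    have P: "P w\<^sub>1 = sympair \<theta> \<alpha>" "P w\<^sub>2 = sympair \<theta> \<beta>"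
      using on_two_tangent_lines ne \<theta> \<alpha> \<beta> by auto
    have "\<alpha> \<noteq> \<beta>"
      using P inj w12 by (metis inj_onD)
    then have Pw: "P w = sympair \<alpha> \<beta>"
      using on_two_tangent_lines \<alpha> \<beta> by auto
    have "infinite (ball (0::complex) 1 - {w\<^sub>1, w\<^sub>2, w})"
      using not_open_singleton uncountable_ball[of 1 "0::complex"]
      by (metis Diff_infinite_finite countable_finite finite.emptyI finite.insertI zero_less_one)
    then obtain x where x: "x \<in> ball 0 1" "x \<notin> {w\<^sub>1, w\<^sub>2, w}"
      by (metis DiffD1 DiffD2 ex_in_conv finite.emptyI)
    have Px: "P x \<noteq> P w\<^sub>1" "P x \<noteq> P w\<^sub>2" "P x \<noteq> P w"
      using inj x w12 w by (auto dest: inj_onD)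
    have "on_tangent_line \<theta> (P x) \<or> on_tangent_line \<alpha> (P x)"
      using pair[OF x(1) w12(1)] x(2) unfolding P on_tangent_line_sympair by blast
    moreover have "on_tangent_line \<theta> (P x) \<or> on_tangent_line \<beta> (P x)"
      using pair[OF x(1) w12(2)] x(2) unfolding P on_tangent_line_sympair by blast
    moreover have "on_tangent_line \<alpha> (P x) \<or> on_tangent_line \<beta> (P x)"
      using pair[OF x(1) w] x(2) unfolding Pw on_tangent_line_sympair by blast
    ultimately show False
      using Px on_two_tangent_lines ne \<open>\<alpha> \<noteq> \<beta>\<close> unfolding P Pw by metis
  qed
  then show ?thesis
    by (intro that[of \<theta>]) auto
qed

text \<open>The parameter \<open>m z\<close> of the common tangent line is the slope of any chord of the image of \<open>w \<mapsto>
  sympair z w\<close>; for chords with fixed \<open>w\<close>-ends it is visibly holomorphic in \<open>z\<close>.\<close>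

lemma automorphism_maps_tangent_lines:
  assumes f: "holo_map_on f sym_bidisc" "f ` sym_bidisc \<subseteq> sym_bidisc"
    and k: "holo_map_on k sym_bidisc" "\<And>q. q \<in> sym_bidisc \<Longrightarrow> k q \<in> sym_bidisc"
    and kf: "\<And>q. q \<in> sym_bidisc \<Longrightarrow> k (f q) = q"
  obtains m where "m holomorphic_on ball 0 1" "\<And>z. cmod z < 1 \<Longrightarrow> cmod (m z) < 1"
    "\<And>z w. cmod z < 1 \<Longrightarrow> cmod w < 1 \<Longrightarrow> on_tangent_line (m z) (f (sympair z w))"
proof -
  have inj: "f (sympair z v) \<noteq> f (sympair z w)" if "cmod z < 1" "cmod v < 1" "cmod w < 1" "v \<noteq> w" for z v w
    using that kf[of "sympair z v"] kf[of "sympair z w"] by (auto simp: sympair_eq_iff)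
  have "\<exists>\<theta>. \<forall>w. cmod w < 1 \<longrightarrow> on_tangent_line \<theta> (f (sympair z w))" if z: "cmod z < 1" for z
  proof (rule common_tangent_line[of "\<lambda>w. f (sympair z w)"])
    show "inj_on (\<lambda>w. f (sympair z w)) (ball 0 1)"
      using inj z by (force simp: inj_on_def)
    fix v w assume vw: "v \<in> ball (0::complex) 1" "w \<in> ball (0::complex) 1" "v \<noteq> w"
    have "chord_form (f (sympair z v)) (f (sympair z w)) = 0"
      by (rule automorphism_chord_form[OF f k kf z]) (use vw in auto)
    then show "\<exists>\<theta>. on_tangent_line \<theta> (f (sympair z v)) \<and> on_tangent_line \<theta> (f (sympair z w))"
      by (rule chord_form_imp_tangent_line) (use inj[OF z] vw in auto)
  qed blast
  then obtain m where m: "\<And>z w. cmod z < 1 \<Longrightarrow> cmod w < 1 \<Longrightarrow> on_tangent_line (m z) (f (sympair z w))"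
    by metis
  have m1: "cmod (m z) < 1" if "cmod z < 1" for z
  proof -
    have "f (sympair z 0) \<in> sym_bidisc"
      using f(2) that by (auto simp: image_subset_iff)
    then show ?thesis
      by (rule sym_bidisc_cases) (use m[OF that, of 0] in \<open>auto simp: on_tangent_line_sympair\<close>)
  qed
  define x y where "x z = fst (f (sympair z (1/2))) - fst (f (sympair z 0))"
    and "y z = snd (f (sympair z (1/2))) - snd (f (sympair z 0))" for z
  have xy: "x z \<noteq> 0 \<and> m z = y z / x z" if z: "cmod z < 1" for z
  proof -
    have "on_tangent_line (m z) (f (sympair z 0))" "on_tangent_line (m z) (f (sympair z (1/2)))"
      using m[OF z] by (auto simp: norm_divide)
    moreover have "y z - m z * x z =
        (snd (f (sympair z (1/2))) - m z * fst (f (sympair z (1/2))) + (m z)\<^sup>2)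
        - (snd (f (sympair z 0)) - m z * fst (f (sympair z 0)) + (m z)\<^sup>2)"
      by (simp add: x_def y_def algebra_simps)
    ultimately have eq: "y z = m z * x z"
      by (simp add: on_tangent_line_def)
    have "f (sympair z 0) \<noteq> f (sympair z (1/2))"
      by (rule inj[OF z]) (auto simp: norm_divide)
    then have "x z \<noteq> 0"
      using eq by (auto simp: x_def y_def prod_eq_iff)
    then show ?thesis
      using eq by simp
  qed
  have "x holomorphic_on ball 0 1" "y holomorphic_on ball 0 1"
    unfolding x_def[abs_def] y_def[abs_def] using f(1) unfolding holo_map_on_def
    by (auto intro!: holomorphic_on_diff holo2_compose_sympair[where f = "\<lambda>q. fst (f q)"]
        holo2_compose_sympair[where f = "\<lambda>q. snd (f q)"] holomorphic_intros simp: norm_divide)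
  then have "(\<lambda>z. y z / x z) holomorphic_on ball 0 1"
    using xy by (intro holomorphic_intros) auto
  then have "m holomorphic_on ball 0 1"
    by (rule holomorphic_transform) (use xy in auto)
  then show ?thesis
    using that m m1 by blast
qed

text \<open>The maps \<open>m\<close> and \<open>n\<close> of tangent lines induced by \<open>f\<close> and by its inverse are inverse to each other,
  and a point \<open>sympair z w\<close> with \<open>z \<noteq> w\<close> is the intersection of the tangent lines with parameters
  \<open>z\<close> and \<open>w\<close>.\<close>

lemma automorphism_of_sym_bidisc:
  assumes "f \<in> Aut_sym_bidisc"
  obtains a b where "cmod b < cmod a"
    "\<And>z w. cmod z < 1 \<Longrightarrow> cmod w < 1 \<Longrightarrow> z \<noteq> w \<Longrightarrow> f (sympair z w) = sympair (mob a b z) (mob a b w)"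
proof -
  define k where "k = inv_into sym_bidisc f"
  have bij: "bij_betw f sym_bidisc sym_bidisc" and f: "holo_map_on f sym_bidisc" and k: "holo_map_on k sym_bidisc"
    using assms by (auto simp: Aut_sym_bidisc_def k_def)
  have bijk: "bij_betw k sym_bidisc sym_bidisc"
    unfolding k_def by (rule bij_betw_inv_into[OF bij])
  have kf: "k (f q) = q" and fk: "f (k q) = q" if "q \<in> sym_bidisc" for q
    using bij that bij_betw_inv_into_left bij_betw_inv_into_right unfolding k_def by fastforce+
  have fG: "f q \<in> sym_bidisc" and kG: "k q \<in> sym_bidisc" if "q \<in> sym_bidisc" for q
    using bij bijk that bij_betwE by blast+
  obtain m where m: "m holomorphic_on ball 0 1" "\<And>z. cmod z < 1 \<Longrightarrow> cmod (m z) < 1"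
      "\<And>z w. cmod z < 1 \<Longrightarrow> cmod w < 1 \<Longrightarrow> on_tangent_line (m z) (f (sympair z w))"
    using automorphism_maps_tangent_lines[OF f _ k kG kf] fG by blast
  obtain n where n: "n holomorphic_on ball 0 1" "\<And>z. cmod z < 1 \<Longrightarrow> cmod (n z) < 1"
      "\<And>z w. cmod z < 1 \<Longrightarrow> cmod w < 1 \<Longrightarrow> on_tangent_line (n z) (k (sympair z w))"
    using automorphism_maps_tangent_lines[OF k _ f fG fk] kG by blast
  have nm: "n (m z) = z" if z: "cmod z < 1" for z
  proof (rule ccontr)
    assume ne: "n (m z) \<noteq> z"
    have all: "n (m z) = w" if w: "cmod w < 1" for w
    proof -
      have q: "f (sympair z w) \<in> sym_bidisc"
        using fG z w by simp
      then obtain u v where uv: "f (sympair z w) = sympair u v" "cmod u < 1" "cmod v < 1"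
        by (rule sym_bidisc_cases)
      then obtain v' where v': "f (sympair z w) = sympair (m z) v'" "cmod v' < 1"
        using m(3)[OF z w] by (auto simp: on_tangent_line_sympair sympair_commute)
      have "on_tangent_line (n (m z)) (k (f (sympair z w)))"
        unfolding v' by (rule n(3)) (use m(2)[OF z] v' in auto)
      then have "on_tangent_line (n (m z)) (sympair z w)"
        using kf z w by simp
      then show ?thesis
        using ne by (auto simp: on_tangent_line_sympair)
    qed
    have "n (m z) = 0" "n (m z) = 1/2"
      by (rule all; simp add: norm_divide)+
    then show False by simp
  qed
  obtain a b where ab: "cmod b < cmod a" "\<And>z. cmod z < 1 \<Longrightarrow> m z = mob a b z"
    using left_invertible_disc_map_is_mob[OF m(1,2) n(1,2) nm] by metis
  have "f (sympair z w) = sympair (m z) (m w)" if "cmod z < 1" "cmod w < 1" "z \<noteq> w" for z w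
  proof (rule on_two_tangent_lines)
    show "m z \<noteq> m w"
      using nm that by metis
    show "on_tangent_line (m z) (f (sympair z w))" "on_tangent_line (m w) (f (sympair z w))"
      using m(3) that sympair_commute by metis+
  qed
  then show ?thesis
    using that ab by metis
qed

section \<open>Orbits and the sharp direction\<close>

text \<open>The automorphism of the symmetrized bidisc induced by \<open>mob a b\<close>, written in the coordinates
  \<open>s = z + w\<close>, \<open>p = zw\<close>.\<close>

definition sym_mob :: "complex \<Rightarrow> complex \<Rightarrow> complex \<times> complex \<Rightarrow> complex \<times> complex" where
  "sym_mob a b q =
     ((2 * cnj a * b + (a * cnj a + b * cnj b) * fst q + 2 * a * cnj b * snd q)
        / ((cnj a)\<^sup>2 + cnj a * cnj b * fst q + (cnj b)\<^sup>2 * snd q),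
      (b\<^sup>2 + a * b * fst q + a\<^sup>2 * snd q)
        / ((cnj a)\<^sup>2 + cnj a * cnj b * fst q + (cnj b)\<^sup>2 * snd q))"

lemma sym_mob_denom:
  "(cnj a)\<^sup>2 + cnj a * cnj b * fst (sympair z w) + (cnj b)\<^sup>2 * snd (sympair z w)
    = (cnj b * z + cnj a) * (cnj b * w + cnj a)"
  by (simp add: sympair_def power2_eq_square algebra_simps)

lemma sym_mob_sympair:
  assumes "cmod b < cmod a" "cmod z < 1" "cmod w < 1"
  shows "sym_mob a b (sympair z w) = sympair (mob a b z) (mob a b w)"
proof -
  have nz: "cnj b * z + cnj a \<noteq> 0" "cnj b * w + cnj a \<noteq> 0"
    using mob_denom_nonzero[OF assms(1)] assms(2,3) by auto
  have "2 * cnj a * b + (a * cnj a + b * cnj b) * fst (sympair z w) + 2 * a * cnj b * snd (sympair z w)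
      = (a * z + b) * (cnj b * w + cnj a) + (a * w + b) * (cnj b * z + cnj a)"
    "b\<^sup>2 + a * b * fst (sympair z w) + a\<^sup>2 * snd (sympair z w) = (a * z + b) * (a * w + b)"
    by (simp_all add: sympair_def power2_eq_square algebra_simps)
  then show ?thesis
    using nz unfolding sym_mob_def sym_mob_denom by (simp add: sympair_def mob_def add_frac_eq)
qed

lemma holo2_on_affine_quotient:
  assumes "\<And>q. q \<in> S \<Longrightarrow> \<alpha>' + \<beta>' * fst q + \<gamma>' * snd q \<noteq> 0"
  shows "holo2_on (\<lambda>q. (\<alpha> + \<beta> * fst q + \<gamma> * snd q) / (\<alpha>' + \<beta>' * fst q + \<gamma>' * snd q)) S"
  unfolding holo2_on_def
proof (intro ballI exI)
  fix q assume q: "q \<in> S"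
  define N M where "N = \<alpha> + \<beta> * fst q + \<gamma> * snd q" and "M = \<alpha>' + \<beta>' * fst q + \<gamma>' * snd q"
  have M: "M \<noteq> 0"
    unfolding M_def by (rule assms[OF q])
  have lin: "((\<lambda>q. \<alpha> + \<beta> * fst q + \<gamma> * snd q) has_derivative (\<lambda>v. \<beta> * fst v + \<gamma> * snd v)) (at q within S)"
    for \<alpha> \<beta> \<gamma> :: complex
    by (auto intro!: derivative_eq_intros)
  have "((\<lambda>q. (\<alpha> + \<beta> * fst q + \<gamma> * snd q) / (\<alpha>' + \<beta>' * fst q + \<gamma>' * snd q)) has_derivative
     (\<lambda>v. ((\<beta> * fst v + \<gamma> * snd v) * M - N * (\<beta>' * fst v + \<gamma>' * snd v)) / (M * M))) (at q within S)"
    using M unfolding N_def M_def by (rule has_derivative_divide'[OF lin lin])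
  moreover have "(\<lambda>v. ((\<beta> * fst v + \<gamma> * snd v) * M - N * (\<beta>' * fst v + \<gamma>' * snd v)) / (M * M)) =
     (\<lambda>v. (\<beta> * M - N * \<beta>') / (M * M) * fst v + (\<gamma> * M - N * \<gamma>') / (M * M) * snd v)"
    using M by (auto simp: divide_simps algebra_simps)
  ultimately show "((\<lambda>q. (\<alpha> + \<beta> * fst q + \<gamma> * snd q) / (\<alpha>' + \<beta>' * fst q + \<gamma>' * snd q)) has_derivative
     (\<lambda>v. (\<beta> * M - N * \<beta>') / (M * M) * fst v + (\<gamma> * M - N * \<gamma>') / (M * M) * snd v)) (at q within S)"
    by (simp only:)
qed

lemma holo_map_on_sym_mob:
  assumes "cmod b < cmod a"
  shows "holo_map_on (sym_mob a b) sym_bidisc"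
proof -
  have "(cnj a)\<^sup>2 + cnj a * cnj b * fst q + (cnj b)\<^sup>2 * snd q \<noteq> 0" if q: "q \<in> sym_bidisc" for q
  proof -
    obtain z w where "q = sympair z w" "cmod z < 1" "cmod w < 1"
      using q by (rule sym_bidisc_cases)
    then show ?thesis
      using mob_denom_nonzero[OF assms] by (simp only: sym_mob_denom) simp
  qed
  then show ?thesis
    unfolding holo_map_on_def sym_mob_def[abs_def] fst_conv snd_conv
    by (intro conjI holo2_on_affine_quotient)
qed

lemma sym_mob_inverse:
  assumes "cmod b < cmod a" "q \<in> sym_bidisc"
  shows "sym_mob a b q \<in> sym_bidisc" "sym_mob (cnj a) (- b) (sym_mob a b q) = q"
    "sym_mob a b (sym_mob (cnj a) (- b) q) = q"
proof -
  obtain z w where q: "q = sympair z w" "cmod z < 1" "cmod w < 1"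
    using assms(2) by (rule sym_bidisc_cases)
  have neg: "cmod (- b) < cmod (cnj a)"
    using assms(1) by simp
  show "sym_mob a b q \<in> sym_bidisc" "sym_mob (cnj a) (- b) (sym_mob a b q) = q"
    using q mob_less_1[OF assms(1)] mob_inverse[OF assms(1)]
    by (simp_all add: sym_mob_sympair[OF assms(1)] sym_mob_sympair[OF neg])
  show "sym_mob a b (sym_mob (cnj a) (- b) q) = q"
    using q mob_less_1[OF neg] mob_inverse[OF neg]
    by (simp add: sym_mob_sympair[OF assms(1)] sym_mob_sympair[OF neg])
qed

lemma holo2_on_cong:
  assumes "holo2_on f S" "\<And>q. q \<in> S \<Longrightarrow> g q = f q"
  shows "holo2_on g S"
  unfolding holo2_on_def
proof
  fix q assume q: "q \<in> S"
  then obtain a b where f: "(f has_derivative (\<lambda>v. a * fst v + b * snd v)) (at q within S)"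
    using assms(1) unfolding holo2_on_def by blast
  have "(g has_derivative (\<lambda>v. a * fst v + b * snd v)) (at q within S)"
    by (rule has_derivative_transform[OF _ _ f]) (use q assms(2) in auto)
  then show "\<exists>a b. (g has_derivative (\<lambda>v. a * fst v + b * snd v)) (at q within S)"
    by blast
qed

lemma sym_mob_in_Aut:
  assumes "cmod b < cmod a"
  shows "sym_mob a b \<in> Aut_sym_bidisc"
proof -
  have neg: "cmod (- b) < cmod (cnj a)"
    using assms by simp
  have "sym_mob (cnj a) (- b) q \<in> sym_bidisc" if "q \<in> sym_bidisc" for q
    by (rule sym_mob_inverse(1)[OF neg that])
  then have bij: "bij_betw (sym_mob a b) sym_bidisc sym_bidisc"
    using sym_mob_inverse[OF assms]
    by (intro bij_betw_byWitness[of _ "sym_mob (cnj a) (- b)"]) blast+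
  have inv: "inv_into sym_bidisc (sym_mob a b) q = sym_mob (cnj a) (- b) q" if "q \<in> sym_bidisc" for q
    using bij that sym_mob_inverse(3)[OF assms that] sym_mob_inverse(1)[OF neg that]
    by (metis bij_betw_inv_into_left)
  have "holo_map_on (sym_mob (cnj a) (- b)) sym_bidisc"
    by (rule holo_map_on_sym_mob[OF neg])
  then have "holo_map_on (inv_into sym_bidisc (sym_mob a b)) sym_bidisc"
    unfolding holo_map_on_def by (auto intro: holo2_on_cong simp: inv)
  then show ?thesis
    using bij holo_map_on_sym_mob[OF assms] by (simp add: Aut_sym_bidisc_def)
qed

lemma Orb_sympair:
  assumes "cmod z < 1" "cmod w < 1" "z \<noteq> w"
  shows "Orb (sympair z w) = {sympair (mob a b z) (mob a b w) | a b. cmod b < cmod a}"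
proof
  show "Orb (sympair z w) \<subseteq> {sympair (mob a b z) (mob a b w) | a b. cmod b < cmod a}"
  proof
    fix q assume "q \<in> Orb (sympair z w)"
    then obtain f where f: "f \<in> Aut_sym_bidisc" "q = f (sympair z w)"
      by (auto simp: Orb_def)
    show "q \<in> {sympair (mob a b z) (mob a b w) | a b. cmod b < cmod a}"
      by (rule automorphism_of_sym_bidisc[OF f(1)]) (use assms f(2) in blast)
  qed
  show "{sympair (mob a b z) (mob a b w) | a b. cmod b < cmod a} \<subseteq> Orb (sympair z w)"
  proof
    fix q assume "q \<in> {sympair (mob a b z) (mob a b w) | a b. cmod b < cmod a}"
    then obtain a b where ab: "cmod b < cmod a" and q: "q = sympair (mob a b z) (mob a b w)"
      by blast
    show "q \<in> Orb (sympair z w)"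
      unfolding Orb_def q sym_mob_sympair[OF ab assms(1,2), symmetric] using sym_mob_in_Aut[OF ab] by blast
  qed
qed

text \<open>The infinitesimal automorphisms of the disc are \<open>X(\<zeta>) = \<alpha> + 2\<kappa>\<zeta> - \<alpha>\<^sup>*\<zeta>\<^sup>2\<close> with \<open>\<kappa>\<close> imaginary, and
  \<open>(X(z), X(w))\<close> is tangent to the orbit of \<open>(z, w)\<close> in the bidisc. For \<open>\<alpha> = c - c\<^sup>*zw\<close> and
  \<open>2\<kappa> = c\<^sup>*(z + w) - c(z + w)\<^sup>*\<close> this vector is \<open>c\<close> times the vector of the two components defined here;
  the choice is found by requiring the part of \<open>X\<close> that is linear in \<open>c\<^sup>*\<close> to vanish at \<open>z\<close> and \<open>w\<close>.
  The derivative of \<open>sympair\<close> at \<open>(z, w)\<close> maps these components to \<open>sharp_vector z w\<close>.\<close>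

definition sharp_component :: "complex \<Rightarrow> complex \<Rightarrow> complex" where
  "sharp_component z w = (1 - z * cnj z) * (1 - cnj w * z)"

definition sharp_vector :: "complex \<Rightarrow> complex \<Rightarrow> complex \<times> complex" where
  "sharp_vector z w = (sharp_component z w + sharp_component w z,
     sharp_component z w * w + z * sharp_component w z)"

lemma one_minus_cnj_mult_nonzero:
  assumes "cmod z < 1" "cmod w < 1"
  shows "1 - cnj z * w \<noteq> 0"
proof
  assume "1 - cnj z * w = 0"
  then have "cnj z * w = 1" by simp
  then have "cmod z * cmod w = 1"
    by (metis complex_mod_cnj norm_mult norm_one)
  then show False
    using assms mult_strict_mono'[of "cmod z" 1 "cmod w" 1] by simp
qed

lemma sharp_component_nonzero:
  assumes "cmod z < 1" "cmod w < 1"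
  shows "sharp_component z w \<noteq> 0"
  using one_minus_cnj_mult_nonzero[OF assms(1,1)] one_minus_cnj_mult_nonzero[OF assms(2,1)]
  by (simp add: sharp_component_def mult.commute)

lemma sharp_vector_nonzero:
  assumes "cmod z < 1" "cmod w < 1" "z \<noteq> w"
  shows "sharp_vector z w \<noteq> 0"
proof
  assume "sharp_vector z w = 0"
  then have 1: "sharp_component w z = - sharp_component z w"
    and 2: "sharp_component z w * w + z * sharp_component w z = 0"
    by (auto simp: sharp_vector_def prod_eq_iff add_eq_0_iff)
  have "sharp_component z w * (w - z) = 0"
    using 2 unfolding 1 by (simp add: algebra_simps)
  then show False
    using sharp_component_nonzero assms by auto
qed

lemma real_curve_of_holomorphic:
  assumes "open S" "F holomorphic_on S" "G holomorphic_on S" "\<And>t. t \<in> I \<Longrightarrow> complex_of_real t \<in> S"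
  shows "(\<lambda>t. (F (of_real t), G (of_real t))) C1_differentiable_on I"
    "t \<in> I \<Longrightarrow> ((\<lambda>t. (F (of_real t), G (of_real t))) has_vector_derivative
        (deriv F (of_real t), deriv G (of_real t))) (at t)"
proof -
  have 1: "((\<lambda>t. f (of_real t)) has_vector_derivative deriv f (of_real t)) (at t)"
    if "t \<in> I" "f holomorphic_on S" for t f
    using holomorphic_derivI[OF that(2) assms(1) assms(4)[OF that(1)], of UNIV]
    by (intro has_vector_derivative_real_field) simp
  show 2: "((\<lambda>t. (F (of_real t), G (of_real t))) has_vector_derivative
        (deriv F (of_real t), deriv G (of_real t))) (at t)" if "t \<in> I" for t
    by (intro has_vector_derivative_Pair 1 that assms)
  have 3: "continuous_on I (\<lambda>t. deriv f (complex_of_real t))" if "f holomorphic_on S" for f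
  proof -
    have "continuous_on S (deriv f)"
      by (intro holomorphic_on_imp_continuous_on holomorphic_deriv that assms)
    then show ?thesis
      by (rule continuous_on_compose2) (use assms(4) in \<open>auto intro!: continuous_intros\<close>)
  qed
  show "(\<lambda>t. (F (of_real t), G (of_real t))) C1_differentiable_on I"
    unfolding C1_differentiable_on_def
    by (intro exI[of _ "\<lambda>t. (deriv F (of_real t), deriv G (of_real t))"] conjI ballI 2
        continuous_on_Pair 3 assms)
qed

lemma sharp_vector_tangent:
  assumes z: "cmod z < 1" "cmod w < 1" "z \<noteq> w"
  shows "cscale c (sharp_vector z w) \<in> real_tangent_space (Orb (sympair z w)) (sympair z w)"
proof -
  define \<kappa> \<alpha> where "\<kappa> = (cnj c * (z + w) - c * cnj (z + w)) / 2" and "\<alpha> = c - cnj c * (z * w)"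
  have kap2: "2 * \<kappa> = cnj c * (z + w) - c * cnj (z + w)"
    by (simp add: \<kappa>_def)
  have "cnj (2 * \<kappa>) = - (2 * \<kappa>)"
    unfolding kap2 by simp
  then have kap: "cnj \<kappa> = - \<kappa>"
    by simp
  then have "Re (cnj \<kappa>) = Re (- \<kappa>)"
    by simp
  then have Re_kap: "Re \<kappa> = 0"
    by simp
  define M where "M x \<tau> = ((1 + \<tau> * \<kappa>) * x + \<tau> * \<alpha>) / (\<tau> * cnj \<alpha> * x + (1 - \<tau> * \<kappa>))" for x \<tau>
  have M_mob: "mob (1 + of_real t * \<kappa>) (of_real t * \<alpha>) x = M x (of_real t)" for t x
    by (simp add: mob_def M_def kap)
  define S where "S = {\<tau>. \<tau> * cnj \<alpha> * z + (1 - \<tau> * \<kappa>) \<noteq> 0 \<and> \<tau> * cnj \<alpha> * w + (1 - \<tau> * \<kappa>) \<noteq> 0}"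
  have S: "open S"
    unfolding S_def by (intro open_Collect_conj open_Collect_neq continuous_intros)
  have hol: "M z holomorphic_on S" "M w holomorphic_on S"
    unfolding M_def[abs_def] by (auto intro!: holomorphic_intros simp: S_def)
  \<comment> \<open>\<open>\<bar>1 + t\<kappa>\<bar> \<ge> 1\<close> because \<open>\<kappa>\<close> is imaginary, so the curve stays in the automorphism group\<close>
  define \<epsilon> where "\<epsilon> = 1 / (1 + cmod \<alpha>)"
  have eps: "\<epsilon> > 0"
    by (simp add: \<epsilon>_def add_pos_nonneg)
  have lt: "cmod (of_real t * \<alpha>) < cmod (1 + of_real t * \<kappa>)" if "t \<in> {-\<epsilon><..<\<epsilon>}" for t
  proof -
    have "\<bar>t\<bar> < 1 / (1 + cmod \<alpha>)"
      using that by (auto simp: \<epsilon>_def)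
    then have "\<bar>t\<bar> * (1 + cmod \<alpha>) < 1"
      by (simp add: pos_less_divide_eq add_pos_nonneg)
    moreover have "\<bar>t\<bar> * cmod \<alpha> \<le> \<bar>t\<bar> * (1 + cmod \<alpha>)"
      by (intro mult_left_mono) auto
    ultimately have "\<bar>t\<bar> * cmod \<alpha> < 1"
      by linarith
    moreover have "1 = \<bar>Re (1 + of_real t * \<kappa>)\<bar>"
      using Re_kap by simp
    moreover have "\<dots> \<le> cmod (1 + of_real t * \<kappa>)"
      by (rule abs_Re_le_cmod)
    ultimately show ?thesis
      by (simp add: norm_mult)
  qed
  have inS: "complex_of_real t \<in> S" if "t \<in> {-\<epsilon><..<\<epsilon>}" for t
    using mob_denom_nonzero[OF lt[OF that]] z kap by (simp add: S_def)
  define \<gamma> where "\<gamma> t = (M z (of_real t) + M w (of_real t), M z (of_real t) * M w (of_real t))" for t :: real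
  have hol2: "(\<lambda>\<tau>. M z \<tau> + M w \<tau>) holomorphic_on S" "(\<lambda>\<tau>. M z \<tau> * M w \<tau>) holomorphic_on S"
    by (intro holomorphic_intros hol)+
  have C1: "\<gamma> C1_differentiable_on {-\<epsilon><..<\<epsilon>}"
    unfolding \<gamma>_def[abs_def] by (rule real_curve_of_holomorphic(1)[OF S hol2 inS])
  have der: "(M x has_field_derivative \<alpha> + 2 * \<kappa> * x - cnj \<alpha> * x\<^sup>2) (at 0)" for x
    unfolding M_def by (auto intro!: derivative_eq_intros simp: algebra_simps power2_eq_square)
  have X: "\<alpha> + 2 * \<kappa> * z - cnj \<alpha> * z\<^sup>2 = c * sharp_component z w"
    "\<alpha> + 2 * \<kappa> * w - cnj \<alpha> * w\<^sup>2 = c * sharp_component w z"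
    unfolding \<alpha>_def kap2 sharp_component_def by (simp_all add: algebra_simps power2_eq_square)
  have M0: "M x 0 = x" for x
    by (simp add: M_def)
  have "((\<lambda>\<tau>. M z \<tau> + M w \<tau>) has_field_derivative c * sharp_component z w + c * sharp_component w z) (at 0)"
    unfolding X[symmetric] by (intro DERIV_add der)
  moreover have "((\<lambda>\<tau>. M z \<tau> * M w \<tau>) has_field_derivative
      (c * sharp_component z w) * w + z * (c * sharp_component w z)) (at 0)"
    using DERIV_mult[OF der der, of z w] unfolding X M0 by (simp add: algebra_simps)
  ultimately have d: "deriv (\<lambda>\<tau>. M z \<tau> + M w \<tau>) 0 = c * sharp_component z w + c * sharp_component w z"
    "deriv (\<lambda>\<tau>. M z \<tau> * M w \<tau>) 0 = (c * sharp_component z w) * w + z * (c * sharp_component w z)"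
    by (simp_all add: DERIV_imp_deriv)
  have "(\<gamma> has_vector_derivative cscale c (sharp_vector z w)) (at 0)"
    using real_curve_of_holomorphic(2)[OF S hol2 inS, of 0] eps d
    by (simp add: \<gamma>_def[abs_def] cscale_def sharp_vector_def algebra_simps)
  moreover have "\<gamma> 0 = sympair z w"
    by (simp add: \<gamma>_def M0 sympair_def)
  moreover have "\<gamma> ` {-\<epsilon><..<\<epsilon>} \<subseteq> Orb (sympair z w)"
  proof
    fix q assume "q \<in> \<gamma> ` {-\<epsilon><..<\<epsilon>}"
    then obtain t where t: "t \<in> {-\<epsilon><..<\<epsilon>}" "q = \<gamma> t" by blast
    have "q = sympair (mob (1 + of_real t * \<kappa>) (of_real t * \<alpha>) z) (mob (1 + of_real t * \<kappa>) (of_real t * \<alpha>) w)"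
      unfolding M_mob t(2) by (simp add: \<gamma>_def sympair_def)
    then show "q \<in> Orb (sympair z w)"
      unfolding Orb_sympair[OF z] using lt[OF t(1)] by blast
  qed
  ultimately show ?thesis
    unfolding real_tangent_space_def using eps C1 by blast
qed

text \<open>The pseudo-hyperbolic distance of \<open>z\<close> and \<open>w\<close> is constant on the orbit. In the coordinates
  \<open>s\<close>, \<open>p\<close> this is the equation \<open>2 + 2\<bar>p\<bar>\<^sup>2 - \<bar>s\<bar>\<^sup>2 = k \<bar>s\<^sup>2 - 4p\<bar>\<close> with a constant \<open>k > 1\<close>.\<close>

lemma Orb_level_set:
  assumes z: "cmod z < 1" "cmod w < 1" "z \<noteq> w"
  obtains k :: real where "k > 1"
    "\<And>q. q \<in> Orb (sympair z w) \<Longrightarrow>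
       (2 + 2 * (snd q * cnj (snd q)) - fst q * cnj (fst q))\<^sup>2
         = of_real (k\<^sup>2) * (((fst q)\<^sup>2 - 4 * snd q) * cnj ((fst q)\<^sup>2 - 4 * snd q))"
proof
  define k where "k = 2 * (cmod (1 - cnj z * w))\<^sup>2 / (cmod (z - w))\<^sup>2 - 1"
  have pos: "(cmod (z - w))\<^sup>2 > 0"
    using z by simp
  have "(cmod (1 - cnj z * w))\<^sup>2 - (cmod (z - w))\<^sup>2 = (1 - (cmod z)\<^sup>2) * (1 - (cmod w)\<^sup>2)"
  proof -
    have "complex_of_real ((cmod (1 - cnj z * w))\<^sup>2 - (cmod (z - w))\<^sup>2) =
        complex_of_real ((1 - (cmod z)\<^sup>2) * (1 - (cmod w)\<^sup>2))"
      by (simp add: of_real_cmod_square algebra_simps)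
    then show ?thesis
      using of_real_eq_iff by blast
  qed
  moreover have "(1 - (cmod z)\<^sup>2) * (1 - (cmod w)\<^sup>2) > 0"
    using z by (intro mult_pos_pos) (auto simp: power_less_one_iff)
  ultimately show "k > 1"
    using pos by (simp add: k_def field_simps)
  fix q assume "q \<in> Orb (sympair z w)"
  then obtain a b where ab: "cmod b < cmod a" and q: "q = sympair (mob a b z) (mob a b w)"
    unfolding Orb_sympair[OF z] by blast
  define x y where "x = mob a b z" and "y = mob a b w"
  define D where "D = complex_of_real ((cmod a)\<^sup>2 - (cmod b)\<^sup>2) / ((cnj b * z + cnj a) * (cnj b * w + cnj a))"
  have le: "cmod z \<le> 1" "cmod w \<le> 1"
    using z by auto
  have "x - y = D * (z - w)"
    unfolding x_def y_def mob_diff[OF ab le] D_def mob_det_pos(1)[OF ab] by simp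
  then have 1: "cmod (x - y) = cmod D * cmod (z - w)"
    by (simp add: norm_mult)
  have "cmod (cnj b * z + cnj a) = cmod (cnj (cnj b * z + cnj a))"
    by (rule complex_mod_cnj[symmetric])
  then have 2: "cmod (1 - cnj x * y) = cmod D * cmod (1 - cnj z * w)"
    unfolding x_def y_def mob_kernel[OF ab le] D_def mob_det_pos(1)[OF ab]
    by (simp only: norm_mult norm_divide) simp
  have "(cmod (1 - cnj x * y))\<^sup>2 * (cmod (z - w))\<^sup>2 = (cmod (1 - cnj z * w))\<^sup>2 * (cmod (x - y))\<^sup>2"
    unfolding 1 2 by (simp add: power_mult_distrib)
  then have k: "2 * (cmod (1 - cnj x * y))\<^sup>2 - (cmod (x - y))\<^sup>2 = k * (cmod (x - y))\<^sup>2"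
    using pos by (simp add: k_def field_simps)
  have "2 + 2 * (snd q * cnj (snd q)) - fst q * cnj (fst q)
      = of_real (2 * (cmod (1 - cnj x * y))\<^sup>2 - (cmod (x - y))\<^sup>2)"
    by (simp add: of_real_cmod_square q sympair_def x_def[symmetric] y_def[symmetric]) (simp add: algebra_simps)
  also have "\<dots> = of_real k * ((x - y) * cnj (x - y))"
    unfolding k by (simp add: of_real_cmod_square)
  finally have T: "2 + 2 * (snd q * cnj (snd q)) - fst q * cnj (fst q) = of_real k * ((x - y) * cnj (x - y))" .
  have d: "(fst q)\<^sup>2 - 4 * snd q = (x - y)\<^sup>2"
    by (simp add: q sympair_def x_def[symmetric] y_def[symmetric] power2_eq_square algebra_simps)
  show "(2 + 2 * (snd q * cnj (snd q)) - fst q * cnj (fst q))\<^sup>2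
       = of_real (k\<^sup>2) * (((fst q)\<^sup>2 - 4 * snd q) * cnj ((fst q)\<^sup>2 - 4 * snd q))"
    unfolding T d by (simp add: power2_eq_square)
qed

text \<open>The form comes from differentiating the squared level equation, which is polynomial in \<open>s\<close>, \<open>p\<close>
  and their conjugates. Its second coefficient is nonzero because \<open>k > 1 > \<bar>p\<bar>\<close>.\<close>

lemma Orb_tangent_hyperplane:
  assumes z: "cmod z < 1" "cmod w < 1" "z \<noteq> w"
  obtains A B where "B \<noteq> 0"
    "\<And>v. v \<in> real_tangent_space (Orb (sympair z w)) (sympair z w) \<Longrightarrow> Re (A * fst v + B * snd v) = 0"
proof -
  obtain k :: real where k: "k > 1"
    "\<And>q. q \<in> Orb (sympair z w) \<Longrightarrow>
       (2 + 2 * (snd q * cnj (snd q)) - fst q * cnj (fst q))\<^sup>2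
         = of_real (k\<^sup>2) * (((fst q)\<^sup>2 - 4 * snd q) * cnj ((fst q)\<^sup>2 - 4 * snd q))"
    using Orb_level_set[OF z] by blast
  define s\<^sub>0 p\<^sub>0 where "s\<^sub>0 = z + w" and "p\<^sub>0 = z * w"
  define T\<^sub>0 d\<^sub>0 where "T\<^sub>0 = 2 + 2 * (p\<^sub>0 * cnj p\<^sub>0) - s\<^sub>0 * cnj s\<^sub>0" and "d\<^sub>0 = s\<^sub>0 * s\<^sub>0 - 4 * p\<^sub>0"
  have d0: "d\<^sub>0 = (z - w)\<^sup>2"
    by (simp add: d\<^sub>0_def s\<^sub>0_def p\<^sub>0_def power2_eq_square algebra_simps)
  have T_real: "cnj T\<^sub>0 = T\<^sub>0"
    by (simp add: T\<^sub>0_def mult.commute)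
  have "sympair z w \<in> Orb (sympair z w)"
    unfolding Orb_sympair[OF z] by (intro CollectI exI[of _ 1] exI[of _ 0]) (simp add: mob_def)
  from k(2)[OF this] have T_sq: "T\<^sub>0 * T\<^sub>0 = of_real (k\<^sup>2) * (d\<^sub>0 * cnj d\<^sub>0)"
    by (simp add: T\<^sub>0_def d\<^sub>0_def s\<^sub>0_def p\<^sub>0_def sympair_def power2_eq_square)
  have "cmod T\<^sub>0 * cmod T\<^sub>0 = (k * cmod d\<^sub>0) * (k * cmod d\<^sub>0)"
  proof -
    have "cmod (T\<^sub>0 * T\<^sub>0) = cmod (of_real (k\<^sup>2) * (d\<^sub>0 * cnj d\<^sub>0))"
      using T_sq by simp
    then show ?thesis
      by (simp only: norm_mult norm_of_real complex_mod_cnj) (simp add: power2_eq_square)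
  qed
  then have T_norm: "cmod T\<^sub>0 = k * cmod d\<^sub>0"
    using k(1) by (metis abs_norm_cancel abs_of_nonneg less_le mult_nonneg_nonneg norm_ge_zero
        order_less_trans real_sqrt_abs2 zero_less_one)
  define A B where "A = - 2 * T\<^sub>0 * cnj s\<^sub>0 - 2 * of_real (k\<^sup>2) * s\<^sub>0 * cnj d\<^sub>0"
    and "B = 4 * T\<^sub>0 * cnj p\<^sub>0 + 4 * of_real (k\<^sup>2) * cnj d\<^sub>0"
  show ?thesis
  proof (rule that)
    show "B \<noteq> 0"
    proof
      assume "B = 0"
      moreover have "B = 4 * (of_real (k\<^sup>2) * cnj d\<^sub>0 + T\<^sub>0 * cnj p\<^sub>0)"
        by (simp add: B_def algebra_simps)
      ultimately have "of_real (k\<^sup>2) * cnj d\<^sub>0 = - (T\<^sub>0 * cnj p\<^sub>0)"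
        by (metis \<open>B = 0\<close> add_eq_0_iff2 mult_eq_0_iff zero_neq_numeral)
      then have "cmod (of_real (k\<^sup>2) * cnj d\<^sub>0) = cmod (T\<^sub>0 * cnj p\<^sub>0)"
        by simp
      then have "k\<^sup>2 * cmod d\<^sub>0 = cmod T\<^sub>0 * cmod p\<^sub>0"
        by (simp only: norm_mult norm_of_real complex_mod_cnj) simp
      then have "k = cmod p\<^sub>0"
        unfolding T_norm power2_eq_square using k(1) z by (simp add: d0)
      moreover have "cmod p\<^sub>0 \<le> 1"
        unfolding p\<^sub>0_def norm_mult using z by (intro mult_le_one) auto
      ultimately show False using k(1) by simp
    qed
    fix v assume "v \<in> real_tangent_space (Orb (sympair z w)) (sympair z w)"
    then obtain \<gamma> \<epsilon> where \<epsilon>: "\<epsilon> > 0" and orb: "\<gamma> ` {-\<epsilon><..<\<epsilon>} \<subseteq> Orb (sympair z w)"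
      and \<gamma>0: "\<gamma> 0 = sympair z w" and \<gamma>: "(\<gamma> has_vector_derivative v) (at (0::real))"
      unfolding real_tangent_space_def by blast
    define s p where "s t = fst (\<gamma> t)" and "p t = snd (\<gamma> t)" for t
    have s0: "s 0 = s\<^sub>0" "p 0 = p\<^sub>0"
      by (simp_all add: s_def p_def s\<^sub>0_def p\<^sub>0_def \<gamma>0 sympair_def)
    have s: "(s has_vector_derivative fst v) (at 0)" and p: "(p has_vector_derivative snd v) (at 0)"
      unfolding s_def[abs_def] p_def[abs_def]
      by (rule bounded_linear.has_vector_derivative[OF bounded_linear_fst \<gamma>]
          bounded_linear.has_vector_derivative[OF bounded_linear_snd \<gamma>])+
    note cn = bounded_linear.has_vector_derivative[OF bounded_linear_cnj]
    define T d where "T t = 2 + 2 * (p t * cnj (p t)) - s t * cnj (s t)" and "d t = s t * s t - 4 * p t" for t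
    have T: "(T has_vector_derivative 0 + 2 * (p 0 * cnj (snd v) + snd v * cnj (p 0))
        - (s 0 * cnj (fst v) + fst v * cnj (s 0))) (at 0)"
      unfolding T_def[abs_def]
      by (intro has_vector_derivative_diff has_vector_derivative_add has_vector_derivative_const
          has_vector_derivative_mult_right has_vector_derivative_mult s p cn)
    have d: "(d has_vector_derivative (s 0 * fst v + fst v * s 0) - 4 * snd v) (at 0)"
      unfolding d_def[abs_def]
      by (intro has_vector_derivative_diff has_vector_derivative_mult_right has_vector_derivative_mult s p)
    define E where "E t = T t * T t - of_real (k\<^sup>2) * (d t * cnj (d t))" for t
    define T' d' where "T' = 2 * (p\<^sub>0 * cnj (snd v) + snd v * cnj p\<^sub>0) - (s\<^sub>0 * cnj (fst v) + fst v * cnj s\<^sub>0)"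
      and "d' = 2 * s\<^sub>0 * fst v - 4 * snd v"
    have T: "(T has_vector_derivative T') (at 0)" and d: "(d has_vector_derivative d') (at 0)"
      using T d by (simp_all add: s0 T'_def d'_def mult.commute mult.left_commute)
    have Td0: "T 0 = T\<^sub>0" "d 0 = d\<^sub>0"
      by (simp_all add: T_def d_def s0 T\<^sub>0_def d\<^sub>0_def)
    have "(E has_vector_derivative (T 0 * T' + T' * T 0) - of_real (k\<^sup>2) * (d 0 * cnj d' + d' * cnj (d 0))) (at 0)"
      unfolding E_def[abs_def]
      by (intro has_vector_derivative_diff has_vector_derivative_mult_right has_vector_derivative_mult T d cn)
    moreover have "E t = 0" if "t \<in> {-\<epsilon><..<\<epsilon>}" for t
    proof -
      have "\<gamma> t \<in> Orb (sympair z w)"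
        using orb that by blast
      from k(2)[OF this] show ?thesis
        by (simp add: E_def T_def d_def s_def p_def power2_eq_square)
    qed
    then have "(E has_vector_derivative 0) (at 0)"
      using \<epsilon> by (intro has_vector_derivative_transform_within_open[OF has_vector_derivative_const, of "{-\<epsilon><..<\<epsilon>}"]) auto
    ultimately have "(T\<^sub>0 * T' + T' * T\<^sub>0) - of_real (k\<^sup>2) * (d\<^sub>0 * cnj d' + d' * cnj d\<^sub>0) = 0"
      unfolding Td0 by (rule vector_derivative_unique_at)
    moreover have "(T\<^sub>0 * T' + T' * T\<^sub>0) - of_real (k\<^sup>2) * (d\<^sub>0 * cnj d' + d' * cnj d\<^sub>0)
        = (A * fst v + B * snd v) + cnj (A * fst v + B * snd v)"
      unfolding T'_def d'_def A_def B_def by (simp add: T_real) (simp add: algebra_simps)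
    ultimately have "(A * fst v + B * snd v) + cnj (A * fst v + B * snd v) = 0"
      by simp
    then show "Re (A * fst v + B * snd v) = 0"
      by (simp only: complex_add_cnj of_real_eq_0_iff)
  qed
qed

lemma complex_line_eq_iff:
  assumes "v \<noteq> 0" "w \<noteq> 0"
  shows "range (\<lambda>c. cscale c v) = range (\<lambda>c. cscale c w) \<longleftrightarrow> fst v * snd w = snd v * fst w"
proof
  assume eq: "range (\<lambda>c. cscale c v) = range (\<lambda>c. cscale c w)"
  have "v = cscale 1 v"
    by (simp add: cscale_def)
  then have "v \<in> range (\<lambda>c. cscale c w)"
    unfolding eq[symmetric] by (rule range_eqI)
  then show "fst v * snd w = snd v * fst w"
    by (auto simp: cscale_def)
next
  assume cross: "fst v * snd w = snd v * fst w"
  obtain r where r: "v = cscale r w"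
  proof (cases "fst w = 0")
    case True
    then have "snd w \<noteq> 0" "fst v = 0"
      using assms(2) cross by (auto simp: prod_eq_iff)
    then show ?thesis
      using that[of "snd v / snd w"] True by (simp add: cscale_def prod_eq_iff)
  next
    case False
    then show ?thesis
      using that[of "fst v / fst w"] cross by (simp add: cscale_def prod_eq_iff field_simps)
  qed
  have "r \<noteq> 0"
    using r assms(1) by (auto simp: cscale_def zero_prod_def)
  have "cscale c v = cscale (c * r) w" "cscale c w = cscale (c / r) v" for c
    unfolding r using \<open>r \<noteq> 0\<close> by (simp_all add: cscale_def)
  then show "range (\<lambda>c. cscale c v) = range (\<lambda>c. cscale c w)"
    by (metis (mono_tags, lifting) image_subset_iff rangeI subset_antisym)
qed

lemma sharp_direction_sympair:
  assumes z: "cmod z < 1" "cmod w < 1" "z \<noteq> w"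
  shows "sharp_direction (sympair z w) = range (\<lambda>c. cscale c (sharp_vector z w))"
  unfolding sharp_direction_def
proof (rule the_equality)
  let ?T = "real_tangent_space (Orb (sympair z w)) (sympair z w)"
  have sub: "range (\<lambda>c. cscale c (sharp_vector z w)) \<subseteq> ?T"
    using sharp_vector_tangent[OF z] by blast
  then show "complex_line (range (\<lambda>c. cscale c (sharp_vector z w))) \<and>
      range (\<lambda>c. cscale c (sharp_vector z w)) \<subseteq> ?T"
    using sharp_vector_nonzero[OF z] unfolding complex_line_def by blast
  fix L assume L: "complex_line L \<and> L \<subseteq> ?T"
  then obtain v where v: "v \<noteq> 0" "L = range (\<lambda>c. cscale c v)"
    unfolding complex_line_def by blast
  have v_sub: "range (\<lambda>c. cscale c v) \<subseteq> ?T"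
    using L v(2) by blast
  obtain A B where B: "B \<noteq> 0" and AB: "\<And>v. v \<in> ?T \<Longrightarrow> Re (A * fst v + B * snd v) = 0"
    using Orb_tangent_hyperplane[OF z] by metis
  \<comment> \<open>a complex line in a real hyperplane lies in the kernel of the complex linear form\<close>
  have ker: "A * fst u + B * snd u = 0" if "range (\<lambda>c. cscale c u) \<subseteq> ?T" for u
  proof -
    define y where "y = A * fst u + B * snd u"
    have "Re (A * fst (cscale (cnj y) u) + B * snd (cscale (cnj y) u)) = 0"
      using that by (intro AB) blast
    moreover have "A * fst (cscale (cnj y) u) + B * snd (cscale (cnj y) u) = y * cnj y"
      by (simp add: cscale_def y_def algebra_simps)
    ultimately have "(cmod y)\<^sup>2 = 0"
      using complex_norm_square[of y] by (metis Re_complex_of_real)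
    then show ?thesis
      by (simp add: y_def)
  qed
  let ?V = "sharp_vector z w"
  have "B * (fst v * snd ?V - snd v * fst ?V) =
      fst v * (A * fst ?V + B * snd ?V) - fst ?V * (A * fst v + B * snd v)"
    by (simp add: algebra_simps)
  also have "\<dots> = 0"
    unfolding ker[OF v_sub] ker[OF sub] by simp
  finally have "fst v * snd ?V = snd v * fst ?V"
    using B by simp
  then show "L = range (\<lambda>c. cscale c ?V)"
    unfolding v(2) by (subst complex_line_eq_iff[OF v(1) sharp_vector_nonzero[OF z]])
qed

section \<open>Real hyperbolic geodesics of the disc\<close>

text \<open>Lines through \<open>0\<close> (\<open>\<beta> = 0\<close>) and circles orthogonal to the unit circle (\<open>\<beta> = 1\<close>, \<open>\<gamma>\<close> the
  centre) in one equation.\<close>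

definition hyp_arc :: "real \<Rightarrow> complex \<Rightarrow> complex set" where
  "hyp_arc \<beta> \<gamma> = {z. cmod z < 1 \<and> \<beta> * (1 + (cmod z)\<^sup>2) = 2 * Re (cnj \<gamma> * z)}"

lemma Re_cnj_mult: "Re (cnj a * z) = a \<bullet> z"
  by (simp add: inner_complex_def)

lemma norm_diff_square: "(cmod (z - a))\<^sup>2 = (cmod z)\<^sup>2 - 2 * Re (cnj a * z) + (cmod a)\<^sup>2"
  unfolding cmod_power2 by (simp add: power2_eq_square algebra_simps)

lemma hyp_arc_scale:
  assumes "r \<noteq> 0"
  shows "hyp_arc (r * \<beta>) (of_real r * \<gamma>) = hyp_arc \<beta> \<gamma>"
proof -
  have "r * \<beta> * (1 + (cmod z)\<^sup>2) = 2 * Re (cnj (of_real r * \<gamma>) * z)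
      \<longleftrightarrow> r * (\<beta> * (1 + (cmod z)\<^sup>2)) = r * (2 * Re (cnj \<gamma> * z))" for z
    by (simp add: algebra_simps)
  then show ?thesis
    using assms by (simp add: hyp_arc_def)
qed

lemma real_hyperbolic_geodesic_imp_hyp_arc:
  assumes "real_hyperbolic_geodesic C"
  obtains \<beta> \<gamma> where "\<bar>\<beta>\<bar> < cmod \<gamma>" "C = hyp_arc \<beta> \<gamma>"
proof -
  obtain K where K: "line_orthogonal_to_unit K \<or> circle_orthogonal_to_unit K" and C: "C = K \<inter> ball 0 1"
    using assms by (auto simp: real_hyperbolic_geodesic_def)
  from K show ?thesis
  proof
    assume "line_orthogonal_to_unit K"
    then obtain u where u: "u \<noteq> 0" "K = span {u}"
      by (auto simp: line_orthogonal_to_unit_def)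
    have "z \<in> K \<longleftrightarrow> Re (cnj (\<i> * u) * z) = 0" for z
    proof
      assume "z \<in> K"
      then obtain r where "z = r *\<^sub>R u"
        unfolding u(2) span_singleton by blast
      then show "Re (cnj (\<i> * u) * z) = 0"
        by (simp add: algebra_simps)
    next
      assume "Re (cnj (\<i> * u) * z) = 0"
      then have "cnj u * z = of_real (Re (cnj u * z))"
        by (simp add: complex_eq_iff algebra_simps)
      moreover have "(u * cnj u) * z = (cnj u * z) * u"
        by (simp add: algebra_simps)
      ultimately have "(u * cnj u) * z = of_real (Re (cnj u * z)) * u"
        by metis
      then have "z = of_real (Re (cnj u * z) / (cmod u)\<^sup>2) * u"
        using u(1) of_real_cmod_square[of u] by (simp add: field_simps)
      then have "z = (Re (cnj u * z) / (cmod u)\<^sup>2) *\<^sub>R u"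
        by (simp only: scaleR_conv_of_real)
      then show "z \<in> K"
        unfolding u(2) span_singleton by (rule range_eqI)
    qed
    then have "C = hyp_arc 0 (\<i> * u)"
      unfolding C hyp_arc_def by auto
    then show ?thesis
      using that[of 0 "\<i> * u"] u(1) by (simp add: norm_mult)
  next
    assume "circle_orthogonal_to_unit K"
    then obtain a r where r: "r > 0" and K: "K = sphere a r" and "K \<inter> sphere 0 1 \<noteq> {}"
      and orth_all: "\<And>z. z \<in> K \<inter> sphere 0 1 \<Longrightarrow> orthogonal (z - a) z"
      unfolding circle_orthogonal_to_unit_def by blast
    then obtain z\<^sub>0 where z\<^sub>0: "z\<^sub>0 \<in> K \<inter> sphere 0 1"
      by blast
    then have z0: "cmod z\<^sub>0 = 1" "cmod (z\<^sub>0 - a) = r"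
      by (auto simp: K dist_norm norm_minus_commute)
    have orth: "orthogonal (z\<^sub>0 - a) z\<^sub>0"
      by (rule orth_all[OF z\<^sub>0])
    have "Re (cnj a * z\<^sub>0) = 1"
    proof -
      have "z\<^sub>0 \<bullet> z\<^sub>0 = 1"
        using z0(1) by (simp add: dot_square_norm)
      then show ?thesis
        using orth unfolding Re_cnj_mult by (simp add: orthogonal_def inner_diff_left)
    qed
    then have a: "(cmod a)\<^sup>2 = 1 + r\<^sup>2"
      using norm_diff_square[of z\<^sub>0 a] z0 by simp
    have "z \<in> K \<longleftrightarrow> 1 * (1 + (cmod z)\<^sup>2) = 2 * Re (cnj a * z)" for z
    proof -
      have "z \<in> K \<longleftrightarrow> (cmod (z - a))\<^sup>2 = r\<^sup>2"
        using r by (auto simp: K dist_norm norm_minus_commute power2_eq_iff_nonneg)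
      then show ?thesis
        unfolding norm_diff_square a by auto
    qed
    then have "C = hyp_arc 1 a"
      unfolding C hyp_arc_def by auto
    moreover have "1\<^sup>2 < (cmod a)\<^sup>2"
      using a r by simp
    then have "1 < cmod a"
      by (rule power2_less_imp_less) simp
    ultimately show ?thesis
      using that[of 1 a] by simp
  qed
qed

lemma hyp_arc_imp_real_hyperbolic_geodesic:
  assumes "\<bar>\<beta>\<bar> < cmod \<gamma>"
  shows "real_hyperbolic_geodesic (hyp_arc \<beta> \<gamma>)"
proof (cases "\<beta> = 0")
  case True
  define u where "u = \<i> * \<gamma>"
  have g: "\<gamma> \<noteq> 0"
    using assms by auto
  have u: "u \<noteq> 0"
    using g by (simp add: u_def)
  have line: "z \<in> span {u} \<longleftrightarrow> Re (cnj \<gamma> * z) = 0" for z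
  proof
    assume "z \<in> span {u}"
    then obtain r where "z = r *\<^sub>R u"
      unfolding span_singleton by blast
    then show "Re (cnj \<gamma> * z) = 0"
      by (simp add: u_def algebra_simps)
  next
    assume "Re (cnj \<gamma> * z) = 0"
    then have "cnj \<gamma> * z = \<i> * of_real (Im (cnj \<gamma> * z))"
      by (simp add: complex_eq_iff)
    moreover have "(\<gamma> * cnj \<gamma>) * z = (cnj \<gamma> * z) * \<gamma>"
      by (simp add: algebra_simps)
    ultimately have "(\<gamma> * cnj \<gamma>) * z = \<i> * of_real (Im (cnj \<gamma> * z)) * \<gamma>"
      by metis
    then have "z = of_real (Im (cnj \<gamma> * z) / (cmod \<gamma>)\<^sup>2) * u"
      using g of_real_cmod_square[of \<gamma>] by (simp add: u_def field_simps)
    then have "z = (Im (cnj \<gamma> * z) / (cmod \<gamma>)\<^sup>2) *\<^sub>R u"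
      by (simp only: scaleR_conv_of_real)
    then show "z \<in> span {u}"
      unfolding span_singleton by (rule range_eqI)
  qed
  have "hyp_arc \<beta> \<gamma> = {z. cmod z < 1 \<and> Re (cnj \<gamma> * z) = 0}"
    by (auto simp: hyp_arc_def True)
  also have "\<dots> = span {u} \<inter> ball 0 1"
    unfolding line[symmetric] by auto
  finally have "hyp_arc \<beta> \<gamma> = span {u} \<inter> ball 0 1" .
  then show ?thesis
    unfolding real_hyperbolic_geodesic_def line_orthogonal_to_unit_def using u by blast
next
  case False
  define a where "a = of_real (1 / \<beta>) * \<gamma>"
  have arc: "hyp_arc \<beta> \<gamma> = hyp_arc 1 a"
    using hyp_arc_scale[of "1 / \<beta>" \<beta> \<gamma>] False by (simp add: a_def)
  have a1: "cmod a > 1"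
    using assms False by (simp add: a_def norm_mult norm_divide field_simps)
  then have a2: "(cmod a)\<^sup>2 > 1"
    by (simp add: one_less_power)
  define r where "r = sqrt ((cmod a)\<^sup>2 - 1)"
  have r: "r > 0" "r\<^sup>2 = (cmod a)\<^sup>2 - 1"
    using a2 by (auto simp: r_def)
  have K: "z \<in> sphere a r \<longleftrightarrow> 1 * (1 + (cmod z)\<^sup>2) = 2 * Re (cnj a * z)" for z
  proof -
    have "z \<in> sphere a r \<longleftrightarrow> (cmod (z - a))\<^sup>2 = r\<^sup>2"
      using r(1) by (auto simp: dist_norm norm_minus_commute power2_eq_iff_nonneg)
    then show ?thesis
      unfolding norm_diff_square r(2) by auto
  qed
  \<comment> \<open>a unimodular point whose projection to the line through \<open>a\<close> has length \<open>1 / \<bar>a\<bar>\<close>\<close>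
  define k where "k = 1 / cmod a"
  define z\<^sub>0 where "z\<^sub>0 = sgn a * Complex k (sqrt (1 - k\<^sup>2))"
  have a0: "a \<noteq> 0" "of_real (cmod a) \<noteq> (0 :: complex)"
    using a1 by auto
  have "0 < k" "k \<le> 1"
    using a1 a0 unfolding k_def by (simp, simp add: divide_le_eq)
  then have k: "0 < k" "k\<^sup>2 \<le> 1"
    by (auto simp: power_le_one)
  have "cmod (Complex k (sqrt (1 - k\<^sup>2))) = 1"
    using k by (simp add: cmod_def)
  then have z01: "cmod z\<^sub>0 = 1"
    using a0 by (simp add: z\<^sub>0_def norm_mult norm_sgn)
  have "cnj a * sgn a = of_real (cmod a)"
    using a0 of_real_cmod_square[of a] by (simp add: sgn_eq power2_eq_square divide_eq_eq mult.commute)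
  then have "cnj a * z\<^sub>0 = of_real (cmod a) * Complex k (sqrt (1 - k\<^sup>2))"
    unfolding z\<^sub>0_def by (simp add: mult.assoc[symmetric])
  then have "Re (cnj a * z\<^sub>0) = 1"
    using a0 by (simp add: k_def)
  then have "z\<^sub>0 \<in> sphere a r \<inter> sphere 0 1"
    using z01 K by simp
  moreover have "orthogonal (z - a) z" if "z \<in> sphere a r \<inter> sphere 0 1" for z
  proof -
    have z: "cmod z = 1" "Re (cnj a * z) = 1"
      using that K[of z] by auto
    then have "z \<bullet> z = 1"
      by (simp add: dot_square_norm)
    then show ?thesis
      using z(2) unfolding Re_cnj_mult by (simp add: orthogonal_def inner_diff_left)
  qed
  ultimately have "circle_orthogonal_to_unit (sphere a r)"
    unfolding circle_orthogonal_to_unit_def using r(1) by blast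
  moreover have "hyp_arc \<beta> \<gamma> = sphere a r \<inter> ball 0 1"
    unfolding arc by (simp only: hyp_arc_def K[symmetric]) auto
  ultimately show ?thesis
    unfolding real_hyperbolic_geodesic_def by blast
qed

text \<open>Near an endpoint \<open>\<eta>\<close> the arc is parametrized by the modulus \<open>\<rho>\<close>: the equation fixes the
  component along \<open>\<gamma>\<close>, and the sign of the other component is that of \<open>\<eta>\<close>.\<close>

lemma hyp_arc_near_endpoint:
  assumes less: "\<bar>\<beta>\<bar> < cmod \<gamma>" and \<eta>: "cmod \<eta> = 1" "\<beta> = Re (cnj \<gamma> * \<eta>)"
  obtains \<zeta> :: "real \<Rightarrow> complex" and \<rho>\<^sub>0 where "\<rho>\<^sub>0 < 1"
    "\<And>\<rho>. \<rho>\<^sub>0 < \<rho> \<Longrightarrow> \<rho> < 1 \<Longrightarrow> \<zeta> \<rho> \<in> hyp_arc \<beta> \<gamma> \<and> cmod (\<zeta> \<rho>) = \<rho>"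
    "(\<zeta> \<longlongrightarrow> \<eta>) (at_left 1)"
proof -
  have g: "\<gamma> \<noteq> 0"
    using less by auto
  define k where "k = \<beta> / cmod \<gamma>"
  have k1: "k\<^sup>2 < 1"
    using less g by (simp add: k_def abs_square_less_1 abs_divide)
  define u where "u = cnj (sgn \<gamma>) * \<eta>"
  have gg: "sgn \<gamma> * cnj (sgn \<gamma>) = 1"
    using g of_real_cmod_square[of "sgn \<gamma>"] by (simp add: norm_sgn)
  have eta: "\<eta> = sgn \<gamma> * u"
    using gg by (simp add: u_def mult.assoc[symmetric])
  have cg: "cnj \<gamma> = of_real (cmod \<gamma>) * cnj (sgn \<gamma>)"
    using g by (simp add: sgn_eq)
  have "\<beta> = cmod \<gamma> * Re u"
    using \<eta>(2) unfolding cg u_def by (simp add: mult.assoc)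
  then have Re_u: "Re u = k"
    using g by (simp add: k_def)
  have "cmod u = 1"
    using \<eta>(1) g by (simp add: u_def norm_mult norm_sgn)
  then have "(Im u)\<^sup>2 = 1 - k\<^sup>2"
    using cmod_power2[of u] Re_u by simp
  then have "\<bar>Im u\<bar> = sqrt (1 - k\<^sup>2)"
    by (metis real_sqrt_abs)
  then have Im_u: "Im u = sgn (Im u) * sqrt (1 - k\<^sup>2)"
    by (metis sgn_mult_abs mult.commute)
  have "Im u \<noteq> 0"
    using k1 \<open>(Im u)\<^sup>2 = 1 - k\<^sup>2\<close> by auto
  then have sgn2: "(sgn (Im u))\<^sup>2 = 1"
    by (simp add: sgn_if)
  define x where "x \<rho> = k * (1 + \<rho>\<^sup>2) / 2" for \<rho> :: real
  define \<zeta> where "\<zeta> \<rho> = sgn \<gamma> * Complex (x \<rho>) (sgn (Im u) * sqrt (\<rho>\<^sup>2 - (x \<rho>)\<^sup>2))" for \<rho>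
  have "((\<lambda>\<rho>. \<rho>\<^sup>2 - (x \<rho>)\<^sup>2) \<longlongrightarrow> 1\<^sup>2 - (x 1)\<^sup>2) (at_left 1)"
    unfolding x_def by (intro tendsto_intros) auto
  moreover have "0 < 1\<^sup>2 - (x 1)\<^sup>2"
    using k1 by (simp add: x_def)
  ultimately have "\<forall>\<^sub>F \<rho> in at_left 1. 0 < \<rho>\<^sup>2 - (x \<rho>)\<^sup>2"
    by (rule order_tendstoD)
  then obtain \<rho>\<^sub>1 where \<rho>1: "\<rho>\<^sub>1 < 1" "\<And>\<rho>. \<rho>\<^sub>1 < \<rho> \<Longrightarrow> \<rho> < 1 \<Longrightarrow> 0 < \<rho>\<^sup>2 - (x \<rho>)\<^sup>2"
    unfolding eventually_at_left_field by blast
  show ?thesis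
  proof (rule that)
    show "max 0 \<rho>\<^sub>1 < 1"
      using \<rho>1(1) by simp
    fix \<rho> :: real assume \<rho>: "max 0 \<rho>\<^sub>1 < \<rho>" "\<rho> < 1"
    then have "cmod (Complex (x \<rho>) (sgn (Im u) * sqrt (\<rho>\<^sup>2 - (x \<rho>)\<^sup>2))) = \<rho>"
      using \<rho>1(2)[of \<rho>] by (simp add: cmod_def power_mult_distrib sgn2)
    then have norm: "cmod (\<zeta> \<rho>) = \<rho>"
      using g by (simp add: \<zeta>_def norm_mult norm_sgn)
    have "cnj \<gamma> * \<zeta> \<rho> = of_real (cmod \<gamma>) * (sgn \<gamma> * cnj (sgn \<gamma>))
        * Complex (x \<rho>) (sgn (Im u) * sqrt (\<rho>\<^sup>2 - (x \<rho>)\<^sup>2))"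
      unfolding cg \<zeta>_def by (simp add: mult_ac)
    then have "Re (cnj \<gamma> * \<zeta> \<rho>) = cmod \<gamma> * x \<rho>"
      unfolding gg by simp
    also have "2 * (cmod \<gamma> * x \<rho>) = \<beta> * (1 + \<rho>\<^sup>2)"
      using g by (simp add: x_def k_def)
    finally show "\<zeta> \<rho> \<in> hyp_arc \<beta> \<gamma> \<and> cmod (\<zeta> \<rho>) = \<rho>"
      using norm \<rho>(2) by (simp add: hyp_arc_def)
  next
    have "(\<zeta> \<longlongrightarrow> sgn \<gamma> * Complex (x 1) (sgn (Im u) * sqrt (1\<^sup>2 - (x 1)\<^sup>2))) (at_left 1)"
      unfolding \<zeta>_def x_def by (intro tendsto_intros) auto
    moreover have "Complex (x 1) (sgn (Im u) * sqrt (1\<^sup>2 - (x 1)\<^sup>2)) = u"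
      using Re_u Im_u by (simp add: x_def complex_eq_iff)
    ultimately show "(\<zeta> \<longlongrightarrow> \<eta>) (at_left 1)"
      unfolding eta by simp
  qed
qed

lemma hyperbolic_endpoints_hyp_arc:
  assumes "\<bar>\<beta>\<bar> < cmod \<gamma>"
  shows "hyperbolic_endpoints (hyp_arc \<beta> \<gamma>) = {z. cmod z = 1 \<and> \<beta> = Re (cnj \<gamma> * z)}"
proof
  have "closed {z. \<beta> * (1 + (cmod z)\<^sup>2) = 2 * Re (cnj \<gamma> * z)}"
    by (intro closed_Collect_eq continuous_intros)
  then have "closure (hyp_arc \<beta> \<gamma>) \<subseteq> {z. \<beta> * (1 + (cmod z)\<^sup>2) = 2 * Re (cnj \<gamma> * z)}"
    by (intro closure_minimal) (auto simp: hyp_arc_def)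
  then show "hyperbolic_endpoints (hyp_arc \<beta> \<gamma>) \<subseteq> {z. cmod z = 1 \<and> \<beta> = Re (cnj \<gamma> * z)}"
    by (auto simp: hyperbolic_endpoints_def)
next
  show "{z. cmod z = 1 \<and> \<beta> = Re (cnj \<gamma> * z)} \<subseteq> hyperbolic_endpoints (hyp_arc \<beta> \<gamma>)"
  proof
    fix \<eta> assume "\<eta> \<in> {z. cmod z = 1 \<and> \<beta> = Re (cnj \<gamma> * z)}"
    then have \<eta>: "cmod \<eta> = 1" "\<beta> = Re (cnj \<gamma> * \<eta>)" by auto
    obtain \<zeta> \<rho>\<^sub>0 where \<zeta>: "\<rho>\<^sub>0 < 1" "\<And>\<rho>. \<rho>\<^sub>0 < \<rho> \<Longrightarrow> \<rho> < 1 \<Longrightarrow> \<zeta> \<rho> \<in> hyp_arc \<beta> \<gamma> \<and> cmod (\<zeta> \<rho>) = \<rho>"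
      "(\<zeta> \<longlongrightarrow> \<eta>) (at_left 1)"
      using hyp_arc_near_endpoint[OF assms \<eta>] by metis
    have "\<forall>\<^sub>F \<rho> in at_left 1. \<zeta> \<rho> \<in> closure (hyp_arc \<beta> \<gamma>)"
      unfolding eventually_at_left_field using \<zeta>(1,2) closure_subset by blast
    then have "\<eta> \<in> closure (hyp_arc \<beta> \<gamma>)"
      by (rule Lim_in_closed_set[OF closed_closure _ _ \<zeta>(3)]) simp
    then show "\<eta> \<in> hyperbolic_endpoints (hyp_arc \<beta> \<gamma>)"
      using \<eta>(1) by (simp add: hyperbolic_endpoints_def)
  qed
qed

text \<open>A limit point inside the disc is what the identity theorem needs along an arc.\<close>

lemma hyp_arc_limit_point:
  assumes "\<bar>\<beta>\<bar> < cmod \<gamma>" "cmod \<eta> = 1" "\<beta> = Re (cnj \<gamma> * \<eta>)"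
  obtains \<xi> where "cmod \<xi> < 1" "\<xi> islimpt hyp_arc \<beta> \<gamma>"
proof -
  obtain \<zeta> :: "real \<Rightarrow> complex" and \<rho>\<^sub>0 where \<zeta>: "\<rho>\<^sub>0 < 1"
    "\<And>\<rho>. \<rho>\<^sub>0 < \<rho> \<Longrightarrow> \<rho> < 1 \<Longrightarrow> \<zeta> \<rho> \<in> hyp_arc \<beta> \<gamma> \<and> cmod (\<zeta> \<rho>) = \<rho>"
    using hyp_arc_near_endpoint[OF assms] by metis
  define \<rho>\<^sub>1 where "\<rho>\<^sub>1 = (\<rho>\<^sub>0 + 1) / 2"
  have r1: "\<rho>\<^sub>0 < \<rho>\<^sub>1" "\<rho>\<^sub>1 < 1"
    using \<zeta>(1) by (auto simp: \<rho>\<^sub>1_def)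
  have "inj_on \<zeta> {\<rho>\<^sub>0<..<\<rho>\<^sub>1}"
    using \<zeta>(2) r1 by (intro inj_onI) (metis greaterThanLessThan_iff less_trans)
  then have "infinite (\<zeta> ` {\<rho>\<^sub>0<..<\<rho>\<^sub>1})"
    using r1 infinite_Ioo finite_image_iff by blast
  moreover have "\<zeta> ` {\<rho>\<^sub>0<..<\<rho>\<^sub>1} \<subseteq> cball 0 \<rho>\<^sub>1"
    using \<zeta>(2) r1 by fastforce
  ultimately obtain \<xi> where \<xi>: "\<xi> \<in> cball 0 \<rho>\<^sub>1" "\<xi> islimpt \<zeta> ` {\<rho>\<^sub>0<..<\<rho>\<^sub>1}"
    using compact_cball[of "0::complex" \<rho>\<^sub>1] unfolding compact_eq_Bolzano_Weierstrass by blast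
  have "\<xi> islimpt hyp_arc \<beta> \<gamma>"
    using \<xi>(2) by (rule islimpt_subset) (use \<zeta>(2) r1 in force)
  then show ?thesis
    using that[of \<xi>] \<xi>(1) r1(2) by simp
qed

text \<open>The two endpoint conditions force \<open>\<gamma>\<close> to be a real multiple of \<open>\<i>(\<eta>\<^sub>1 - \<eta>\<^sub>2)\<close>, and \<open>\<beta>\<close> is then
  determined by the same factor.\<close>

lemma hyp_arc_determined_by_endpoints:
  assumes "\<bar>\<beta>\<bar> < cmod \<gamma>" "\<eta>\<^sub>1 \<noteq> \<eta>\<^sub>2"
    "\<beta> = Re (cnj \<gamma> * \<eta>\<^sub>1)" "\<beta> = Re (cnj \<gamma> * \<eta>\<^sub>2)"
  shows "hyp_arc \<beta> \<gamma> = hyp_arc (Re (cnj (\<i> * (\<eta>\<^sub>1 - \<eta>\<^sub>2)) * \<eta>\<^sub>1)) (\<i> * (\<eta>\<^sub>1 - \<eta>\<^sub>2))"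
proof -
  define \<delta> where "\<delta> = \<eta>\<^sub>1 - \<eta>\<^sub>2"
  have d: "\<delta> \<noteq> 0"
    using assms(2) by (simp add: \<delta>_def)
  define r where "r = Im (\<gamma> * cnj \<delta>) / (cmod \<delta>)\<^sup>2"
  have "Re (\<gamma> * cnj \<delta>) = 0"
    using assms(3,4) by (simp add: \<delta>_def algebra_simps)
  then have "\<gamma> * cnj \<delta> = \<i> * of_real (Im (\<gamma> * cnj \<delta>))"
    by (simp add: complex_eq_iff)
  moreover have "\<gamma> * (\<delta> * cnj \<delta>) = (\<gamma> * cnj \<delta>) * \<delta>"
    by (simp add: algebra_simps)
  ultimately have "\<gamma> * (\<delta> * cnj \<delta>) = \<i> * of_real (Im (\<gamma> * cnj \<delta>)) * \<delta>"
    by metis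
  then have g: "\<gamma> = of_real r * (\<i> * \<delta>)"
    using d of_real_cmod_square[of \<delta>] by (simp add: r_def field_simps)
  have "\<gamma> \<noteq> 0"
    using assms(1) by auto
  then have "r \<noteq> 0"
    using g by auto
  moreover have "\<beta> = r * Re (cnj (\<i> * \<delta>) * \<eta>\<^sub>1)"
    unfolding assms(3) g by (simp add: algebra_simps)
  ultimately show ?thesis
    using hyp_arc_scale[of r] g by (simp add: \<delta>_def)
qed

section \<open>Parametrizations of a geodesic\<close>

text \<open>The change of parameter is \<open>\<Phi> \<circ> h'\<close> for a left inverse \<open>\<Phi>\<close> of \<open>h\<close>.\<close>

lemma geodesic_reparametrization:
  assumes h: "geodesic_param h" and h': "geodesic_param h'" and sub: "h' ` ball 0 1 \<subseteq> h ` ball 0 1"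
  obtains m where "m holomorphic_on ball 0 1" "\<And>z. cmod z < 1 \<Longrightarrow> cmod (m z) < 1"
    "\<And>z. cmod z < 1 \<Longrightarrow> h' z = h (m z)" "\<And>z x. cmod z < 1 \<Longrightarrow> cmod x < 1 \<Longrightarrow> h' z = h x \<Longrightarrow> m z = x"
proof -
  obtain \<Phi> where \<Phi>: "holo2_on \<Phi> sym_bidisc" "\<And>z. cmod z < 1 \<Longrightarrow> \<Phi> (h z) = z"
    using h by (auto simp: geodesic_param_def)
  have h'G: "h' z \<in> sym_bidisc" if "cmod z < 1" for z
    using h' that by (auto simp: geodesic_param_def image_subset_iff)
  have in_h: "\<exists>x. cmod x < 1 \<and> h' z = h x" if "cmod z < 1" for z
    using sub that by (force simp: image_subset_iff)
  have "(\<lambda>z. \<Phi> (fst (h' z), snd (h' z))) holomorphic_on ball 0 1"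
    by (rule holo2_compose_holomorphic[OF \<Phi>(1) open_ball])
       (use h' h'G in \<open>auto simp: geodesic_param_def holo_curve_on_def\<close>)
  then have 1: "(\<lambda>z. \<Phi> (h' z)) holomorphic_on ball 0 1"
    by simp
  have 2: "cmod (\<Phi> (h' z)) < 1 \<and> h' z = h (\<Phi> (h' z))" if z: "cmod z < 1" for z
  proof -
    obtain x where "cmod x < 1" "h' z = h x"
      using in_h[OF z] by blast
    then show ?thesis
      using \<Phi>(2) by simp
  qed
  show ?thesis
    by (rule that[OF 1]) (use 2 \<Phi>(2) in auto)
qed

lemma geodesic_tangent_param:
  assumes h: "geodesic_param h" and z: "cmod z < 1"
  shows "geodesic_tangent (h ` ball 0 1) (h z) = range (\<lambda>c. cscale c (curve_deriv h z))"
proof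
  show "range (\<lambda>c. cscale c (curve_deriv h z)) \<subseteq> geodesic_tangent (h ` ball 0 1) (h z)"
    unfolding geodesic_tangent_def using h z by auto
  show "geodesic_tangent (h ` ball 0 1) (h z) \<subseteq> range (\<lambda>c. cscale c (curve_deriv h z))"
  proof
    fix v assume "v \<in> geodesic_tangent (h ` ball 0 1) (h z)"
    then obtain c h' z' where v: "v = cscale c (curve_deriv h' z')" and h': "geodesic_param h'"
      and im: "h ` ball 0 1 = h' ` ball 0 1" and z': "cmod z' < 1" and eq: "h' z' = h z"
      unfolding geodesic_tangent_def by auto
    obtain m where m: "m holomorphic_on ball 0 1" "\<And>z. cmod z < 1 \<Longrightarrow> cmod (m z) < 1"
      "\<And>z. cmod z < 1 \<Longrightarrow> h' z = h (m z)" "\<And>z x. cmod z < 1 \<Longrightarrow> cmod x < 1 \<Longrightarrow> h' z = h x \<Longrightarrow> m z = x"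
      using geodesic_reparametrization[OF h h'] im by blast
    have mz: "m z' = z"
      using m(4) z z' eq by blast
    have dm: "(m has_field_derivative deriv m z') (at z')"
      using m(1) z' by (intro holomorphic_derivI[of _ "ball 0 1"]) auto
    have chain: "deriv (\<lambda>\<zeta>. k (h' \<zeta>)) z' = deriv (\<lambda>\<zeta>. k (h \<zeta>)) z * deriv m z'"
      if "(\<lambda>\<zeta>. k (h \<zeta>)) holomorphic_on ball 0 1" for k :: "complex \<times> complex \<Rightarrow> complex"
    proof -
      have "((\<lambda>\<zeta>. k (h \<zeta>)) has_field_derivative deriv (\<lambda>\<zeta>. k (h \<zeta>)) z) (at (m z'))"
        unfolding mz using that z by (intro holomorphic_derivI[of _ "ball 0 1"]) auto
      then have "((\<lambda>\<zeta>. k (h \<zeta>)) \<circ> m has_field_derivative deriv (\<lambda>\<zeta>. k (h \<zeta>)) z * deriv m z') (at z')"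
        by (rule DERIV_chain) (rule dm)
      then have "((\<lambda>\<zeta>. k (h' \<zeta>)) has_field_derivative deriv (\<lambda>\<zeta>. k (h \<zeta>)) z * deriv m z') (at z')"
        by (rule has_field_derivative_transform_within_open[where S = "ball 0 1"]) (use z' m(3) in auto)
      then show ?thesis
        by (rule DERIV_imp_deriv)
    qed
    have "curve_deriv h' z' = cscale (deriv m z') (curve_deriv h z)"
      using chain[of fst] chain[of snd] h
      by (simp add: curve_deriv_def cscale_def geodesic_param_def holo_curve_on_def mult.commute)
    then have "v = cscale (c * deriv m z') (curve_deriv h z)"
      by (simp add: v cscale_def)
    then show "v \<in> range (\<lambda>c. cscale c (curve_deriv h z))"
      by (rule range_eqI)
  qed
qed

text \<open>With a left inverse \<open>\<Phi>\<^sub>0\<close> of \<open>h\<^sub>0\<close>, the maps \<open>h\<^sub>0 \<circ> \<Phi>\<^sub>0 \<circ> h\<close> and \<open>h\<close> agree on \<open>C\<close>, hence on the disc. So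
  \<open>\<Phi>\<^sub>0 \<circ> h\<close> is a left-invertible map of the disc, which is an automorphism.\<close>

lemma geodesic_eq_if_contains_arc:
  assumes h: "geodesic_param h" and h\<^sub>0: "geodesic_param h\<^sub>0"
    and sub: "C \<subseteq> ball 0 1" "h ` C \<subseteq> h\<^sub>0 ` ball 0 1" and lim: "\<xi> islimpt C" "cmod \<xi> < 1"
  shows "h ` ball 0 1 = h\<^sub>0 ` ball 0 1"
proof -
  obtain \<Phi> where \<Phi>: "holo2_on \<Phi> sym_bidisc" "\<Phi> ` sym_bidisc \<subseteq> ball 0 1" "\<And>z. cmod z < 1 \<Longrightarrow> \<Phi> (h z) = z"
    using h by (auto simp: geodesic_param_def)
  obtain \<Phi>\<^sub>0 where \<Phi>\<^sub>0: "holo2_on \<Phi>\<^sub>0 sym_bidisc" "\<Phi>\<^sub>0 ` sym_bidisc \<subseteq> ball 0 1"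
      "\<And>z. cmod z < 1 \<Longrightarrow> \<Phi>\<^sub>0 (h\<^sub>0 z) = z"
    using h\<^sub>0 by (auto simp: geodesic_param_def)
  have hol: "(\<lambda>z. fst (h z)) holomorphic_on ball 0 1" "(\<lambda>z. snd (h z)) holomorphic_on ball 0 1"
     "(\<lambda>z. fst (h\<^sub>0 z)) holomorphic_on ball 0 1" "(\<lambda>z. snd (h\<^sub>0 z)) holomorphic_on ball 0 1"
    using h h\<^sub>0 by (auto simp: geodesic_param_def holo_curve_on_def)
  have G: "h z \<in> sym_bidisc" "h\<^sub>0 z \<in> sym_bidisc" if "cmod z < 1" for z
    using h h\<^sub>0 that by (auto simp: geodesic_param_def image_subset_iff)
  define m k where "m z = \<Phi>\<^sub>0 (h z)" and "k z = \<Phi> (h\<^sub>0 z)" for z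
  have "(\<lambda>z. \<Phi>\<^sub>0 (fst (h z), snd (h z))) holomorphic_on ball 0 1"
    by (rule holo2_compose_holomorphic[OF \<Phi>\<^sub>0(1) open_ball]) (use hol G in auto)
  then have m_hol: "m holomorphic_on ball 0 1"
    by (simp add: m_def[abs_def])
  have "(\<lambda>z. \<Phi> (fst (h\<^sub>0 z), snd (h\<^sub>0 z))) holomorphic_on ball 0 1"
    by (rule holo2_compose_holomorphic[OF \<Phi>(1) open_ball]) (use hol G in auto)
  then have k_hol: "k holomorphic_on ball 0 1"
    by (simp add: k_def[abs_def])
  have m1: "cmod (m z) < 1" and k1: "cmod (k z) < 1" if "cmod z < 1" for z
    using G[OF that] \<Phi>(2) \<Phi>\<^sub>0(2) by (auto simp: m_def k_def image_subset_iff)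
  have m_im: "m ` ball 0 1 \<subseteq> ball 0 1"
    using m1 by auto
  have on_C: "h\<^sub>0 (m z) = h z" if z: "z \<in> C" for z
  proof -
    obtain x where "cmod x < 1" "h z = h\<^sub>0 x"
      using sub(2) z by (force simp: image_subset_iff)
    then show ?thesis
      using \<Phi>\<^sub>0(3) by (simp add: m_def)
  qed
  have vanish: "f z = 0" if "f holomorphic_on ball 0 1" "\<And>z. z \<in> C \<Longrightarrow> f z = 0" "cmod z < 1"
    for f :: "complex \<Rightarrow> complex" and z
    by (rule analytic_continuation[OF that(1) open_ball connected_ball sub(1) _ lim(1) that(2)])
       (use lim(2) that(3) in auto)
  have hm: "h\<^sub>0 (m z) = h z" if z: "cmod z < 1" for z
  proof -
    have comp: "(\<lambda>z. k (m z)) holomorphic_on ball 0 1" if "k holomorphic_on ball 0 1" for k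
      using holomorphic_on_compose_gen[OF m_hol that m_im] by (simp add: o_def)
    have "(\<lambda>z. fst (h\<^sub>0 (m z)) - fst (h z)) holomorphic_on ball 0 1"
      "(\<lambda>z. snd (h\<^sub>0 (m z)) - snd (h z)) holomorphic_on ball 0 1"
      by (intro holomorphic_on_diff hol comp[OF hol(3)] comp[OF hol(4)])+
    then have "fst (h\<^sub>0 (m z)) - fst (h z) = 0" "snd (h\<^sub>0 (m z)) - snd (h z) = 0"
      using vanish[OF _ _ z, of "\<lambda>z. fst (h\<^sub>0 (m z)) - fst (h z)"]
        vanish[OF _ _ z, of "\<lambda>z. snd (h\<^sub>0 (m z)) - snd (h z)"] on_C by simp_all
    then show ?thesis
      by (simp add: prod_eq_iff)
  qed
  have "k (m z) = z" if "cmod z < 1" for z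
    using hm[OF that] \<Phi>(3)[OF that] by (simp add: k_def)
  then obtain a b where ab: "cmod b < cmod a" "\<And>z. cmod z < 1 \<Longrightarrow> m z = mob a b z"
    using left_invertible_disc_map_is_mob[OF m_hol m1 k_hol k1] by metis
  have "h\<^sub>0 w \<in> h ` ball 0 1" if w: "cmod w < 1" for w
  proof -
    have neg: "cmod (- b) < cmod (cnj a)"
      using ab(1) by simp
    define z where "z = mob (cnj a) (- b) w"
    have z: "cmod z < 1"
      unfolding z_def by (rule mob_less_1[OF neg w])
    have "m z = w"
      using mob_inverse[OF neg, of w] w ab(2)[OF z] by (simp add: z_def)
    then show ?thesis
      using hm[OF z] z by force
  qed
  moreover have "h z \<in> h\<^sub>0 ` ball 0 1" if "cmod z < 1" for z
    using hm[OF that] m1[OF that] by (metis image_eqI mem_ball_0)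
  ultimately show ?thesis
    by auto
qed

lemma holo_extension_unique:
  assumes "holo_extension h g" "holo_extension h g'" "cmod z \<le> 1"
  shows "g z = g' z"
proof -
  have cont: "continuous_on (cball 0 1) f"
    if f: "holo_extension h f" for f
  proof -
    obtain S where "cball 0 1 \<subseteq> S" "holo_curve_on f S"
      using f by (auto simp: holo_extension_def)
    then have "continuous_on (cball 0 1) (\<lambda>z. fst (f z))" "continuous_on (cball 0 1) (\<lambda>z. snd (f z))"
      using continuous_on_subset holomorphic_on_imp_continuous_on unfolding holo_curve_on_def by blast+
    then show ?thesis
      using continuous_on_Pair by fastforce
  qed
  have eq: "g x = g' x" if "x \<in> ball 0 1" for x
    using assms(1,2) that by (simp add: holo_extension_def)
  have zc: "z \<in> closure (ball 0 1)"
    using assms(3) by simp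
  have "fst (g z) - fst (g' z) = 0"
    by (rule continuous_constant_on_closure[OF _ _ zc, where f = "\<lambda>z. fst (g z) - fst (g' z)"])
       (use cont assms(1,2) eq in \<open>auto intro!: continuous_intros\<close>)
  moreover have "snd (g z) - snd (g' z) = 0"
    by (rule continuous_constant_on_closure[OF _ _ zc, where f = "\<lambda>z. snd (g z) - snd (g' z)"])
       (use cont assms(1,2) eq in \<open>auto intro!: continuous_intros\<close>)
  ultimately show ?thesis
    by (simp add: prod_eq_iff)
qed

section \<open>Purely balanced geodesics\<close>

text \<open>The numerator of \<open>1 - f\<^sub>1\<^sup>*f\<^sub>2\<close> for \<open>f\<^sub>i = mob a\<^sub>i b\<^sub>i\<close>; its real and imaginary parts decide both where the
  geodesic is sharp and where its royal nodes are.\<close>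

definition pair_form :: "complex \<Rightarrow> complex \<Rightarrow> complex \<Rightarrow> complex \<Rightarrow> complex \<Rightarrow> complex" where
  "pair_form a\<^sub>1 b\<^sub>1 a\<^sub>2 b\<^sub>2 z =
     (b\<^sub>1 * cnj z + a\<^sub>1) * (cnj b\<^sub>2 * z + cnj a\<^sub>2) - (cnj a\<^sub>1 * cnj z + cnj b\<^sub>1) * (a\<^sub>2 * z + b\<^sub>2)"

lemma pair_form_kernel:
  assumes "cmod b\<^sub>1 < cmod a\<^sub>1" "cmod b\<^sub>2 < cmod a\<^sub>2" "cmod z \<le> 1"
  shows "1 - cnj (mob a\<^sub>1 b\<^sub>1 z) * mob a\<^sub>2 b\<^sub>2 z =
    pair_form a\<^sub>1 b\<^sub>1 a\<^sub>2 b\<^sub>2 z / (cnj (cnj b\<^sub>1 * z + cnj a\<^sub>1) * (cnj b\<^sub>2 * z + cnj a\<^sub>2))"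
proof -
  have "cnj b\<^sub>2 * z + cnj a\<^sub>2 \<noteq> 0" "cnj (cnj b\<^sub>1 * z + cnj a\<^sub>1) \<noteq> 0"
    using mob_denom_nonzero assms by (auto simp del: complex_cnj_add)
  then have "cnj b\<^sub>2 * z + cnj a\<^sub>2 \<noteq> 0" "b\<^sub>1 * cnj z + a\<^sub>1 \<noteq> 0"
    by auto
  then show ?thesis
    unfolding mob_def pair_form_def by (simp add: divide_simps)
qed

lemma pair_form_expand:
  fixes a\<^sub>1 b\<^sub>1 a\<^sub>2 b\<^sub>2 z :: complex
  defines "\<kappa> \<equiv> a\<^sub>1 * cnj a\<^sub>2 - cnj b\<^sub>1 * b\<^sub>2" and "\<delta> \<equiv> a\<^sub>1 * cnj b\<^sub>2 - cnj b\<^sub>1 * a\<^sub>2"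
  shows "pair_form a\<^sub>1 b\<^sub>1 a\<^sub>2 b\<^sub>2 z = \<kappa> - cnj \<kappa> * of_real ((cmod z)\<^sup>2) + (\<delta> * z - cnj (\<delta> * z))"
  unfolding pair_form_def \<kappa>_def \<delta>_def
  by (simp add: of_real_cmod_square) (simp add: algebra_simps)

text \<open>In terms of the lifts the tangent vector of the geodesic is \<open>(f\<^sub>1', f\<^sub>2')\<close> and the sharp direction
  is spanned by \<open>((1 - \<bar>f\<^sub>1\<bar>\<^sup>2)(1 - f\<^sub>2\<^sup>*f\<^sub>1), (1 - \<bar>f\<^sub>2\<bar>\<^sup>2)(1 - f\<^sub>1\<^sup>*f\<^sub>2))\<close>. Once the common nonzero factor
  \<open>E\<close> is cancelled, proportionality says \<open>P = P\<^sup>*\<close> for the numerator \<open>P\<close> of \<open>1 - f\<^sub>1\<^sup>*f\<^sub>2\<close>.\<close>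

lemma sharp_iff_pair_form_real:
  assumes ab: "cmod b\<^sub>1 < cmod a\<^sub>1" "cmod b\<^sub>2 < cmod a\<^sub>2" and z: "cmod z < 1"
  defines "D\<^sub>1 \<equiv> cnj b\<^sub>1 * z + cnj a\<^sub>1" and "D\<^sub>2 \<equiv> cnj b\<^sub>2 * z + cnj a\<^sub>2"
  shows "(a\<^sub>1 * cnj a\<^sub>1 - b\<^sub>1 * cnj b\<^sub>1) / D\<^sub>1\<^sup>2 * sharp_component (mob a\<^sub>2 b\<^sub>2 z) (mob a\<^sub>1 b\<^sub>1 z)
       = (a\<^sub>2 * cnj a\<^sub>2 - b\<^sub>2 * cnj b\<^sub>2) / D\<^sub>2\<^sup>2 * sharp_component (mob a\<^sub>1 b\<^sub>1 z) (mob a\<^sub>2 b\<^sub>2 z)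
     \<longleftrightarrow> Im (pair_form a\<^sub>1 b\<^sub>1 a\<^sub>2 b\<^sub>2 z) = 0"
proof -
  define d\<^sub>1 d\<^sub>2 P where "d\<^sub>1 = a\<^sub>1 * cnj a\<^sub>1 - b\<^sub>1 * cnj b\<^sub>1" and "d\<^sub>2 = a\<^sub>2 * cnj a\<^sub>2 - b\<^sub>2 * cnj b\<^sub>2"
    and "P = pair_form a\<^sub>1 b\<^sub>1 a\<^sub>2 b\<^sub>2 z"
  define f\<^sub>1 f\<^sub>2 where "f\<^sub>1 = mob a\<^sub>1 b\<^sub>1 z" and "f\<^sub>2 = mob a\<^sub>2 b\<^sub>2 z"
  have le: "cmod z \<le> 1"
    using z by simp
  have nz: "D\<^sub>1 \<noteq> 0" "D\<^sub>2 \<noteq> 0" "d\<^sub>1 \<noteq> 0" "d\<^sub>2 \<noteq> 0" "1 - cnj z * z \<noteq> 0"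
    unfolding D\<^sub>1_def D\<^sub>2_def d\<^sub>1_def d\<^sub>2_def
    using mob_denom_nonzero[OF ab(1) le] mob_denom_nonzero[OF ab(2) le] mob_det_pos(3)[OF ab(1)]
      mob_det_pos(3)[OF ab(2)] one_minus_cnj_mult_nonzero[OF z z] by blast+
  have k: "1 - f\<^sub>1 * cnj f\<^sub>1 = d\<^sub>1 * (1 - cnj z * z) / (cnj D\<^sub>1 * D\<^sub>1)"
     "1 - f\<^sub>2 * cnj f\<^sub>2 = d\<^sub>2 * (1 - cnj z * z) / (cnj D\<^sub>2 * D\<^sub>2)"
    unfolding mult.commute[of f\<^sub>1] mult.commute[of f\<^sub>2] unfolding f\<^sub>1_def f\<^sub>2_def D\<^sub>1_def D\<^sub>2_def d\<^sub>1_def d\<^sub>2_def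
    by (rule mob_kernel; use ab le in simp)+
  have K: "1 - cnj f\<^sub>1 * f\<^sub>2 = P / (cnj D\<^sub>1 * D\<^sub>2)"
    unfolding f\<^sub>1_def f\<^sub>2_def D\<^sub>1_def D\<^sub>2_def P_def by (rule pair_form_kernel[OF ab le])
  have K': "1 - cnj f\<^sub>2 * f\<^sub>1 = cnj P / (D\<^sub>1 * cnj D\<^sub>2)"
    using arg_cong[OF K, of cnj] by (simp add: mult.commute)
  define E where "E = d\<^sub>1 * d\<^sub>2 * (1 - cnj z * z) / (D\<^sub>1\<^sup>2 * D\<^sub>2\<^sup>2 * cnj D\<^sub>1 * cnj D\<^sub>2)"
  have E: "E \<noteq> 0"
    using nz by (simp add: E_def)
  have "d\<^sub>1 / D\<^sub>1\<^sup>2 * sharp_component f\<^sub>2 f\<^sub>1 = E * P"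
    unfolding sharp_component_def k K E_def using nz by (simp add: field_simps power2_eq_square)
  moreover have "d\<^sub>2 / D\<^sub>2\<^sup>2 * sharp_component f\<^sub>1 f\<^sub>2 = E * cnj P"
    unfolding sharp_component_def k K' E_def using nz by (simp add: field_simps power2_eq_square)
  ultimately have "d\<^sub>1 / D\<^sub>1\<^sup>2 * sharp_component f\<^sub>2 f\<^sub>1 = d\<^sub>2 / D\<^sub>2\<^sup>2 * sharp_component f\<^sub>1 f\<^sub>2 \<longleftrightarrow> P = cnj P"
    using E by simp
  also have "\<dots> \<longleftrightarrow> Im P = 0"
    by (auto simp: complex_eq_iff)
  finally show ?thesis
    unfolding d\<^sub>1_def d\<^sub>2_def P_def f\<^sub>1_def f\<^sub>2_def .
qed

text \<open>Since \<open>\<bar>f\<^sub>1\<bar> = 1\<close> on the circle, \<open>f\<^sub>1 = f\<^sub>2\<close> there means \<open>1 - f\<^sub>1\<^sup>*f\<^sub>2 = 0\<close>. For \<open>\<bar>z\<bar> = 1\<close> the pair form is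
  imaginary, so a single real equation remains; it is the equation of the sharp points at
  \<open>\<bar>z\<bar> = 1\<close>.\<close>

lemma mob_eq_iff_on_circle:
  fixes a\<^sub>1 b\<^sub>1 a\<^sub>2 b\<^sub>2 z :: complex
  assumes ab: "cmod b\<^sub>1 < cmod a\<^sub>1" "cmod b\<^sub>2 < cmod a\<^sub>2" and z: "cmod z = 1"
  defines "\<kappa> \<equiv> a\<^sub>1 * cnj a\<^sub>2 - cnj b\<^sub>1 * b\<^sub>2" and "\<delta> \<equiv> a\<^sub>1 * cnj b\<^sub>2 - cnj b\<^sub>1 * a\<^sub>2"
  shows "mob a\<^sub>1 b\<^sub>1 z = mob a\<^sub>2 b\<^sub>2 z \<longleftrightarrow> Im \<kappa> + Im (\<delta> * z) = 0"
proof -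
  define f\<^sub>1 f\<^sub>2 where "f\<^sub>1 = mob a\<^sub>1 b\<^sub>1 z" and "f\<^sub>2 = mob a\<^sub>2 b\<^sub>2 z"
  have "cmod f\<^sub>1 = 1"
    unfolding f\<^sub>1_def by (rule mob_sphere[OF ab(1) z])
  then have f1: "f\<^sub>1 * cnj f\<^sub>1 = 1"
    using of_real_cmod_square[of f\<^sub>1] by simp
  have le: "cmod z \<le> 1"
    using z by simp
  have "1 - cnj f\<^sub>1 * f\<^sub>2 = cnj f\<^sub>1 * (f\<^sub>1 - f\<^sub>2)"
    using f1 by (simp add: algebra_simps)
  moreover have "cnj f\<^sub>1 \<noteq> 0"
    using f1 by auto
  ultimately have "f\<^sub>1 = f\<^sub>2 \<longleftrightarrow> 1 - cnj f\<^sub>1 * f\<^sub>2 = 0"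
    by simp
  also have "\<dots> \<longleftrightarrow> pair_form a\<^sub>1 b\<^sub>1 a\<^sub>2 b\<^sub>2 z = 0"
    unfolding f\<^sub>1_def f\<^sub>2_def pair_form_kernel[OF ab le]
    using mob_denom_nonzero[OF ab(1) le] mob_denom_nonzero[OF ab(2) le]
    by (simp del: complex_cnj_add complex_cnj_mult)
  also have "pair_form a\<^sub>1 b\<^sub>1 a\<^sub>2 b\<^sub>2 z = (\<kappa> - cnj \<kappa>) + (\<delta> * z - cnj (\<delta> * z))"
    unfolding pair_form_expand z \<kappa>_def \<delta>_def by simp
  also have "\<dots> = \<i> * of_real (2 * (Im \<kappa> + Im (\<delta> * z)))"
    unfolding complex_diff_cnj by (simp add: algebra_simps)
  also have "\<dots> = 0 \<longleftrightarrow> Im \<kappa> + Im (\<delta> * z) = 0"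
    by (simp only: mult_eq_0_iff of_real_eq_0_iff) simp
  finally show ?thesis
    unfolding f\<^sub>1_def f\<^sub>2_def .
qed

text \<open>A royal point in the open domain would not lie in the royal boundary, so the geodesic can be
  lifted; its royal points are then the images of the points of the closed disc where the two
  lifts coincide.\<close>

lemma purely_balanced_lift:
  assumes h: "geodesic_param h" and pb: "purely_balanced (h ` ball 0 1)"
  obtains a\<^sub>1 b\<^sub>1 a\<^sub>2 b\<^sub>2 \<eta>\<^sub>1 \<eta>\<^sub>2 where "cmod b\<^sub>1 < cmod a\<^sub>1" "cmod b\<^sub>2 < cmod a\<^sub>2"
    "\<And>z. cmod z < 1 \<Longrightarrow> h z = sympair (mob a\<^sub>1 b\<^sub>1 z) (mob a\<^sub>2 b\<^sub>2 z) \<and> mob a\<^sub>1 b\<^sub>1 z \<noteq> mob a\<^sub>2 b\<^sub>2 z"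
    "\<eta>\<^sub>1 \<noteq> \<eta>\<^sub>2" "cmod \<eta>\<^sub>1 = 1" "cmod \<eta>\<^sub>2 = 1"
    "\<And>z. cmod z \<le> 1 \<Longrightarrow> mob a\<^sub>1 b\<^sub>1 z = mob a\<^sub>2 b\<^sub>2 z \<longleftrightarrow> z = \<eta>\<^sub>1 \<or> z = \<eta>\<^sub>2"
    "royal_points (h ` ball 0 1) = (\<lambda>z. sympair (mob a\<^sub>1 b\<^sub>1 z) (mob a\<^sub>2 b\<^sub>2 z)) ` {\<eta>\<^sub>1, \<eta>\<^sub>2}"
proof -
  let ?D = "h ` ball 0 1"
  have card: "card (royal_points ?D) = 2" and bd: "royal_points ?D \<subseteq> royal_boundary"
    using pb by (auto simp: purely_balanced_def)
  have "?D \<inter> royal_variety = {}"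
  proof (rule ccontr)
    assume "?D \<inter> royal_variety \<noteq> {}"
    then obtain q where q: "q \<in> ?D" "q \<in> royal_variety" by blast
    then have "q \<in> closure ?D" "q \<in> closure royal_variety"
      using subsetD[OF closure_subset q(1)] subsetD[OF closure_subset q(2)] by simp_all
    then have "q \<in> royal_boundary"
      using bd unfolding royal_points_def by blast
    moreover obtain x y where xy: "q = sympair x y"
      by (rule sympair_surj)
    ultimately show False
      using q(2) royal_variety_iff royal_boundary_iff by force
  qed
  then obtain a\<^sub>1 b\<^sub>1 a\<^sub>2 b\<^sub>2 where ab: "cmod b\<^sub>1 < cmod a\<^sub>1" "cmod b\<^sub>2 < cmod a\<^sub>2"
    and hz: "\<And>z. cmod z < 1 \<Longrightarrow> h z = sympair (mob a\<^sub>1 b\<^sub>1 z) (mob a\<^sub>2 b\<^sub>2 z) \<and> mob a\<^sub>1 b\<^sub>1 z \<noteq> mob a\<^sub>2 b\<^sub>2 z"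
    using geodesic_off_royal_variety[OF h] by metis
  define f\<^sub>1 f\<^sub>2 g where "f\<^sub>1 = mob a\<^sub>1 b\<^sub>1" and "f\<^sub>2 = mob a\<^sub>2 b\<^sub>2" and "g z = sympair (f\<^sub>1 z) (f\<^sub>2 z)" for z
  have cont: "continuous_on (cball 0 1) (mob a b)" if "cmod b < cmod a" for a b
    using mob_DERIV[OF that] by (intro continuous_at_imp_continuous_on) (auto intro!: DERIV_isCont)
  have "continuous_on (cball 0 1) g"
    unfolding g_def sympair_def f\<^sub>1_def f\<^sub>2_def by (intro continuous_intros cont ab)
  then have "closure (g ` ball 0 1) = g ` cball 0 1"
    by (rule closure_image_ball)
  moreover have "?D = g ` ball 0 1"
    by (rule image_cong) (use hz in \<open>auto simp: g_def f\<^sub>1_def f\<^sub>2_def\<close>)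
  ultimately have clD: "closure ?D = g ` cball 0 1"
    by simp
  define N where "N = {z. cmod z \<le> 1 \<and> f\<^sub>1 z = f\<^sub>2 z}"
  have f_le: "cmod (f\<^sub>1 z) \<le> 1" if "cmod z \<le> 1" for z
    using mob_less_1[OF ab(1), of z] mob_sphere[OF ab(1), of z] that unfolding f\<^sub>1_def by linarith
  have "g z \<in> closure royal_variety \<longleftrightarrow> f\<^sub>1 z = f\<^sub>2 z" if "cmod z \<le> 1" for z
    unfolding g_def closure_royal_variety_iff using f_le[OF that] by auto
  then have royal: "royal_points ?D = g ` N"
    unfolding royal_points_def clD N_def by auto
  have inj: "inj_on g N"
  proof (rule inj_onI)
    fix z w assume zw: "z \<in> N" "w \<in> N" "g z = g w"
    then have "f\<^sub>1 z = f\<^sub>1 w"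
      by (auto simp: g_def N_def sympair_eq_iff)
    then show "z = w"
      using zw mob_inj[OF ab(1), of z w] unfolding N_def f\<^sub>1_def by blast
  qed
  then have "card N = 2"
    using card royal card_image by metis
  then obtain \<eta>\<^sub>1 \<eta>\<^sub>2 where N: "N = {\<eta>\<^sub>1, \<eta>\<^sub>2}" "\<eta>\<^sub>1 \<noteq> \<eta>\<^sub>2"
    by (meson card_2_iff)
  have unit: "cmod z = 1" if z: "z \<in> N" for z
  proof -
    have "g z \<in> royal_boundary"
      using bd royal z by blast
    then have "cmod (f\<^sub>1 z) = 1"
      by (metis g_def royal_boundary_iff)
    then show ?thesis
      using mob_less_1[OF ab(1), of z] z unfolding f\<^sub>1_def N_def by force
  qed
  show ?thesis
  proof (rule that[OF ab hz N(2)])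
    show "cmod \<eta>\<^sub>1 = 1" "cmod \<eta>\<^sub>2 = 1"
      using unit N by auto
    show "mob a\<^sub>1 b\<^sub>1 z = mob a\<^sub>2 b\<^sub>2 z \<longleftrightarrow> z = \<eta>\<^sub>1 \<or> z = \<eta>\<^sub>2" if "cmod z \<le> 1" for z
      using N(1) that by (auto simp: N_def f\<^sub>1_def f\<^sub>2_def)
    show "royal_points (h ` ball 0 1) = (\<lambda>z. sympair (mob a\<^sub>1 b\<^sub>1 z) (mob a\<^sub>2 b\<^sub>2 z)) ` {\<eta>\<^sub>1, \<eta>\<^sub>2}"
      using royal by (simp add: N g_def f\<^sub>1_def f\<^sub>2_def)
  qed auto
qed

lemma sharp_at_param_iff:
  assumes h: "geodesic_param h" and ab: "cmod b\<^sub>1 < cmod a\<^sub>1" "cmod b\<^sub>2 < cmod a\<^sub>2"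
    and hz: "\<And>z. cmod z < 1 \<Longrightarrow> h z = sympair (mob a\<^sub>1 b\<^sub>1 z) (mob a\<^sub>2 b\<^sub>2 z) \<and> mob a\<^sub>1 b\<^sub>1 z \<noteq> mob a\<^sub>2 b\<^sub>2 z"
    and z: "cmod z < 1"
  shows "geodesic_tangent (h ` ball 0 1) (h z) = sharp_direction (h z)
    \<longleftrightarrow> Im (pair_form a\<^sub>1 b\<^sub>1 a\<^sub>2 b\<^sub>2 z) = 0"
proof -
  define f\<^sub>1 f\<^sub>2 where "f\<^sub>1 = mob a\<^sub>1 b\<^sub>1 z" and "f\<^sub>2 = mob a\<^sub>2 b\<^sub>2 z"
  define e\<^sub>1 e\<^sub>2 where "e\<^sub>1 = (a\<^sub>1 * cnj a\<^sub>1 - b\<^sub>1 * cnj b\<^sub>1) / (cnj b\<^sub>1 * z + cnj a\<^sub>1)\<^sup>2"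
    and "e\<^sub>2 = (a\<^sub>2 * cnj a\<^sub>2 - b\<^sub>2 * cnj b\<^sub>2) / (cnj b\<^sub>2 * z + cnj a\<^sub>2)\<^sup>2"
  define X\<^sub>1 X\<^sub>2 where "X\<^sub>1 = sharp_component f\<^sub>1 f\<^sub>2" and "X\<^sub>2 = sharp_component f\<^sub>2 f\<^sub>1"
  have le: "cmod z \<le> 1"
    using z by simp
  have der: "(mob a\<^sub>1 b\<^sub>1 has_field_derivative e\<^sub>1) (at z)" "(mob a\<^sub>2 b\<^sub>2 has_field_derivative e\<^sub>2) (at z)"
    unfolding e\<^sub>1_def e\<^sub>2_def by (rule mob_DERIV[OF _ le]; rule ab)+
  have "((\<lambda>\<zeta>. mob a\<^sub>1 b\<^sub>1 \<zeta> + mob a\<^sub>2 b\<^sub>2 \<zeta>) has_field_derivative e\<^sub>1 + e\<^sub>2) (at z)"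
    by (intro DERIV_add der)
  then have "((\<lambda>\<zeta>. fst (h \<zeta>)) has_field_derivative e\<^sub>1 + e\<^sub>2) (at z)"
    by (rule has_field_derivative_transform_within_open[where S = "ball 0 1"])
       (use z hz in \<open>auto simp: sympair_def\<close>)
  moreover have "((\<lambda>\<zeta>. mob a\<^sub>1 b\<^sub>1 \<zeta> * mob a\<^sub>2 b\<^sub>2 \<zeta>) has_field_derivative e\<^sub>1 * f\<^sub>2 + f\<^sub>1 * e\<^sub>2) (at z)"
    using DERIV_mult[OF der] by (simp add: f\<^sub>1_def f\<^sub>2_def algebra_simps)
  then have "((\<lambda>\<zeta>. snd (h \<zeta>)) has_field_derivative e\<^sub>1 * f\<^sub>2 + f\<^sub>1 * e\<^sub>2) (at z)"
    by (rule has_field_derivative_transform_within_open[where S = "ball 0 1"])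
       (use z hz in \<open>auto simp: sympair_def\<close>)
  ultimately have dh: "curve_deriv h z = (e\<^sub>1 + e\<^sub>2, e\<^sub>1 * f\<^sub>2 + f\<^sub>1 * e\<^sub>2)"
    by (simp add: curve_deriv_def DERIV_imp_deriv)
  have f: "cmod f\<^sub>1 < 1" "cmod f\<^sub>2 < 1" "f\<^sub>1 \<noteq> f\<^sub>2" "h z = sympair f\<^sub>1 f\<^sub>2"
    using mob_less_1[OF ab(1) z] mob_less_1[OF ab(2) z] hz[OF z] by (auto simp: f\<^sub>1_def f\<^sub>2_def)
  have "e\<^sub>1 \<noteq> 0"
    unfolding e\<^sub>1_def using mob_det_pos(3)[OF ab(1)] mob_denom_nonzero[OF ab(1) le] by simp
  have dh0: "curve_deriv h z \<noteq> 0"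
  proof
    assume "curve_deriv h z = 0"
    then have 1: "e\<^sub>2 = - e\<^sub>1" and 2: "e\<^sub>1 * f\<^sub>2 + f\<^sub>1 * e\<^sub>2 = 0"
      by (auto simp: dh zero_prod_def add_eq_0_iff)
    have "e\<^sub>1 * (f\<^sub>2 - f\<^sub>1) = 0"
      using 2 unfolding 1 by (simp add: algebra_simps)
    then show False
      using \<open>e\<^sub>1 \<noteq> 0\<close> f(3) by simp
  qed
  have "geodesic_tangent (h ` ball 0 1) (h z) = sharp_direction (h z) \<longleftrightarrow>
      fst (curve_deriv h z) * snd (sharp_vector f\<^sub>1 f\<^sub>2) = snd (curve_deriv h z) * fst (sharp_vector f\<^sub>1 f\<^sub>2)"
    unfolding geodesic_tangent_param[OF h z] unfolding f(4) sharp_direction_sympair[OF f(1-3)]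
    by (rule complex_line_eq_iff[OF dh0 sharp_vector_nonzero[OF f(1-3)]])
  also have "\<dots> \<longleftrightarrow> (f\<^sub>1 - f\<^sub>2) * (e\<^sub>1 * X\<^sub>2 - e\<^sub>2 * X\<^sub>1) = 0"
  proof -
    have "(e\<^sub>1 + e\<^sub>2) * (X\<^sub>1 * f\<^sub>2 + f\<^sub>1 * X\<^sub>2) - (e\<^sub>1 * f\<^sub>2 + f\<^sub>1 * e\<^sub>2) * (X\<^sub>1 + X\<^sub>2)
        = (f\<^sub>1 - f\<^sub>2) * (e\<^sub>1 * X\<^sub>2 - e\<^sub>2 * X\<^sub>1)"
      by (simp add: algebra_simps)
    then show ?thesis
      unfolding dh sharp_vector_def X\<^sub>1_def[symmetric] X\<^sub>2_def[symmetric] fst_conv snd_conv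
      by (metis eq_iff_diff_eq_0)
  qed
  also have "\<dots> \<longleftrightarrow> e\<^sub>1 * X\<^sub>2 = e\<^sub>2 * X\<^sub>1"
    using f(3) by simp
  also have "\<dots> \<longleftrightarrow> Im (pair_form a\<^sub>1 b\<^sub>1 a\<^sub>2 b\<^sub>2 z) = 0"
    unfolding e\<^sub>1_def e\<^sub>2_def X\<^sub>1_def X\<^sub>2_def f\<^sub>1_def f\<^sub>2_def by (rule sharp_iff_pair_form_real[OF ab z])
  finally show ?thesis .
qed

text \<open>The equation of the sharp points describes a line or circle orthogonal to the unit circle only if
  \<open>\<bar>\<beta>\<bar> < \<bar>\<gamma>\<bar>\<close>. This is where it matters that there are two royal nodes, and not more.\<close>

lemma sharp_set_param:
  assumes h: "geodesic_param h" and pb: "purely_balanced (h ` ball 0 1)"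
  obtains g \<beta> \<gamma> \<eta>\<^sub>1 \<eta>\<^sub>2 where "\<bar>\<beta>\<bar> < cmod \<gamma>" "holo_extension h g"
    "sharp_set (h ` ball 0 1) = h ` hyp_arc \<beta> \<gamma>"
    "hyperbolic_endpoints (hyp_arc \<beta> \<gamma>) = {\<eta>\<^sub>1, \<eta>\<^sub>2}" "\<eta>\<^sub>1 \<noteq> \<eta>\<^sub>2"
    "royal_points (h ` ball 0 1) = g ` {\<eta>\<^sub>1, \<eta>\<^sub>2}"
    "\<And>z x. cmod z \<le> 1 \<Longrightarrow> x \<in> {\<eta>\<^sub>1, \<eta>\<^sub>2} \<Longrightarrow> g z = g x \<Longrightarrow> z = x"
proof (rule purely_balanced_lift[OF h pb])
  fix a\<^sub>1 b\<^sub>1 a\<^sub>2 b\<^sub>2 \<eta>\<^sub>1 \<eta>\<^sub>2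
  assume ab: "cmod b\<^sub>1 < cmod a\<^sub>1" "cmod b\<^sub>2 < cmod a\<^sub>2"
    and hz: "\<And>z. cmod z < 1 \<Longrightarrow> h z = sympair (mob a\<^sub>1 b\<^sub>1 z) (mob a\<^sub>2 b\<^sub>2 z) \<and> mob a\<^sub>1 b\<^sub>1 z \<noteq> mob a\<^sub>2 b\<^sub>2 z"
    and \<eta>: "\<eta>\<^sub>1 \<noteq> \<eta>\<^sub>2" "cmod \<eta>\<^sub>1 = 1" "cmod \<eta>\<^sub>2 = 1"
    and nodes: "\<And>z. cmod z \<le> 1 \<Longrightarrow> mob a\<^sub>1 b\<^sub>1 z = mob a\<^sub>2 b\<^sub>2 z \<longleftrightarrow> z = \<eta>\<^sub>1 \<or> z = \<eta>\<^sub>2"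
    and royal: "royal_points (h ` ball 0 1) = (\<lambda>z. sympair (mob a\<^sub>1 b\<^sub>1 z) (mob a\<^sub>2 b\<^sub>2 z)) ` {\<eta>\<^sub>1, \<eta>\<^sub>2}"
  define g where "g z = sympair (mob a\<^sub>1 b\<^sub>1 z) (mob a\<^sub>2 b\<^sub>2 z)" for z
  define \<kappa> \<delta> where "\<kappa> = a\<^sub>1 * cnj a\<^sub>2 - cnj b\<^sub>1 * b\<^sub>2" and "\<delta> = a\<^sub>1 * cnj b\<^sub>2 - cnj b\<^sub>1 * a\<^sub>2"
  define \<beta> \<gamma> where "\<beta> = Im \<kappa>" and "\<gamma> = cnj (\<i> * \<delta>)"
  have Re\<gamma>: "Re (cnj \<gamma> * z) = - Im (\<delta> * z)" for z
    by (simp add: \<gamma>_def)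
  have circ: "z = \<eta>\<^sub>1 \<or> z = \<eta>\<^sub>2 \<longleftrightarrow> \<beta> = Re (cnj \<gamma> * z)" if "cmod z = 1" for z
    using nodes[of z] mob_eq_iff_on_circle[OF ab that] that
    unfolding Re\<gamma> \<beta>_def \<kappa>_def \<delta>_def by (simp add: add_eq_0_iff2)
  have less: "\<bar>\<beta>\<bar> < cmod \<gamma>"
  proof (rule ccontr)
    assume "\<not> \<bar>\<beta>\<bar> < cmod \<gamma>"
    then have ge: "cmod \<gamma> \<le> \<bar>\<beta>\<bar>" by simp
    have eq: "cnj \<gamma> * z = of_real \<beta>" if "cmod z = 1" "\<beta> = Re (cnj \<gamma> * z)" for z
    proof -
      have "cmod (cnj \<gamma> * z) = cmod \<gamma>"
        using that(1) by (simp add: norm_mult)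
      then have "(Re (cnj \<gamma> * z))\<^sup>2 + (Im (cnj \<gamma> * z))\<^sup>2 \<le> \<beta>\<^sup>2"
        using ge cmod_power2[of "cnj \<gamma> * z"] power_mono[OF ge, of 2] by simp
      then have "Im (cnj \<gamma> * z) = 0"
        unfolding that(2)[symmetric] by simp
      then show ?thesis
        using that(2) by (simp add: complex_eq_iff)
    qed
    have "cnj \<gamma> * \<eta>\<^sub>1 = cnj \<gamma> * \<eta>\<^sub>2"
      using eq circ \<eta> by metis
    then have "\<gamma> = 0"
      using \<eta>(1) by simp
    then have "\<beta> = 0"
      using circ[OF \<eta>(2)] by simp
    \<comment> \<open>now every point of the circle is a royal node, also a third one\<close>
    have all: "z = \<eta>\<^sub>1 \<or> z = \<eta>\<^sub>2" if "cmod z = 1" for z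
      using circ[OF that] \<open>\<gamma> = 0\<close> \<open>\<beta> = 0\<close> by simp
    have "{1, - 1, \<i>} \<subseteq> {\<eta>\<^sub>1, \<eta>\<^sub>2}"
      using all[of 1] all[of "- 1"] all[of \<i>] by auto
    then have "card {1, - 1, \<i>} \<le> card {\<eta>\<^sub>1, \<eta>\<^sub>2}"
      by (intro card_mono) auto
    moreover have "card {1, - 1, \<i>} = 3"
      by (auto simp: complex_eq_iff card_insert_if)
    moreover have "card {\<eta>\<^sub>1, \<eta>\<^sub>2} \<le> 2"
      by (simp add: card_insert_if)
    ultimately show False by simp
  qed
  have ends: "hyperbolic_endpoints (hyp_arc \<beta> \<gamma>) = {\<eta>\<^sub>1, \<eta>\<^sub>2}"
    unfolding hyperbolic_endpoints_hyp_arc[OF less] using circ \<eta> by auto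
  have real_iff: "Im (pair_form a\<^sub>1 b\<^sub>1 a\<^sub>2 b\<^sub>2 z) = 0 \<longleftrightarrow> z \<in> hyp_arc \<beta> \<gamma>" if "cmod z < 1" for z
  proof -
    have "Im (pair_form a\<^sub>1 b\<^sub>1 a\<^sub>2 b\<^sub>2 z) = Im \<kappa> * (1 + (cmod z)\<^sup>2) + 2 * Im (\<delta> * z)"
      unfolding pair_form_expand \<kappa>_def[symmetric] \<delta>_def[symmetric]
      by (simp add: complex_diff_cnj algebra_simps del: of_real_power)
    then show ?thesis
      unfolding hyp_arc_def Re\<gamma> \<beta>_def using that by auto
  qed
  have sharp: "sharp_set (h ` ball 0 1) = h ` hyp_arc \<beta> \<gamma>"
  proof -
    have "h z \<in> sharp_set (h ` ball 0 1) \<longleftrightarrow> z \<in> hyp_arc \<beta> \<gamma>" if "cmod z < 1" for z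
      using sharp_at_param_iff[OF h ab hz that] real_iff[OF that] that by (auto simp: sharp_set_def)
    moreover have "hyp_arc \<beta> \<gamma> \<subseteq> ball 0 1"
      by (auto simp: hyp_arc_def)
    moreover have "sharp_set (h ` ball 0 1) \<subseteq> h ` ball 0 1"
      by (auto simp: sharp_set_def)
    ultimately show ?thesis
      by (auto 0 3)
  qed
  have ext: "holo_extension h g"
    unfolding holo_extension_def
  proof (intro conjI exI[of _ "{z. cnj b\<^sub>1 * z + cnj a\<^sub>1 \<noteq> 0} \<inter> {z. cnj b\<^sub>2 * z + cnj a\<^sub>2 \<noteq> 0}"] ballI)
    show "open ({z. cnj b\<^sub>1 * z + cnj a\<^sub>1 \<noteq> 0} \<inter> {z. cnj b\<^sub>2 * z + cnj a\<^sub>2 \<noteq> 0})"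
      by (intro open_Int open_Collect_neq continuous_intros)
    show "cball 0 1 \<subseteq> {z. cnj b\<^sub>1 * z + cnj a\<^sub>1 \<noteq> 0} \<inter> {z. cnj b\<^sub>2 * z + cnj a\<^sub>2 \<noteq> 0}"
      using mob_denom_nonzero ab by auto
    show "holo_curve_on g ({z. cnj b\<^sub>1 * z + cnj a\<^sub>1 \<noteq> 0} \<inter> {z. cnj b\<^sub>2 * z + cnj a\<^sub>2 \<noteq> 0})"
      unfolding holo_curve_on_def g_def sympair_def mob_def by (auto intro!: holomorphic_intros)
  qed (use hz in \<open>auto simp: g_def\<close>)
  have node: "z = x" if "cmod z \<le> 1" "x \<in> {\<eta>\<^sub>1, \<eta>\<^sub>2}" "g z = g x" for z x
  proof -
    have x: "cmod x \<le> 1" "mob a\<^sub>1 b\<^sub>1 x = mob a\<^sub>2 b\<^sub>2 x"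
      using that(2) \<eta> nodes[of x] by auto
    then have "mob a\<^sub>1 b\<^sub>1 z = mob a\<^sub>1 b\<^sub>1 x"
      using that(3) by (auto simp: g_def sympair_eq_iff)
    then show ?thesis
      using mob_inj[OF ab(1) that(1) x(1)] by simp
  qed
  show ?thesis
    by (rule that[OF less ext sharp ends \<eta>(1) _ node]) (use royal in \<open>auto simp: g_def\<close>)
qed

theorem theorem1p6:
  fixes D :: "(complex \<times> complex) set"
  assumes "complex_geodesic D" and "purely_balanced D"
  shows "sharp_set D = Xi D \<and> sharp_set D \<subseteq> D \<and>
         simple_real_geodesic_with_endpoints (sharp_set D) (royal_points D)"
proof -
  obtain h\<^sub>0 where h0: "geodesic_param h\<^sub>0" and D: "D = h\<^sub>0 ` ball 0 1"
    using assms(1) by (auto simp: complex_geodesic_def)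
  obtain g\<^sub>0 \<beta>\<^sub>0 \<gamma>\<^sub>0 \<eta> \<eta>' where g0: "\<bar>\<beta>\<^sub>0\<bar> < cmod \<gamma>\<^sub>0" "holo_extension h\<^sub>0 g\<^sub>0"
    "sharp_set D = h\<^sub>0 ` hyp_arc \<beta>\<^sub>0 \<gamma>\<^sub>0"
    "hyperbolic_endpoints (hyp_arc \<beta>\<^sub>0 \<gamma>\<^sub>0) = {\<eta>, \<eta>'}" "royal_points D = g\<^sub>0 ` {\<eta>, \<eta>'}"
    using sharp_set_param[OF h0] assms(2) unfolding D by metis
  have sub: "sharp_set D \<subseteq> D"
    by (auto simp: sharp_set_def)
  have simple: "simple_real_geodesic_with_endpoints (sharp_set D) (royal_points D)"
    unfolding simple_real_geodesic_with_endpoints_def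
    using h0 g0 hyp_arc_imp_real_hyperbolic_geodesic[OF g0(1)] by metis
  have "Xi D = sharp_set D"
    unfolding Xi_def
  proof (rule the_equality)
    show "sharp_set D \<subseteq> D \<and> simple_real_geodesic_with_endpoints (sharp_set D) (royal_points D)"
      using sub simple by blast
    fix E assume E: "E \<subseteq> D \<and> simple_real_geodesic_with_endpoints E (royal_points D)"
    then obtain h g C where h: "geodesic_param h" "holo_extension h g" "real_hyperbolic_geodesic C"
      "E = h ` C" "royal_points D = g ` hyperbolic_endpoints C"
      unfolding simple_real_geodesic_with_endpoints_def by blast
    obtain \<beta> \<gamma> where C: "\<bar>\<beta>\<bar> < cmod \<gamma>" "C = hyp_arc \<beta> \<gamma>"
      using real_hyperbolic_geodesic_imp_hyp_arc[OF h(3)] by metis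
    have ends: "hyperbolic_endpoints C = {z. cmod z = 1 \<and> \<beta> = Re (cnj \<gamma> * z)}"
      unfolding C(2) by (rule hyperbolic_endpoints_hyp_arc[OF C(1)])
    have "hyperbolic_endpoints C \<noteq> {}"
      using h(5) g0(5) by auto
    then obtain \<zeta> where "cmod \<zeta> = 1" "\<beta> = Re (cnj \<gamma> * \<zeta>)"
      unfolding ends by blast
    then obtain \<xi> where \<xi>: "cmod \<xi> < 1" "\<xi> islimpt C"
      using hyp_arc_limit_point[OF C(1)] unfolding C(2) by metis
    have C_sub: "C \<subseteq> ball 0 1"
      unfolding C(2) hyp_arc_def by auto
    have "h ` C \<subseteq> h\<^sub>0 ` ball 0 1"
      using E h(4) D by blast
    then have Dh: "D = h ` ball 0 1"
      using geodesic_eq_if_contains_arc[OF h(1) h0 C_sub _ \<xi>(2,1)] D by simp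
    \<comment> \<open>now \<open>h\<close> itself parametrizes \<open>D\<close>, and \<open>C\<close> is the arc with the two royal nodes of \<open>h\<close> as endpoints\<close>
    obtain g' \<beta>' \<gamma>' \<eta>\<^sub>1 \<eta>\<^sub>2 where g': "\<bar>\<beta>'\<bar> < cmod \<gamma>'" "holo_extension h g'"
      "sharp_set D = h ` hyp_arc \<beta>' \<gamma>'"
      "hyperbolic_endpoints (hyp_arc \<beta>' \<gamma>') = {\<eta>\<^sub>1, \<eta>\<^sub>2}" "\<eta>\<^sub>1 \<noteq> \<eta>\<^sub>2"
      "royal_points D = g' ` {\<eta>\<^sub>1, \<eta>\<^sub>2}"
      "\<And>z x. cmod z \<le> 1 \<Longrightarrow> x \<in> {\<eta>\<^sub>1, \<eta>\<^sub>2} \<Longrightarrow> g' z = g' x \<Longrightarrow> z = x"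
      using sharp_set_param[OF h(1)] assms(2) unfolding Dh by metis
    have "\<eta>\<^sub>1 \<in> hyperbolic_endpoints C \<and> \<eta>\<^sub>2 \<in> hyperbolic_endpoints C"
    proof -
      have "x \<in> hyperbolic_endpoints C" if x: "x \<in> {\<eta>\<^sub>1, \<eta>\<^sub>2}" for x
      proof -
        have "g' x \<in> g ` hyperbolic_endpoints C"
          using x g'(6) h(5) by auto
        then obtain y where y: "y \<in> hyperbolic_endpoints C" "g' x = g y" by blast
        then have "cmod y \<le> 1"
          unfolding ends by simp
        then have "y = x"
          using g'(7)[OF _ x] y(2) holo_extension_unique[OF h(2) g'(2)] by metis
        then show ?thesis
          using y(1) by simp
      qed
      then show ?thesis by simp
    qed
    then have "\<beta> = Re (cnj \<gamma> * \<eta>\<^sub>1)" "\<beta> = Re (cnj \<gamma> * \<eta>\<^sub>2)"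
      unfolding ends by auto
    moreover have "\<beta>' = Re (cnj \<gamma>' * \<eta>\<^sub>1)" "\<beta>' = Re (cnj \<gamma>' * \<eta>\<^sub>2)"
      using g'(4) unfolding hyperbolic_endpoints_hyp_arc[OF g'(1)] by blast+
    ultimately have "C = hyp_arc \<beta>' \<gamma>'"
      unfolding C(2) using hyp_arc_determined_by_endpoints[OF C(1) g'(5)]
        hyp_arc_determined_by_endpoints[OF g'(1) g'(5)] by metis
    then show "E = sharp_set D"
      using h(4) g'(3) by simp
  qed
  then show ?thesis
    using sub simple by simp
qed

end
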